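(* Let $V$ be a complete and cocomplete closed symmetric monoidal category, and let $F:\mathtt O\to\mathtt P$ be a discrete operadic fibration of operadic categories. Then the assignment $\mathcal O\mapsto F_!\mathcal O$, where $$F_!\mathcal O(T)=\coprod_{F(t)=T}\mathcal O(t),\qquad T\in\mathtt P,$$ with the $\mathtt P$-operad structure described in the context, defines a left adjoint $F_!:\mathrm{Op}^{\mathtt O}(V)\to\mathrm{Op}^{\mathtt P}(V)$ to the restriction functor $F^*:\mathrm{Op}^{\mathtt P}(V)\to\mathrm{Op}^{\mathtt O}(V)$.
   Context: **Operadic category.** $\mathtt{sFSet}$ is the category of the sets $\bar n=\{1,\dots,n\}$, $n\ge0$, and all maps; the fiber $f^{-1}(i)$ of a map is the object $\bar n_i$ order-isomorphic to the preimage of $i$. A (strict) operadic category is a category $\mathtt O$ with a functor $|\cdot|:\mathtt O\to\mathtt{sFSet}$, a chosen terminal object $U_c$ in each connected component $c\in\pi_0(\mathtt O)$ and, for each $f:T\to S$ and $i\in|S|$, an object $f^{-1}(i)$ (the $i$-th fiber) with $|f^{-1}(i)|=|f|^{-1}(i)$, such that: - (i) $|U_c|=\bar1$. - (ii) All fibers of identities are chosen terminal objects. - (iii) For $f:T\to S$, $g:S\to R$, $h=gf$, $i\in|R|$ there is given $f_i:h^{-1}(i)\to g^{-1}(i)$ with $|f_i|$ the map induced by $|f|$, forming a functor $\mathrm{Fib}_i:\mathtt O/R\to\mathtt O$; for $R=U_c$, $\mathrm{Fib}_1$ is the domain functor. - (iv) $f^{-1}(j)=f_{|g|(j)}^{-1}(j)$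 for $j\in|S|$. - (v) For $f:T\to S$, $a:S\to Q$, $c:Q\to R$, $b=af$, $g=ca$, $h=cb$, $j\in|Q|$, $i=|c|(j)$, one has $(f_i)_j=f_j:b^{-1}(j)\to a^{-1}(j)$, where $f_j$ is induced by the triangle over $Q$ and $(f_i)_j$ by the triangle $h^{-1}(i)\to g^{-1}(i)\to c^{-1}(i)$. An operadic functor is a functor over $\mathtt{sFSet}$ preserving fibers, $F(f^{-1}(i))=F(f)^{-1}(i)$, the induced maps, $F(f_i)=F(f)_i$, and the chosen terminal objects. **Operads.** An $\mathtt O$-operad $\mathcal P$ in $V$ consists of objects $\mathcal P(T)$, $T\in\mathtt O$, units $I\to\mathcal P(U_c)$ and maps $\mu(f):\mathcal P(f)\otimes\mathcal P(S)\to\mathcal P(T)$ for $f:T\to S$, where $\mathcal P(f)=\bigotimes_{i\in|S|}\mathcal P(f^{-1}(i))$. Axioms: for $T\xrightarrow fS\xrightarrow gR$, $h=gf$, $\mu(f)\circ(\mathrm{id}\otimes\mu(g))=\mu(h)\circ(\bigotimes_{i\in|R|}\mu(f_i)\otimes\mathrm{id})$ on $\bigotimes_i\mathcal P(f_i)\otimes\mathcal P(g)\otimes\mathcal P(R)$ (using $\bigotimes_i\mathcal P(f_i)\cong\mathcal P(f)$); and the composites $\mathcal P(T)\to\mathcal P(\mathrm{id}_T)\otimes\mathcal P(T)\xrightarrow{\mu(\mathrm{id})}\mathcal P(T)$ and $\mathcal P(T)\to\mathcal P(T)\otimes\mathcal P(U_c)\xrightarrow{\mu(T\to U_c)}\mathcal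 P(T)$, formed with the units, are identities. Morphisms are families of maps commuting with all structure; $\mathrm{Op}^{\mathtt O}(V)$ is the resulting category. For an operadic functor $F:\mathtt O\to\mathtt P$, $F^*\mathcal P(t)=\mathcal P(F(t))$. **Discrete operadic fibration.** An operadic functor $F:\mathtt O\to\mathtt P$ such that (i) $F$ induces a surjection $\pi_0(\mathtt O)\to\pi_0(\mathtt P)$; (ii) for any $f:T\to S$ in $\mathtt P$ and $s,t_i\in\mathtt O$ ($i\in|S|$) with $F(s)=S$, $F(t_i)=f^{-1}(i)$, there is a unique $\sigma:t\to s$ in $\mathtt O$ with $F(\sigma)=f$ and $\sigma^{-1}(i)=t_i$ for all $i$. (Such $F$ induces a bijection on $\pi_0$.) **Operad structure on $F_!\mathcal O$.** For $f:T\to S$ in $\mathtt P$, the restriction of $\mu(f)$ to the summand $\bigotimes_i\mathcal O(t_i)\otimes\mathcal O(s)$ with $F(t_i)=f^{-1}(i)$, $F(s)=S$ is $\mu(\sigma):\bigotimes_i\mathcal O(t_i)\otimes\mathcal O(s)\to\mathcal O(t)$ followed by the inclusion $\mathcal O(t)\to F_!\mathcal O(T)$, with $\sigma:t\to s$ the unique lift in (ii). The unit is $I\to\mathcal O(V_a)\to F_!\mathcal O(U_c)$, with $V_a$ the unique chosen terminal object with $F(V_a)=U_c$. *)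

theory Defs
  imports Main "HOL-Library.FuncSet" "HOL-Library.Multiset"
begin

section \<open>Categories, functors, limits, adjunctions\<close>

record ('o, 'a) cat =
  Obj :: "'o set"
  Arr :: "'a set"
  Dom :: "'a \<Rightarrow> 'o"
  Cod :: "'a \<Rightarrow> 'o"
  Ide :: "'o \<Rightarrow> 'a"
  Comp :: "'a \<Rightarrow> 'a \<Rightarrow> 'a"  (infixr "\<cdot>\<index>" 75)

text \<open>Composition is in applicative order: \<open>g \<cdot>\<^bsub>C\<^esub> f\<close> is \<open>f\<close> followed by \<open>g\<close>.\<close>

definition hom :: "('o, 'a, 'x) cat_scheme \<Rightarrow> 'o \<Rightarrow> 'o \<Rightarrow> 'a set" where
  "hom C A B = {f \<in> Arr C. Dom C f = A \<and> Cod C f = B}"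

locale category =
  fixes C :: "('o, 'a, 'x) cat_scheme" (structure)
  assumes Dom_Obj: "f \<in> Arr C \<Longrightarrow> Dom C f \<in> Obj C"
    and Cod_Obj: "f \<in> Arr C \<Longrightarrow> Cod C f \<in> Obj C"
    and Ide_hom: "A \<in> Obj C \<Longrightarrow> Ide C A \<in> hom C A A"
    and Comp_hom: "f \<in> hom C A B \<Longrightarrow> g \<in> hom C B D \<Longrightarrow> g \<cdot> f \<in> hom C A D"
    and Comp_Ide: "f \<in> hom C A B \<Longrightarrow> f \<cdot> Ide C A = f"
    and Ide_Comp: "f \<in> hom C A B \<Longrightarrow> Ide C B \<cdot> f = f"
    and Comp_assoc: "f \<in> hom C A B \<Longrightarrow> g \<in> hom C B D \<Longrightarrow> h \<in> hom C D E \<Longrightarrow>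
      (h \<cdot> g) \<cdot> f = h \<cdot> (g \<cdot> f)"

definition inverse_arrows :: "('o, 'a, 'x) cat_scheme \<Rightarrow> 'a \<Rightarrow> 'a \<Rightarrow> bool" where
  "inverse_arrows C f g \<longleftrightarrow> f \<in> Arr C \<and> g \<in> hom C (Cod C f) (Dom C f) \<and>
     g \<cdot>\<^bsub>C\<^esub> f = Ide C (Dom C f) \<and> f \<cdot>\<^bsub>C\<^esub> g = Ide C (Cod C f)"

definition is_iso :: "('o, 'a, 'x) cat_scheme \<Rightarrow> 'a \<Rightarrow> bool" where
  "is_iso C f \<longleftrightarrow> (\<exists>g. inverse_arrows C f g)"

record ('o, 'a, 'p, 'b) fct =
  FO :: "'o \<Rightarrow> 'p"
  FA :: "'a \<Rightarrow> 'b"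

definition is_functor ::
  "('o, 'a, 'x) cat_scheme \<Rightarrow> ('p, 'b, 'y) cat_scheme \<Rightarrow> ('o, 'a, 'p, 'b) fct \<Rightarrow> bool" where
  "is_functor C D F \<longleftrightarrow> category C \<and> category D \<and>
     (\<forall>A\<in>Obj C. FO F A \<in> Obj D) \<and>
     (\<forall>f\<in>Arr C. FA F f \<in> hom D (FO F (Dom C f)) (FO F (Cod C f))) \<and>
     (\<forall>A\<in>Obj C. FA F (Ide C A) = Ide D (FO F A)) \<and>
     (\<forall>f\<in>Arr C. \<forall>g\<in>Arr C. Dom C g = Cod C f \<longrightarrow>
        FA F (g \<cdot>\<^bsub>C\<^esub> f) = FA F g \<cdot>\<^bsub>D\<^esub> FA F f)"

definition is_cone ::
  "('j, 'k, 'y) cat_scheme \<Rightarrow> ('o, 'a, 'x) cat_scheme \<Rightarrow> ('j, 'k, 'o, 'a) fct \<Rightarrow>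
   'o \<Rightarrow> ('j \<Rightarrow> 'a) \<Rightarrow> bool" where
  "is_cone J C D L p \<longleftrightarrow> L \<in> Obj C \<and> (\<forall>j\<in>Obj J. p j \<in> hom C L (FO D j)) \<and>
     (\<forall>u\<in>Arr J. FA D u \<cdot>\<^bsub>C\<^esub> p (Dom J u) = p (Cod J u))"

definition is_limit ::
  "('j, 'k, 'y) cat_scheme \<Rightarrow> ('o, 'a, 'x) cat_scheme \<Rightarrow> ('j, 'k, 'o, 'a) fct \<Rightarrow>
   'o \<Rightarrow> ('j \<Rightarrow> 'a) \<Rightarrow> bool" where
  "is_limit J C D L p \<longleftrightarrow> is_cone J C D L p \<and>
     (\<forall>M q. is_cone J C D M q \<longrightarrow> (\<exists>!m. m \<in> hom C M L \<and> (\<forall>j\<in>Obj J. p j \<cdot>\<^bsub>C\<^esub> m = q j)))"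

definition is_cocone ::
  "('j, 'k, 'y) cat_scheme \<Rightarrow> ('o, 'a, 'x) cat_scheme \<Rightarrow> ('j, 'k, 'o, 'a) fct \<Rightarrow>
   'o \<Rightarrow> ('j \<Rightarrow> 'a) \<Rightarrow> bool" where
  "is_cocone J C D L p \<longleftrightarrow> L \<in> Obj C \<and> (\<forall>j\<in>Obj J. p j \<in> hom C (FO D j) L) \<and>
     (\<forall>u\<in>Arr J. p (Cod J u) \<cdot>\<^bsub>C\<^esub> FA D u = p (Dom J u))"

definition is_colimit ::
  "('j, 'k, 'y) cat_scheme \<Rightarrow> ('o, 'a, 'x) cat_scheme \<Rightarrow> ('j, 'k, 'o, 'a) fct \<Rightarrow>
   'o \<Rightarrow> ('j \<Rightarrow> 'a) \<Rightarrow> bool" where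
  "is_colimit J C D L p \<longleftrightarrow> is_cocone J C D L p \<and>
     (\<forall>M q. is_cocone J C D M q \<longrightarrow> (\<exists>!m. m \<in> hom C L M \<and> (\<forall>j\<in>Obj J. m \<cdot>\<^bsub>C\<^esub> p j = q j)))"

text \<open>
  Size is measured by an arbitrary type \<open>'u\<close>: a category is small if its objects and its arrows
  each inject into \<open>'u\<close>, and (co)completeness refers to diagrams of small shape. Up to isomorphism
  the small shapes are the categories with objects and arrows in \<open>'u\<close>.
\<close>

definition small_category :: "'u itself \<Rightarrow> ('o, 'a, 'x) cat_scheme \<Rightarrow> bool" where
  "small_category U C \<longleftrightarrow>
     (\<exists>h :: 'o \<Rightarrow> 'u. inj_on h (Obj C)) \<and> (\<exists>k :: 'a \<Rightarrow> 'u. inj_on k (Arr C))"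

definition complete_category :: "'u itself \<Rightarrow> ('o, 'a, 'x) cat_scheme \<Rightarrow> bool" where
  "complete_category U C \<longleftrightarrow>
     (\<forall>(J :: ('u, 'u) cat) D. is_functor J C D \<longrightarrow> (\<exists>L p. is_limit J C D L p))"

definition cocomplete_category :: "'u itself \<Rightarrow> ('o, 'a, 'x) cat_scheme \<Rightarrow> bool" where
  "cocomplete_category U C \<longleftrightarrow>
     (\<forall>(J :: ('u, 'u) cat) D. is_functor J C D \<longrightarrow> (\<exists>L p. is_colimit J C D L p))"

definition is_coproduct ::
  "('o, 'a, 'x) cat_scheme \<Rightarrow> 'i set \<Rightarrow> ('i \<Rightarrow> 'o) \<Rightarrow> 'o \<times> ('i \<Rightarrow> 'a) \<Rightarrow> bool" where
  "is_coproduct C A X = (\<lambda>(K, inj). K \<in> Obj C \<and> (\<forall>i\<in>A. inj i \<in> hom C (X i) K) \<and>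
     (\<forall>M q. M \<in> Obj C \<and> (\<forall>i\<in>A. q i \<in> hom C (X i) M) \<longrightarrow>
        (\<exists>!m. m \<in> hom C K M \<and> (\<forall>i\<in>A. m \<cdot>\<^bsub>C\<^esub> inj i = q i))))"

text \<open>A choice of coproduct object together with its inclusions.\<close>

definition coprod ::
  "('o, 'a, 'x) cat_scheme \<Rightarrow> 'i set \<Rightarrow> ('i \<Rightarrow> 'o) \<Rightarrow> 'o \<times> ('i \<Rightarrow> 'a)" where
  "coprod C A X = (SOME K. is_coproduct C A X K)"

definition is_left_adjoint ::
  "('o, 'a, 'x) cat_scheme \<Rightarrow> ('p, 'b, 'y) cat_scheme \<Rightarrow>
   ('o, 'a, 'p, 'b) fct \<Rightarrow> ('p, 'b, 'o, 'a) fct \<Rightarrow> bool" where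
  "is_left_adjoint C D L R \<longleftrightarrow> is_functor C D L \<and> is_functor D C R \<and>
     (\<exists>\<Phi>. (\<forall>c\<in>Obj C. \<forall>d\<in>Obj D. bij_betw (\<Phi> c d) (hom D (FO L c) d) (hom C c (FO R d))) \<and>
          (\<forall>u\<in>Arr C. \<forall>v\<in>Arr D. \<forall>f\<in>hom D (FO L (Cod C u)) (Dom D v).
             \<Phi> (Dom C u) (Cod D v) (v \<cdot>\<^bsub>D\<^esub> f \<cdot>\<^bsub>D\<^esub> FA L u) =
             FA R v \<cdot>\<^bsub>C\<^esub> \<Phi> (Cod C u) (Dom D v) f \<cdot>\<^bsub>C\<^esub> u))"

definition connected_rel :: "('o, 'a, 'x) cat_scheme \<Rightarrow> ('o \<times> 'o) set" where
  "connected_rel C = {(A, B). A \<in> Obj C \<and> B \<in> Obj C \<and>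
     (A, B) \<in> {(X, Y). hom C X Y \<noteq> {} \<or> hom C Y X \<noteq> {}}\<^sup>*}"

definition component :: "('o, 'a, 'x) cat_scheme \<Rightarrow> 'o \<Rightarrow> 'o set" where
  "component C A = connected_rel C `` {A}"

definition pi0 :: "('o, 'a, 'x) cat_scheme \<Rightarrow> 'o set set" where
  "pi0 C = Obj C // connected_rel C"

text \<open>The induced map on components: all members of the union below coincide.\<close>

definition pi0_map ::
  "('p, 'b, 'y) cat_scheme \<Rightarrow> ('o, 'a, 'p, 'b) fct \<Rightarrow> 'o set \<Rightarrow> 'p set" where
  "pi0_map D F c = (\<Union>x\<in>c. component D (FO F x))"


section \<open>Symmetric monoidal closed categories\<close>

record ('o, 'a) smc = "('o, 'a) cat" +
  TensO :: "'o \<Rightarrow> 'o \<Rightarrow> 'o"  (infixr "\<otimes>\<index>" 80)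
  TensA :: "'a \<Rightarrow> 'a \<Rightarrow> 'a"  (infixr "\<odot>\<index>" 80)
  UnitO :: "'o"
  Assoc :: "'o \<Rightarrow> 'o \<Rightarrow> 'o \<Rightarrow> 'a"
  LUnit :: "'o \<Rightarrow> 'a"
  RUnit :: "'o \<Rightarrow> 'a"
  Braid :: "'o \<Rightarrow> 'o \<Rightarrow> 'a"

locale symmetric_monoidal_category = category V
  for V :: "('o, 'a) smc" (structure) +
  assumes TensO_Obj: "A \<in> Obj V \<Longrightarrow> B \<in> Obj V \<Longrightarrow> A \<otimes> B \<in> Obj V"
    and TensA_hom: "f \<in> hom V A B \<Longrightarrow> g \<in> hom V A' B' \<Longrightarrow> f \<odot> g \<in> hom V (A \<otimes> A') (B \<otimes> B')"
    and TensA_Ide: "A \<in> Obj V \<Longrightarrow> B \<in> Obj V \<Longrightarrow> Ide V A \<odot> Ide V B = Ide V (A \<otimes> B)"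
    and TensA_Comp: "f \<in> hom V A B \<Longrightarrow> g \<in> hom V B D \<Longrightarrow> f' \<in> hom V A' B' \<Longrightarrow> g' \<in> hom V B' D' \<Longrightarrow>
      (g \<cdot> f) \<odot> (g' \<cdot> f') = (g \<odot> g') \<cdot> (f \<odot> f')"
    and UnitO_Obj: "UnitO V \<in> Obj V"
    and Assoc_hom: "A \<in> Obj V \<Longrightarrow> B \<in> Obj V \<Longrightarrow> D \<in> Obj V \<Longrightarrow>
      Assoc V A B D \<in> hom V ((A \<otimes> B) \<otimes> D) (A \<otimes> (B \<otimes> D))"
    and Assoc_iso: "A \<in> Obj V \<Longrightarrow> B \<in> Obj V \<Longrightarrow> D \<in> Obj V \<Longrightarrow> is_iso V (Assoc V A B D)"
    and Assoc_natural: "f \<in> hom V A A' \<Longrightarrow> g \<in> hom V B B' \<Longrightarrow> h \<in> hom V D D' \<Longrightarrow>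
      Assoc V A' B' D' \<cdot> ((f \<odot> g) \<odot> h) = (f \<odot> (g \<odot> h)) \<cdot> Assoc V A B D"
    and LUnit_hom: "A \<in> Obj V \<Longrightarrow> LUnit V A \<in> hom V (UnitO V \<otimes> A) A"
    and LUnit_iso: "A \<in> Obj V \<Longrightarrow> is_iso V (LUnit V A)"
    and LUnit_natural: "f \<in> hom V A B \<Longrightarrow> LUnit V B \<cdot> (Ide V (UnitO V) \<odot> f) = f \<cdot> LUnit V A"
    and RUnit_hom: "A \<in> Obj V \<Longrightarrow> RUnit V A \<in> hom V (A \<otimes> UnitO V) A"
    and RUnit_iso: "A \<in> Obj V \<Longrightarrow> is_iso V (RUnit V A)"
    and RUnit_natural: "f \<in> hom V A B \<Longrightarrow> RUnit V B \<cdot> (f \<odot> Ide V (UnitO V)) = f \<cdot> RUnit V A"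
    and Braid_hom: "A \<in> Obj V \<Longrightarrow> B \<in> Obj V \<Longrightarrow> Braid V A B \<in> hom V (A \<otimes> B) (B \<otimes> A)"
    and Braid_natural: "f \<in> hom V A A' \<Longrightarrow> g \<in> hom V B B' \<Longrightarrow>
      Braid V A' B' \<cdot> (f \<odot> g) = (g \<odot> f) \<cdot> Braid V A B"
    and pentagon: "A \<in> Obj V \<Longrightarrow> B \<in> Obj V \<Longrightarrow> D \<in> Obj V \<Longrightarrow> E \<in> Obj V \<Longrightarrow>
      Assoc V A B (D \<otimes> E) \<cdot> Assoc V (A \<otimes> B) D E =
      (Ide V A \<odot> Assoc V B D E) \<cdot> Assoc V A (B \<otimes> D) E \<cdot> (Assoc V A B D \<odot> Ide V E)"
    and triangle: "A \<in> Obj V \<Longrightarrow> B \<in> Obj V \<Longrightarrow>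
      (Ide V A \<odot> LUnit V B) \<cdot> Assoc V A (UnitO V) B = RUnit V A \<odot> Ide V B"
    and hexagon: "A \<in> Obj V \<Longrightarrow> B \<in> Obj V \<Longrightarrow> D \<in> Obj V \<Longrightarrow>
      Assoc V B D A \<cdot> Braid V A (B \<otimes> D) \<cdot> Assoc V A B D =
      (Ide V B \<odot> Braid V A D) \<cdot> Assoc V B A D \<cdot> (Braid V A B \<odot> Ide V D)"
    and symmetry: "A \<in> Obj V \<Longrightarrow> B \<in> Obj V \<Longrightarrow> Braid V B A \<cdot> Braid V A B = Ide V (A \<otimes> B)"

definition is_closed :: "('o, 'a) smc \<Rightarrow> bool" where
  "is_closed V \<longleftrightarrow> (\<forall>B\<in>Obj V. \<forall>D\<in>Obj V. \<exists>H\<in>Obj V. \<exists>ev\<in>hom V (H \<otimes>\<^bsub>V\<^esub> B) D.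
     \<forall>A\<in>Obj V. \<forall>f\<in>hom V (A \<otimes>\<^bsub>V\<^esub> B) D.
       \<exists>!g. g \<in> hom V A H \<and> ev \<cdot>\<^bsub>V\<^esub> (g \<odot>\<^bsub>V\<^esub> Ide V B) = f)"


subsection \<open>Iterated tensor products and canonical isomorphisms\<close>

datatype 'l tword = One | Leaf 'l | Times "'l tword" "'l tword"

primrec tobj :: "('o, 'a) smc \<Rightarrow> ('l \<Rightarrow> 'o) \<Rightarrow> 'l tword \<Rightarrow> 'o" where
  "tobj V X One = UnitO V"
| "tobj V X (Leaf l) = X l"
| "tobj V X (Times v w) = tobj V X v \<otimes>\<^bsub>V\<^esub> tobj V X w"

primrec tarr :: "('o, 'a) smc \<Rightarrow> ('l \<Rightarrow> 'a) \<Rightarrow> 'l tword \<Rightarrow> 'a" where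
  "tarr V h One = Ide V (UnitO V)"
| "tarr V h (Leaf l) = h l"
| "tarr V h (Times v w) = tarr V h v \<odot>\<^bsub>V\<^esub> tarr V h w"

fun tens :: "'l tword list \<Rightarrow> 'l tword" where
  "tens [] = One"
| "tens [w] = w"
| "tens (w # w' # ws) = Times w (tens (w' # ws))"

text \<open>\<open>bigO V n X\<close> and \<open>bigA V n h\<close> are the tensor products of \<open>X 1, \<dots>, X n\<close> and \<open>h 1, \<dots>, h n\<close>.\<close>

definition bigO :: "('o, 'a) smc \<Rightarrow> nat \<Rightarrow> (nat \<Rightarrow> 'o) \<Rightarrow> 'o" where
  "bigO V n X = tobj V X (tens (map Leaf [1..<Suc n]))"

definition bigA :: "('o, 'a) smc \<Rightarrow> nat \<Rightarrow> (nat \<Rightarrow> 'a) \<Rightarrow> 'a" where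
  "bigA V n h = tarr V h (tens (map Leaf [1..<Suc n]))"

text \<open>
  \<open>canonical V X v w \<phi>\<close>: \<open>\<phi>\<close> is a composite of instances of the structure isomorphisms of \<open>V\<close>
  leading from the word \<open>v\<close> to the word \<open>w\<close>. It is used only for words \<open>v\<close>, \<open>w\<close> with the same
  pairwise distinct leaves. Then such a \<open>\<phi>\<close> exists (\<open>canonical_exists\<close> below), and by Mac Lane's
  coherence theorem it is unique.
\<close>

inductive canonical :: "('o, 'a) smc \<Rightarrow> ('l \<Rightarrow> 'o) \<Rightarrow> 'l tword \<Rightarrow> 'l tword \<Rightarrow> 'a \<Rightarrow> bool"
  for V X where
  can_Ide: "canonical V X w w (Ide V (tobj V X w))"
| can_Comp: "canonical V X u v \<phi> \<Longrightarrow> canonical V X v w \<psi> \<Longrightarrow> canonical V X u w (\<psi> \<cdot>\<^bsub>V\<^esub> \<phi>)"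
| can_Tens: "canonical V X v w \<phi> \<Longrightarrow> canonical V X v' w' \<psi> \<Longrightarrow>
    canonical V X (Times v v') (Times w w') (\<phi> \<odot>\<^bsub>V\<^esub> \<psi>)"
| can_inv: "canonical V X v w \<phi> \<Longrightarrow> inverse_arrows V \<phi> \<psi> \<Longrightarrow> canonical V X w v \<psi>"
| can_Assoc: "canonical V X (Times (Times u v) w) (Times u (Times v w))
    (Assoc V (tobj V X u) (tobj V X v) (tobj V X w))"
| can_LUnit: "canonical V X (Times One w) w (LUnit V (tobj V X w))"
| can_RUnit: "canonical V X (Times w One) w (RUnit V (tobj V X w))"
| can_Braid: "canonical V X (Times v w) (Times w v) (Braid V (tobj V X v) (tobj V X w))"

primrec leaves :: "'l tword \<Rightarrow> 'l list" where
  "leaves One = []"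
| "leaves (Leaf l) = [l]"
| "leaves (Times v w) = leaves v @ leaves w"

lemma leaves_tens: "leaves (tens ws) = concat (map leaves ws)"
  by (induction ws rule: tens.induct) auto

lemma tobj_cong: "(\<And>l. l \<in> set (leaves w) \<Longrightarrow> X l = Y l) \<Longrightarrow> tobj V X w = tobj V Y w"
  by (induction w) auto

lemma canonical_leaves: "canonical V X v w \<phi> \<Longrightarrow> mset (leaves v) = mset (leaves w)"
  by (induction rule: canonical.induct) auto

lemma canonical_cong:
  assumes "canonical V X v w \<phi>" "\<And>l. l \<in> set (leaves v) \<Longrightarrow> X l = Y l"
  shows "canonical V Y v w \<phi>"
  using assms
proof (induction rule: canonical.induct)
  case (can_Ide w)
  then show ?case using canonical.can_Ide[of V Y w] tobj_cong[of w X Y V] by simp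
next
  case (can_Comp u v \<phi> w \<psi>)
  from can_Comp.hyps(1) have "set (leaves u) = set (leaves v)"
    by (metis canonical_leaves set_mset_mset)
  with can_Comp show ?case by (auto intro: canonical.can_Comp)
next
  case (can_inv v w \<phi> \<psi>)
  from can_inv.hyps(1) have "set (leaves v) = set (leaves w)"
    by (metis canonical_leaves set_mset_mset)
  with can_inv show ?case by (auto intro: canonical.can_inv)
next
  case (can_Assoc u v w)
  then have "tobj V X u = tobj V Y u" "tobj V X v = tobj V Y v" "tobj V X w = tobj V Y w"
    by (auto intro!: tobj_cong)
  then show ?case using canonical.can_Assoc[of V Y u v w] by simp
next
  case (can_LUnit w)
  then show ?case using canonical.can_LUnit[of V Y w] tobj_cong[of w X Y V] by simp
next
  case (can_RUnit w)
  then show ?case using canonical.can_RUnit[of V Y w] tobj_cong[of w X Y V] by simp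
next
  case (can_Braid v w)
  then have "tobj V X v = tobj V Y v" "tobj V X w = tobj V Y w"
    by (auto intro!: tobj_cong)
  then show ?case using canonical.can_Braid[of V Y v w] by simp
qed (auto intro: canonical.can_Tens)

context symmetric_monoidal_category
begin

lemma tobj_Obj: "(\<And>l. X l \<in> Obj V) \<Longrightarrow> tobj V X w \<in> Obj V"
  by (induction w) (auto simp: UnitO_Obj TensO_Obj)

lemma Braid_iso: "A \<in> Obj V \<Longrightarrow> B \<in> Obj V \<Longrightarrow> inverse_arrows V (Braid V A B) (Braid V B A)"
  using Braid_hom[of A B] Braid_hom[of B A] symmetry[of A B] symmetry[of B A]
  by (auto simp: inverse_arrows_def hom_def)

lemma inverse_Comp:
  assumes "\<phi> \<in> hom V A B" "\<psi> \<in> hom V B D" "inverse_arrows V \<phi> \<phi>'" "inverse_arrows V \<psi> \<psi>'"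
  shows "inverse_arrows V (\<psi> \<cdot> \<phi>) (\<phi>' \<cdot> \<psi>')"
proof -
  have h: "\<phi>' \<in> hom V B A" "\<psi>' \<in> hom V D B"
    and e: "\<phi>' \<cdot> \<phi> = Ide V A" "\<phi> \<cdot> \<phi>' = Ide V B" "\<psi>' \<cdot> \<psi> = Ide V B" "\<psi> \<cdot> \<psi>' = Ide V D"
    using assms by (auto simp: inverse_arrows_def hom_def)
  have c: "\<psi> \<cdot> \<phi> \<in> hom V A D" "\<phi>' \<cdot> \<psi>' \<in> hom V D A" "\<psi>' \<cdot> \<psi> \<in> hom V B B"
    using assms h Comp_hom by blast+
  have "(\<phi>' \<cdot> \<psi>') \<cdot> (\<psi> \<cdot> \<phi>) = \<phi>' \<cdot> (\<psi>' \<cdot> (\<psi> \<cdot> \<phi>))"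
    using Comp_assoc[OF c(1) h(2) h(1)] .
  also have "\<dots> = \<phi>' \<cdot> ((\<psi>' \<cdot> \<psi>) \<cdot> \<phi>)"
    using Comp_assoc[OF assms(1,2) h(2)] by simp
  also have "\<dots> = Ide V A" using Ide_Comp[OF assms(1)] e by simp
  finally have 1: "(\<phi>' \<cdot> \<psi>') \<cdot> (\<psi> \<cdot> \<phi>) = Ide V A" .
  have "(\<psi> \<cdot> \<phi>) \<cdot> (\<phi>' \<cdot> \<psi>') = \<psi> \<cdot> (\<phi> \<cdot> (\<phi>' \<cdot> \<psi>'))"
    using Comp_assoc[OF c(2) assms(1,2)] .
  also have "\<dots> = \<psi> \<cdot> ((\<phi> \<cdot> \<phi>') \<cdot> \<psi>')"
    using Comp_assoc[OF h(2,1) assms(1)] by simp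
  also have "\<dots> = Ide V D" using Ide_Comp[OF h(2)] e by simp
  finally have 2: "(\<psi> \<cdot> \<phi>) \<cdot> (\<phi>' \<cdot> \<psi>') = Ide V D" .
  show ?thesis using c 1 2 by (auto simp: inverse_arrows_def hom_def)
qed

lemma inverse_Tens:
  assumes "\<phi> \<in> hom V A B" "\<psi> \<in> hom V A' B'" "inverse_arrows V \<phi> \<phi>'" "inverse_arrows V \<psi> \<psi>'"
  shows "inverse_arrows V (\<phi> \<odot> \<psi>) (\<phi>' \<odot> \<psi>')"
proof -
  have h: "\<phi>' \<in> hom V B A" "\<psi>' \<in> hom V B' A'"
    and e: "\<phi>' \<cdot> \<phi> = Ide V A" "\<phi> \<cdot> \<phi>' = Ide V B" "\<psi>' \<cdot> \<psi> = Ide V A'" "\<psi> \<cdot> \<psi>' = Ide V B'"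
    using assms by (auto simp: inverse_arrows_def hom_def)
  have o: "A \<in> Obj V" "B \<in> Obj V" "A' \<in> Obj V" "B' \<in> Obj V"
    using assms(1,2) Dom_Obj Cod_Obj by (auto simp: hom_def)
  have "(\<phi>' \<odot> \<psi>') \<cdot> (\<phi> \<odot> \<psi>) = Ide V (A \<otimes> A')"
    using TensA_Comp[OF assms(1) h(1) assms(2) h(2)] e TensA_Ide o by simp
  moreover have "(\<phi> \<odot> \<psi>) \<cdot> (\<phi>' \<odot> \<psi>') = Ide V (B \<otimes> B')"
    using TensA_Comp[OF h(1) assms(1) h(2) assms(2)] e TensA_Ide o by simp
  ultimately show ?thesis
    using TensA_hom[OF assms(1,2)] TensA_hom[OF h] by (auto simp: inverse_arrows_def hom_def)
qed

lemma canonical_hom_iso: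
  assumes "canonical V X v w \<phi>" "\<And>l. X l \<in> Obj V"
  shows "\<phi> \<in> hom V (tobj V X v) (tobj V X w) \<and> is_iso V \<phi>"
  using assms(1)
proof induction
  case (can_Ide w)
  have "Ide V (tobj V X w) \<in> hom V (tobj V X w) (tobj V X w)"
    using Ide_hom tobj_Obj assms(2) by blast
  moreover from this have "Ide V (tobj V X w) \<cdot> Ide V (tobj V X w) = Ide V (tobj V X w)"
    by (rule Comp_Ide)
  ultimately show ?case by (auto simp: is_iso_def inverse_arrows_def hom_def)
next
  case (can_Comp u v \<phi> w \<psi>)
  then show ?case using Comp_hom inverse_Comp unfolding is_iso_def by blast
next
  case (can_Tens v w \<phi> v' w' \<psi>)
  then show ?case using TensA_hom inverse_Tens unfolding is_iso_def tobj.simps by blast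
next
  case (can_inv v w \<phi> \<psi>)
  then show ?case by (auto simp: is_iso_def inverse_arrows_def hom_def)
next
  case (can_Braid v w)
  have "tobj V X v \<in> Obj V" "tobj V X w \<in> Obj V" using tobj_Obj assms(2) by blast+
  then show ?case using Braid_hom Braid_iso unfolding is_iso_def tobj.simps by blast
qed (use assms(2) in \<open>auto simp: tobj_Obj Assoc_hom Assoc_iso LUnit_hom LUnit_iso RUnit_hom RUnit_iso\<close>)

lemma canonical_exists:
  fixes v w :: "'l tword"
  assumes X0: "\<And>l. l \<in> set (leaves v) \<Longrightarrow> X0 l \<in> Obj V"
    and leaves: "mset (leaves v) = mset (leaves w)"
  shows "\<exists>\<phi>. canonical V X0 v w \<phi>"
proof -
  define X where "X l = (if l \<in> set (leaves v) then X0 l else UnitO V)" for l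
  have X: "X l \<in> Obj V" for l by (simp add: X_def X0 UnitO_Obj)
  define E where "E v w \<longleftrightarrow> (\<exists>\<phi>. canonical V X v w \<phi>)" for v w
  have refl: "E v v" for v unfolding E_def by (blast intro: canonical.can_Ide)
  have trans [trans]: "E u v \<Longrightarrow> E v w \<Longrightarrow> E u w" for u v w
    unfolding E_def by (blast intro: canonical.can_Comp)
  have cong: "E v w \<Longrightarrow> E v' w' \<Longrightarrow> E (Times v v') (Times w w')" for v w v' w'
    unfolding E_def by (blast intro: canonical.can_Tens)
  have sym: "E v w \<Longrightarrow> E w v" for v w
  proof -
    assume "E v w"
    then obtain \<phi> where \<phi>: "canonical V X v w \<phi>" by (auto simp: E_def)
    then have "is_iso V \<phi>" using canonical_hom_iso X by blast
    then obtain \<psi> where "inverse_arrows V \<phi> \<psi>" by (auto simp: is_iso_def)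
    with \<phi> show "E w v" unfolding E_def by (blast intro: canonical.can_inv)
  qed
  have assoc: "E (Times (Times u v) w) (Times u (Times v w))" for u v w
    unfolding E_def by (blast intro: canonical.can_Assoc)
  have lunit: "E (Times One w) w" and runit: "E (Times w One) w" for w
    unfolding E_def by (blast intro: canonical.can_LUnit canonical.can_RUnit)+
  have braid: "E (Times v w) (Times w v)" for v w
    unfolding E_def by (blast intro: canonical.can_Braid)
  define nf where "nf ls = foldr (\<lambda>l. Times (Leaf l)) ls One" for ls :: "'l list"
  have app: "E (Times (nf ls) (nf ls')) (nf (ls @ ls'))" for ls ls'
  proof (induction ls)
    case Nil
    then show ?case by (simp add: nf_def lunit)
  next
    case (Cons l ls)
    have "E (Times (nf (l # ls)) (nf ls')) (Times (Leaf l) (Times (nf ls) (nf ls')))"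
      by (simp add: nf_def assoc)
    also have "E \<dots> (nf ((l # ls) @ ls'))" using cong[OF refl Cons] by (simp add: nf_def)
    finally show ?case .
  qed
  have norm: "E w (nf (leaves w))" for w
  proof (induction w)
    case (Leaf l)
    then show ?case using sym[OF runit] by (simp add: nf_def)
  next
    case (Times v w)
    then show ?case using trans[OF cong app] by simp
  qed (simp add: nf_def refl)
  have perm: "mset ls = mset ls' \<Longrightarrow> E (nf ls) (nf ls')" for ls ls'
  proof (induction ls arbitrary: ls')
    case Nil
    then show ?case by (simp add: refl)
  next
    case (Cons l ls)
    then obtain us vs where ls': "ls' = us @ l # vs"
      by (metis list.set_intros(1) set_mset_mset split_list)
    with Cons.prems have "mset ls = mset (us @ vs)" by simp
    then have "E (nf ls) (nf (us @ vs))" by (rule Cons.IH)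
    then have "E (nf (l # ls)) (Times (Leaf l) (nf (us @ vs)))"
      using cong[OF refl] by (simp add: nf_def)
    also have "E \<dots> (Times (Leaf l) (Times (nf us) (nf vs)))" by (rule cong[OF refl sym[OF app]])
    also have "E \<dots> (Times (Times (Leaf l) (nf us)) (nf vs))" by (rule sym[OF assoc])
    also have "E \<dots> (Times (Times (nf us) (Leaf l)) (nf vs))" by (rule cong[OF braid refl])
    also have "E \<dots> (Times (nf us) (Times (Leaf l) (nf vs)))" by (rule assoc)
    also have "E \<dots> (nf ls')" using app[of us "l # vs"] by (simp add: nf_def ls')
    finally show ?case .
  qed
  have "E v w" using trans[OF norm trans[OF perm[OF leaves] sym[OF norm]]] .
  then obtain \<phi> where "canonical V X v w \<phi>" by (auto simp: E_def)
  then have "canonical V X0 v w \<phi>" by (rule canonical_cong) (simp add: X_def)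
  then show ?thesis by blast
qed

end


section \<open>Operadic categories\<close>

text \<open>
  The category of the sets \<open>{1..n}\<close>, represented by \<open>n\<close>; an arrow \<open>m \<rightarrow> n\<close> is a triple
  \<open>(m, \<phi>, n)\<close> with \<open>\<phi>\<close> extensional on \<open>{1..m}\<close>.
\<close>

type_synonym smap = "nat \<times> (nat \<Rightarrow> nat) \<times> nat"

definition sFSet :: "(nat, smap) cat" where
  "sFSet = \<lparr>Obj = UNIV, Arr = {(m, \<phi>, n). \<phi> \<in> {1..m} \<rightarrow>\<^sub>E {1..n}},
     Dom = (\<lambda>(m, \<phi>, n). m), Cod = (\<lambda>(m, \<phi>, n). n),
     Ide = (\<lambda>n. (n, \<lambda>k\<in>{1..n}. k, n)),
     Comp = (\<lambda>(m', \<psi>, n') (m, \<phi>, n). (m, compose {1..m} \<psi> \<phi>, n'))\<rparr>"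

definition sapp :: "smap \<Rightarrow> nat \<Rightarrow> nat" where
  "sapp \<alpha> = fst (snd \<alpha>)"

definition spre :: "smap \<Rightarrow> nat \<Rightarrow> nat set" where
  "spre \<alpha> i = {k \<in> {1..Dom sFSet \<alpha>}. sapp \<alpha> k = i}"

text \<open>
  The fiber over \<open>i\<close> is \<open>{1..sfib \<alpha> i}\<close>; its order isomorphism with the preimage \<open>spre \<alpha> i\<close> is
  \<open>sincl \<alpha> i\<close>, with inverse \<open>spos \<alpha> i\<close>.
\<close>

definition sfib :: "smap \<Rightarrow> nat \<Rightarrow> nat" where
  "sfib \<alpha> i = card (spre \<alpha> i)"

definition sincl :: "smap \<Rightarrow> nat \<Rightarrow> nat \<Rightarrow> nat" where
  "sincl \<alpha> i p = sorted_list_of_set (spre \<alpha> i) ! (p - 1)"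

definition spos :: "smap \<Rightarrow> nat \<Rightarrow> nat \<Rightarrow> nat" where
  "spos \<alpha> i k = card {k' \<in> spre \<alpha> i. k' \<le> k}"

definition sind :: "smap \<Rightarrow> smap \<Rightarrow> nat \<Rightarrow> smap" where
  "sind \<alpha> \<beta> i = (let \<gamma> = \<beta> \<cdot>\<^bsub>sFSet\<^esub> \<alpha> in
     (sfib \<gamma> i, \<lambda>p\<in>{1..sfib \<gamma> i}. spos \<beta> i (sapp \<alpha> (sincl \<gamma> i p)), sfib \<beta> i))"

text \<open>
  \<open>fib f i\<close> is the fiber of \<open>f\<close> over \<open>i\<close>. For \<open>f : T \<rightarrow> S\<close> and \<open>g : S \<rightarrow> R\<close>, \<open>ind f g i\<close> is the
  induced map \<open>f\<^sub>i\<close> from the fiber of \<open>g f\<close> to the fiber of \<open>g\<close> over \<open>i\<close>.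
\<close>

record ('o, 'a) operadic = "('o, 'a) cat" +
  crd :: "('o, 'a, nat, smap) fct"
  trm :: "'o set \<Rightarrow> 'o"
  fib :: "'a \<Rightarrow> nat \<Rightarrow> 'o"
  ind :: "'a \<Rightarrow> 'a \<Rightarrow> nat \<Rightarrow> 'a"

abbreviation sz :: "('o, 'a) operadic \<Rightarrow> 'o \<Rightarrow> nat" where
  "sz \<O> T \<equiv> FO (crd \<O>) T"

abbreviation szm :: "('o, 'a) operadic \<Rightarrow> 'a \<Rightarrow> smap" where
  "szm \<O> f \<equiv> FA (crd \<O>) f"

locale operadic_category = category \<O>
  for \<O> :: "('o, 'a) operadic" (structure) +
  assumes crd_functor: "is_functor \<O> sFSet (crd \<O>)"
    and trm_mem: "c \<in> pi0 \<O> \<Longrightarrow> trm \<O> c \<in> c"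
    and trm_terminal: "c \<in> pi0 \<O> \<Longrightarrow> T \<in> c \<Longrightarrow> \<exists>!f. f \<in> hom \<O> T (trm \<O> c)"
    and fib_Obj: "f \<in> hom \<O> T S \<Longrightarrow> i \<in> {1..sz \<O> S} \<Longrightarrow> fib \<O> f i \<in> Obj \<O>"
    and sz_fib: "f \<in> hom \<O> T S \<Longrightarrow> i \<in> {1..sz \<O> S} \<Longrightarrow> sz \<O> (fib \<O> f i) = sfib (szm \<O> f) i"
    and sz_trm: "c \<in> pi0 \<O> \<Longrightarrow> sz \<O> (trm \<O> c) = 1"
    and fib_Ide: "T \<in> Obj \<O> \<Longrightarrow> i \<in> {1..sz \<O> T} \<Longrightarrow> fib \<O> (Ide \<O> T) i \<in> trm \<O> ` pi0 \<O>"
    and ind_hom: "f \<in> hom \<O> T S \<Longrightarrow> g \<in> hom \<O> S R \<Longrightarrow> i \<in> {1..sz \<O> R} \<Longrightarrow>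
      ind \<O> f g i \<in> hom \<O> (fib \<O> (g \<cdot> f) i) (fib \<O> g i)"
    and szm_ind: "f \<in> hom \<O> T S \<Longrightarrow> g \<in> hom \<O> S R \<Longrightarrow> i \<in> {1..sz \<O> R} \<Longrightarrow>
      szm \<O> (ind \<O> f g i) = sind (szm \<O> f) (szm \<O> g) i"
    and ind_Ide: "g \<in> hom \<O> S R \<Longrightarrow> i \<in> {1..sz \<O> R} \<Longrightarrow>
      ind \<O> (Ide \<O> S) g i = Ide \<O> (fib \<O> g i)"
    and ind_Comp: "f \<in> hom \<O> T S \<Longrightarrow> f' \<in> hom \<O> S S' \<Longrightarrow> g \<in> hom \<O> S' R \<Longrightarrow> i \<in> {1..sz \<O> R} \<Longrightarrow>
      ind \<O> (f' \<cdot> f) g i = ind \<O> f' g i \<cdot> ind \<O> f (g \<cdot> f') i"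
    and fib_trm: "c \<in> pi0 \<O> \<Longrightarrow> g \<in> hom \<O> S (trm \<O> c) \<Longrightarrow> fib \<O> g 1 = S"
    and ind_trm: "c \<in> pi0 \<O> \<Longrightarrow> f \<in> hom \<O> T S \<Longrightarrow> g \<in> hom \<O> S (trm \<O> c) \<Longrightarrow> ind \<O> f g 1 = f"
    and fib_ind: "f \<in> hom \<O> T S \<Longrightarrow> g \<in> hom \<O> S R \<Longrightarrow> j \<in> {1..sz \<O> S} \<Longrightarrow>
      i = sapp (szm \<O> g) j \<Longrightarrow> fib \<O> (ind \<O> f g i) (spos (szm \<O> g) i j) = fib \<O> f j"
    and ind_ind: "f \<in> hom \<O> T S \<Longrightarrow> a \<in> hom \<O> S Q \<Longrightarrow> c' \<in> hom \<O> Q R \<Longrightarrow> j \<in> {1..sz \<O> Q} \<Longrightarrow>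
      i = sapp (szm \<O> c') j \<Longrightarrow>
      ind \<O> (ind \<O> f (c' \<cdot> a) i) (ind \<O> a c' i) (spos (szm \<O> c') i j) = ind \<O> f a j"

definition is_operadic_functor ::
  "('o, 'a) operadic \<Rightarrow> ('p, 'b) operadic \<Rightarrow> ('o, 'a, 'p, 'b) fct \<Rightarrow> bool" where
  "is_operadic_functor \<O> \<P> F \<longleftrightarrow> operadic_category \<O> \<and> operadic_category \<P> \<and> is_functor \<O> \<P> F \<and>
     (\<forall>T\<in>Obj \<O>. sz \<P> (FO F T) = sz \<O> T) \<and>
     (\<forall>f\<in>Arr \<O>. szm \<P> (FA F f) = szm \<O> f) \<and>
     (\<forall>f\<in>Arr \<O>. \<forall>i\<in>{1..sz \<O> (Cod \<O> f)}. FO F (fib \<O> f i) = fib \<P> (FA F f) i) \<and>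
     (\<forall>f\<in>Arr \<O>. \<forall>g\<in>Arr \<O>. \<forall>i\<in>{1..sz \<O> (Cod \<O> g)}. Dom \<O> g = Cod \<O> f \<longrightarrow>
        FA F (ind \<O> f g i) = ind \<P> (FA F f) (FA F g) i) \<and>
     (\<forall>c\<in>pi0 \<O>. FO F (trm \<O> c) = trm \<P> (pi0_map \<P> F c))"

definition obj_fibre :: "('o, 'a) operadic \<Rightarrow> ('o, 'a, 'p, 'b) fct \<Rightarrow> 'p \<Rightarrow> 'o set" where
  "obj_fibre \<O> F T = {t \<in> Obj \<O>. FO F t = T}"

definition is_lift ::
  "('o, 'a) operadic \<Rightarrow> ('o, 'a, 'p, 'b) fct \<Rightarrow> 'b \<Rightarrow> 'o \<Rightarrow> (nat \<Rightarrow> 'o) \<Rightarrow> 'a \<Rightarrow> bool" where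
  "is_lift \<O> F f s t \<sigma> \<longleftrightarrow> \<sigma> \<in> Arr \<O> \<and> Cod \<O> \<sigma> = s \<and> FA F \<sigma> = f \<and>
     (\<forall>i\<in>{1..sz \<O> s}. fib \<O> \<sigma> i = t i)"

definition is_discrete_operadic_fibration ::
  "('o, 'a) operadic \<Rightarrow> ('p, 'b) operadic \<Rightarrow> ('o, 'a, 'p, 'b) fct \<Rightarrow> bool" where
  "is_discrete_operadic_fibration \<O> \<P> F \<longleftrightarrow> is_operadic_functor \<O> \<P> F \<and>
     pi0_map \<P> F ` pi0 \<O> = pi0 \<P> \<and>
     (\<forall>f\<in>Arr \<P>. \<forall>s\<in>obj_fibre \<O> F (Cod \<P> f). \<forall>t.
        (\<forall>i\<in>{1..sz \<P> (Cod \<P> f)}. t i \<in> obj_fibre \<O> F (fib \<P> f i)) \<longrightarrow> (\<exists>!\<sigma>. is_lift \<O> F f s t \<sigma>))"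


section \<open>Operads\<close>

record ('o, 'a, 'vo, 'va) operad =
  ob :: "'o \<Rightarrow> 'vo"
  unt :: "'o set \<Rightarrow> 'va"
  mu :: "'a \<Rightarrow> 'va"

text \<open>The object \<open>P(f)\<close>.\<close>

definition ob_fib ::
  "('vo, 'va) smc \<Rightarrow> ('o, 'a) operadic \<Rightarrow> ('o \<Rightarrow> 'vo) \<Rightarrow> 'a \<Rightarrow> 'vo" where
  "ob_fib V \<O> X f = bigO V (sz \<O> (Cod \<O> f)) (\<lambda>i. X (fib \<O> f i))"

text \<open>
  The two bracketings of the source of the associativity axiom for \<open>T \<rightarrow> S \<rightarrow> R\<close>, where
  \<open>\<beta> : |S| \<rightarrow> |R|\<close> underlies the second map: \<open>Up j\<close> stands for \<open>P(f\<^sup>-\<^sup>1(j))\<close>, \<open>Mid i\<close> for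
  \<open>P(g\<^sup>-\<^sup>1(i))\<close> and \<open>Low\<close> for \<open>P(R)\<close>. The first word is \<open>P(f) \<otimes> (P(g) \<otimes> P(R))\<close>, the second is
  the tensor product of all \<open>P(f\<^sub>i) \<otimes> P(g\<^sup>-\<^sup>1(i))\<close> followed by \<open>P(R)\<close>.
\<close>

datatype slot = Up nat | Mid nat | Low

definition assoc_src :: "smap \<Rightarrow> slot tword" where
  "assoc_src \<beta> = Times (tens (map (\<lambda>j. Leaf (Up j)) [1..<Suc (Dom sFSet \<beta>)]))
     (Times (tens (map (\<lambda>i. Leaf (Mid i)) [1..<Suc (Cod sFSet \<beta>)])) (Leaf Low))"

definition assoc_tgt :: "smap \<Rightarrow> slot tword" where
  "assoc_tgt \<beta> = Times
     (tens (map (\<lambda>i. Times (tens (map (\<lambda>p. Leaf (Up (sincl \<beta> i p))) [1..<Suc (sfib \<beta> i)])) (Leaf (Mid i)))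
        [1..<Suc (Cod sFSet \<beta>)]))
     (Leaf Low)"

lemma sincl_list: "map (sincl \<beta> i) [1..<Suc (sfib \<beta> i)] = sorted_list_of_set (spre \<beta> i)"
  by (rule nth_equalityI) (auto simp: sincl_def sfib_def simp del: upt_Suc)

lemma assoc_leaves:
  assumes "\<beta> \<in> Arr sFSet"
  shows "distinct (leaves (assoc_src \<beta>))" "mset (leaves (assoc_src \<beta>)) = mset (leaves (assoc_tgt \<beta>))"
proof -
  define n r where "n = Dom sFSet \<beta>" and "r = Cod sFSet \<beta>"
  have fin: "finite (spre \<beta> i)" for i by (simp add: spre_def)
  have maps: "sapp \<beta> k \<in> {1..r}" if "k \<in> {1..n}" for k
    using assms that by (auto simp: n_def r_def sFSet_def sapp_def)
  have src: "leaves (assoc_src \<beta>) = map Up [1..<Suc n] @ map Mid [1..<Suc r] @ [Low]"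
    by (simp add: assoc_src_def leaves_tens n_def r_def comp_def del: upt_Suc)
  have tgt: "leaves (assoc_tgt \<beta>) =
      concat (map (\<lambda>i. map Up (sorted_list_of_set (spre \<beta> i)) @ [Mid i]) [1..<Suc r]) @ [Low]"
    by (simp add: assoc_tgt_def leaves_tens r_def comp_def
        flip: sincl_list del: upt_Suc)
  show 1: "distinct (leaves (assoc_src \<beta>))"
    by (auto simp: src distinct_map inj_on_def simp del: upt_Suc)
  have "distinct (concat (map (\<lambda>i. map Up (sorted_list_of_set (spre \<beta> i)) @ [Mid i]) is))"
    if "distinct is" for "is"
    using that by (induction "is") (auto simp: distinct_map inj_on_def fin spre_def)
  then have 2: "distinct (leaves (assoc_tgt \<beta>))"
    by (auto simp: tgt simp del: upt_Suc)
  have "set (leaves (assoc_src \<beta>)) = set (leaves (assoc_tgt \<beta>))"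
  proof
    show "set (leaves (assoc_src \<beta>)) \<subseteq> set (leaves (assoc_tgt \<beta>))"
    proof
      fix l assume l: "l \<in> set (leaves (assoc_src \<beta>))"
      show "l \<in> set (leaves (assoc_tgt \<beta>))"
      proof (cases l)
        case (Up k)
        with l have k: "k \<in> {1..n}" by (auto simp: src)
        then have "k \<in> spre \<beta> (sapp \<beta> k)" by (auto simp: spre_def n_def)
        moreover have "sapp \<beta> k \<in> set [1..<Suc r]" using maps[OF k] by (simp del: upt_Suc)
        ultimately show ?thesis using fin Up by (auto simp: tgt simp del: upt_Suc set_upt)
      qed (use l in \<open>auto simp: src tgt simp del: upt_Suc\<close>)
    qed
    show "set (leaves (assoc_tgt \<beta>)) \<subseteq> set (leaves (assoc_src \<beta>))"
      by (auto simp: src tgt fin spre_def simp flip: n_def simp del: upt_Suc)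
  qed
  then show "mset (leaves (assoc_src \<beta>)) = mset (leaves (assoc_tgt \<beta>))"
    using 1 2 by (simp add: set_eq_iff_mset_eq_distinct)
qed

definition is_operad ::
  "('vo, 'va) smc \<Rightarrow> ('o, 'a) operadic \<Rightarrow> ('o, 'a, 'vo, 'va) operad \<Rightarrow> bool" where
  "is_operad V \<O> P \<longleftrightarrow>
     ob P \<in> Obj \<O> \<rightarrow>\<^sub>E Obj V \<and>
     unt P \<in> (\<Pi>\<^sub>E c\<in>pi0 \<O>. hom V (UnitO V) (ob P (trm \<O> c))) \<and>
     mu P \<in> (\<Pi>\<^sub>E f\<in>Arr \<O>. hom V (ob_fib V \<O> (ob P) f \<otimes>\<^bsub>V\<^esub> ob P (Cod \<O> f)) (ob P (Dom \<O> f))) \<and>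
     (\<forall>f\<in>Arr \<O>. \<forall>g\<in>Arr \<O>. \<forall>\<phi>.
        Dom \<O> g = Cod \<O> f \<and>
        canonical V
          (case_slot (\<lambda>j. ob P (fib \<O> f j)) (\<lambda>i. ob P (fib \<O> g i)) (ob P (Cod \<O> g)))
          (assoc_src (szm \<O> g)) (assoc_tgt (szm \<O> g)) \<phi> \<longrightarrow>
        mu P f \<cdot>\<^bsub>V\<^esub> (Ide V (ob_fib V \<O> (ob P) f) \<odot>\<^bsub>V\<^esub> mu P g) =
        mu P (g \<cdot>\<^bsub>\<O>\<^esub> f) \<cdot>\<^bsub>V\<^esub>
          (bigA V (sz \<O> (Cod \<O> g)) (\<lambda>i. mu P (ind \<O> f g i)) \<odot>\<^bsub>V\<^esub> Ide V (ob P (Cod \<O> g))) \<cdot>\<^bsub>V\<^esub> \<phi>) \<and>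
     (\<forall>T\<in>Obj \<O>. \<forall>\<phi>.
        canonical V (\<lambda>_::unit. ob P T)
          (Leaf ()) (Times (tens (map (\<lambda>_. One) [1..<Suc (sz \<O> T)])) (Leaf ())) \<phi> \<longrightarrow>
        mu P (Ide \<O> T) \<cdot>\<^bsub>V\<^esub>
          (bigA V (sz \<O> T) (\<lambda>i. unt P (component \<O> (fib \<O> (Ide \<O> T) i))) \<odot>\<^bsub>V\<^esub> Ide V (ob P T)) \<cdot>\<^bsub>V\<^esub> \<phi> =
        Ide V (ob P T)) \<and>
     (\<forall>c\<in>pi0 \<O>. \<forall>T\<in>c. \<forall>f\<in>hom \<O> T (trm \<O> c). \<forall>\<phi>.
        canonical V (\<lambda>_::unit. ob P T) (Leaf ()) (Times (Leaf ()) One) \<phi> \<longrightarrow>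
        mu P f \<cdot>\<^bsub>V\<^esub> (Ide V (ob P T) \<odot>\<^bsub>V\<^esub> unt P c) \<cdot>\<^bsub>V\<^esub> \<phi> = Ide V (ob P T))"

definition is_operad_map ::
  "('vo, 'va) smc \<Rightarrow> ('o, 'a) operadic \<Rightarrow> ('o, 'a, 'vo, 'va) operad \<Rightarrow>
   ('o, 'a, 'vo, 'va) operad \<Rightarrow> ('o \<Rightarrow> 'va) \<Rightarrow> bool" where
  "is_operad_map V \<O> P Q \<theta> \<longleftrightarrow>
     \<theta> \<in> (\<Pi>\<^sub>E T\<in>Obj \<O>. hom V (ob P T) (ob Q T)) \<and>
     (\<forall>c\<in>pi0 \<O>. \<theta> (trm \<O> c) \<cdot>\<^bsub>V\<^esub> unt P c = unt Q c) \<and>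
     (\<forall>f\<in>Arr \<O>. \<theta> (Dom \<O> f) \<cdot>\<^bsub>V\<^esub> mu P f =
        mu Q f \<cdot>\<^bsub>V\<^esub>
          (bigA V (sz \<O> (Cod \<O> f)) (\<lambda>i. \<theta> (fib \<O> f i)) \<odot>\<^bsub>V\<^esub> \<theta> (Cod \<O> f)))"

type_synonym ('o, 'a, 'vo, 'va) operad_arr =
  "('o, 'a, 'vo, 'va) operad \<times> ('o \<Rightarrow> 'va) \<times> ('o, 'a, 'vo, 'va) operad"

definition Op ::
  "('vo, 'va) smc \<Rightarrow> ('o, 'a) operadic \<Rightarrow>
   (('o, 'a, 'vo, 'va) operad, ('o, 'a, 'vo, 'va) operad_arr) cat" where
  "Op V \<O> = \<lparr>Obj = {P. is_operad V \<O> P},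
     Arr = {(P, \<theta>, Q). is_operad V \<O> P \<and> is_operad V \<O> Q \<and> is_operad_map V \<O> P Q \<theta>},
     Dom = (\<lambda>(P, \<theta>, Q). P), Cod = (\<lambda>(P, \<theta>, Q). Q),
     Ide = (\<lambda>P. (P, \<lambda>T\<in>Obj \<O>. Ide V (ob P T), P)),
     Comp = (\<lambda>(Q', \<eta>, R) (P, \<theta>, Q). (P, \<lambda>T\<in>Obj \<O>. \<eta> T \<cdot>\<^bsub>V\<^esub> \<theta> T, R))\<rparr>"


subsection \<open>Restriction along an operadic functor\<close>

definition pullback_operad ::
  "('o, 'a) operadic \<Rightarrow> ('p, 'b) operadic \<Rightarrow> ('o, 'a, 'p, 'b) fct \<Rightarrow>
   ('p, 'b, 'vo, 'va) operad \<Rightarrow> ('o, 'a, 'vo, 'va) operad" where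
  "pullback_operad \<O> \<P> F P =
     \<lparr>ob = (\<lambda>t\<in>Obj \<O>. ob P (FO F t)),
      unt = (\<lambda>c\<in>pi0 \<O>. unt P (pi0_map \<P> F c)),
      mu = (\<lambda>f\<in>Arr \<O>. mu P (FA F f))\<rparr>"

definition pullback ::
  "('o, 'a) operadic \<Rightarrow> ('p, 'b) operadic \<Rightarrow> ('o, 'a, 'p, 'b) fct \<Rightarrow>
   (('p, 'b, 'vo, 'va) operad, ('p, 'b, 'vo, 'va) operad_arr,
    ('o, 'a, 'vo, 'va) operad, ('o, 'a, 'vo, 'va) operad_arr) fct" where
  "pullback \<O> \<P> F =
     \<lparr>FO = pullback_operad \<O> \<P> F,
      FA = (\<lambda>(P, \<theta>, Q). (pullback_operad \<O> \<P> F P, \<lambda>t\<in>Obj \<O>. \<theta> (FO F t), pullback_operad \<O> \<P> F Q))\<rparr>"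


subsection \<open>The functor \<open>F\<^sub>!\<close>\<close>

definition shriek_ob ::
  "('vo, 'va) smc \<Rightarrow> ('o, 'a) operadic \<Rightarrow> ('o, 'a, 'p, 'b) fct \<Rightarrow>
   ('o, 'a, 'vo, 'va) operad \<Rightarrow> 'p \<Rightarrow> 'vo" where
  "shriek_ob V \<O> F A T = fst (coprod V (obj_fibre \<O> F T) (ob A))"

definition shriek_inj ::
  "('vo, 'va) smc \<Rightarrow> ('o, 'a) operadic \<Rightarrow> ('o, 'a, 'p, 'b) fct \<Rightarrow>
   ('o, 'a, 'vo, 'va) operad \<Rightarrow> 'o \<Rightarrow> 'va" where
  "shriek_inj V \<O> F A t = snd (coprod V (obj_fibre \<O> F (FO F t)) (ob A)) t"

definition shriek_mu ::
  "('vo, 'va) smc \<Rightarrow> ('o, 'a) operadic \<Rightarrow> ('p, 'b) operadic \<Rightarrow> ('o, 'a, 'p, 'b) fct \<Rightarrow>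
   ('o, 'a, 'vo, 'va) operad \<Rightarrow> 'b \<Rightarrow> 'va" where
  "shriek_mu V \<O> \<P> F A f =
     (THE m. m \<in> hom V (ob_fib V \<P> (shriek_ob V \<O> F A) f \<otimes>\<^bsub>V\<^esub> shriek_ob V \<O> F A (Cod \<P> f))
                       (shriek_ob V \<O> F A (Dom \<P> f)) \<and>
        (\<forall>s\<in>obj_fibre \<O> F (Cod \<P> f). \<forall>t.
           (\<forall>i\<in>{1..sz \<P> (Cod \<P> f)}. t i \<in> obj_fibre \<O> F (fib \<P> f i)) \<longrightarrow>
           (let \<sigma> = (THE \<sigma>. is_lift \<O> F f s t \<sigma>) in
              m \<cdot>\<^bsub>V\<^esub> (bigA V (sz \<P> (Cod \<P> f)) (\<lambda>i. shriek_inj V \<O> F A (t i)) \<odot>\<^bsub>V\<^esub> shriek_inj V \<O> F A s) =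
              shriek_inj V \<O> F A (Dom \<O> \<sigma>) \<cdot>\<^bsub>V\<^esub> mu A \<sigma>)))"

definition shriek_unt ::
  "('vo, 'va) smc \<Rightarrow> ('o, 'a) operadic \<Rightarrow> ('p, 'b) operadic \<Rightarrow> ('o, 'a, 'p, 'b) fct \<Rightarrow>
   ('o, 'a, 'vo, 'va) operad \<Rightarrow> 'p set \<Rightarrow> 'va" where
  "shriek_unt V \<O> \<P> F A c =
     (let a = (THE a. a \<in> pi0 \<O> \<and> FO F (trm \<O> a) = trm \<P> c) in
        shriek_inj V \<O> F A (trm \<O> a) \<cdot>\<^bsub>V\<^esub> unt A a)"

definition shriek_operad ::
  "('vo, 'va) smc \<Rightarrow> ('o, 'a) operadic \<Rightarrow> ('p, 'b) operadic \<Rightarrow> ('o, 'a, 'p, 'b) fct \<Rightarrow>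
   ('o, 'a, 'vo, 'va) operad \<Rightarrow> ('p, 'b, 'vo, 'va) operad" where
  "shriek_operad V \<O> \<P> F A =
     \<lparr>ob = (\<lambda>T\<in>Obj \<P>. shriek_ob V \<O> F A T),
      unt = (\<lambda>c\<in>pi0 \<P>. shriek_unt V \<O> \<P> F A c),
      mu = (\<lambda>f\<in>Arr \<P>. shriek_mu V \<O> \<P> F A f)\<rparr>"

text \<open>On a morphism \<open>\<theta>\<close> the functor is the coproduct of the components of \<open>\<theta>\<close>.\<close>

definition shriek_map ::
  "('vo, 'va) smc \<Rightarrow> ('o, 'a) operadic \<Rightarrow> ('o, 'a, 'p, 'b) fct \<Rightarrow>
   ('o, 'a, 'vo, 'va) operad \<Rightarrow> ('o, 'a, 'vo, 'va) operad \<Rightarrow> ('o \<Rightarrow> 'va) \<Rightarrow> 'p \<Rightarrow> 'va" where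
  "shriek_map V \<O> F A B \<theta> T =
     (THE m. m \<in> hom V (shriek_ob V \<O> F A T) (shriek_ob V \<O> F B T) \<and>
        (\<forall>t\<in>obj_fibre \<O> F T. m \<cdot>\<^bsub>V\<^esub> shriek_inj V \<O> F A t = shriek_inj V \<O> F B t \<cdot>\<^bsub>V\<^esub> \<theta> t))"

definition shriek ::
  "('vo, 'va) smc \<Rightarrow> ('o, 'a) operadic \<Rightarrow> ('p, 'b) operadic \<Rightarrow> ('o, 'a, 'p, 'b) fct \<Rightarrow>
   (('o, 'a, 'vo, 'va) operad, ('o, 'a, 'vo, 'va) operad_arr,
    ('p, 'b, 'vo, 'va) operad, ('p, 'b, 'vo, 'va) operad_arr) fct" where
  "shriek V \<O> \<P> F =
     \<lparr>FO = shriek_operad V \<O> \<P> F,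
      FA = (\<lambda>(A, \<theta>, B).
        (shriek_operad V \<O> \<P> F A, \<lambda>T\<in>Obj \<P>. shriek_map V \<O> F A B \<theta> T, shriek_operad V \<O> \<P> F B))\<rparr>"

end

theory Submission
  imports Defs
begin

text \<open>
  Since \<open>V\<close> is closed, the tensor product preserves coproducts in each variable, so
  \<open>F\<^sub>!\<A>(f) \<otimes> F\<^sub>!\<A>(S)\<close> is the coproduct of \<open>\<A>(\<sigma>) \<otimes> \<A>(s)\<close> over all lifts \<open>\<sigma> : t \<rightarrow> s\<close> of
  \<open>f : T \<rightarrow> S\<close>, and the source of the associativity axiom for \<open>T \<rightarrow> S \<rightarrow> R\<close> is the coproduct over all
  composable pairs of lifts. The operad axioms for \<open>F\<^sub>!\<A>\<close> can therefore be checked on summands, where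
  naturality of the canonical isomorphisms reduces them to the axioms for \<open>\<A>\<close>. In the same way,
  a family of maps \<open>F\<^sub>!\<A>(T) \<rightarrow> \<Q>(T)\<close> is a morphism of operads if and only if its restrictions
  \<open>\<A>(t) \<rightarrow> \<Q>(F(t))\<close> form a morphism \<open>\<A> \<rightarrow> F\<^sup>*\<Q>\<close>, which is the adjunction.
\<close>

section \<open>Coproducts\<close>

text \<open>The associativity and unit axioms contain rebracketings \<open>\<phi>\<close> that are
  not written out, and they are required for every \<open>\<phi>\<close> that is
  \<open>canonical\<close>. This universal form is what makes the transfer work: for a given
  \<open>\<phi>\<close> between words in the coproducts, naturality produces some canonical
  \<open>\<psi>\<close> between the words in the summands, and the axiom of \<open>A\<close> applies
  to whichever \<open>\<psi>\<close> arises. The fibration enters at two places. An arrow of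
  \<open>\<O>\<close> is the lift of its image determined by its own codomain and fibers, so the
  choices of summands for \<open>f\<close> correspond to the arrows \<open>\<sigma>\<close> with
  \<open>FA F \<sigma> = f\<close>, and comparisons run over such arrows. For units, surjectivity on
  components supplies a chosen terminal object over each chosen terminal object of
  \<open>\<P>\<close>, and lifting identities shows that there is only one. That \<open>F\<close>
  preserves fibers and induced maps ensures that rebracketing matches: for composable lifts
  \<open>\<sigma>\<close>, \<open>\<gamma>\<close> of \<open>f\<close>, \<open>g\<close>, the arrow
  belonging to the block of \<open>f_i\<close> is \<open>ind \<O> \<sigma> \<gamma> i\<close>.
  Smallness of \<open>\<O>\<close> gives the coproducts over the fibers of \<open>F\<close> on
  objects.\<close>

context category
begin

lemma Comp_simps [simp]:
  assumes "f \<in> Arr C" "g \<in> Arr C" "Dom C g = Cod C f"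
  shows "g \<cdot> f \<in> Arr C" "Dom C (g \<cdot> f) = Dom C f" "Cod C (g \<cdot> f) = Cod C g"
  using Comp_hom[of f "Dom C f" "Cod C f" g "Cod C g"] assms by (auto simp: hom_def)

lemma Ide_simps [simp]:
  assumes "A \<in> Obj C"
  shows "Ide C A \<in> Arr C" "Dom C (Ide C A) = A" "Cod C (Ide C A) = A"
  using Ide_hom[OF assms] by (auto simp: hom_def)

lemma Comp_Ide_Dom [simp]: "f \<in> Arr C \<Longrightarrow> Dom C f = A \<Longrightarrow> f \<cdot> Ide C A = f"
  by (rule Comp_Ide[of _ _ "Cod C f"]) (simp add: hom_def)

lemma Ide_Comp_Cod [simp]: "f \<in> Arr C \<Longrightarrow> Cod C f = A \<Longrightarrow> Ide C A \<cdot> f = f"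
  by (rule Ide_Comp[of _ "Dom C f"]) (simp add: hom_def)

lemma Comp_assoc_Arr [simp]:
  "f \<in> Arr C \<Longrightarrow> g \<in> Arr C \<Longrightarrow> h \<in> Arr C \<Longrightarrow> Dom C g = Cod C f \<Longrightarrow> Dom C h = Cod C g \<Longrightarrow>
    (h \<cdot> g) \<cdot> f = h \<cdot> (g \<cdot> f)"
  by (rule Comp_assoc[of f "Dom C f" "Cod C f" g "Cod C g" h "Cod C h"]) (auto simp: hom_def)

lemma hom_Obj: "f \<in> hom C A B \<Longrightarrow> A \<in> Obj C \<and> B \<in> Obj C"
  using Dom_Obj Cod_Obj by (auto simp: hom_def)

lemma is_coproductI:
  assumes "K \<in> Obj C" "\<And>i. i \<in> A \<Longrightarrow> inc i \<in> hom C (X i) K"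
    and "\<And>M q. M \<in> Obj C \<Longrightarrow> (\<And>i. i \<in> A \<Longrightarrow> q i \<in> hom C (X i) M) \<Longrightarrow>
      \<exists>m \<in> hom C K M. \<forall>i\<in>A. m \<cdot> inc i = q i"
    and "\<And>M m m'. m \<in> hom C K M \<Longrightarrow> m' \<in> hom C K M \<Longrightarrow>
      (\<And>i. i \<in> A \<Longrightarrow> m \<cdot> inc i = m' \<cdot> inc i) \<Longrightarrow> m = m'"
  shows "is_coproduct C A X (K, inc)"
proof -
  have "\<exists>!m. m \<in> hom C K M \<and> (\<forall>i\<in>A. m \<cdot> inc i = q i)"
    if M: "M \<in> Obj C" and q: "\<forall>i\<in>A. q i \<in> hom C (X i) M" for M q
  proof -
    obtain m where m: "m \<in> hom C K M" "\<forall>i\<in>A. m \<cdot> inc i = q i"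
      using assms(3)[OF M] q by metis
    moreover have "m' = m" if "m' \<in> hom C K M \<and> (\<forall>i\<in>A. m' \<cdot> inc i = q i)" for m'
      by (rule assms(4)) (use m that in auto)
    ultimately show ?thesis by blast
  qed
  then show ?thesis using assms(1,2) by (simp add: is_coproduct_def)
qed

lemma coproduct_inj: "is_coproduct C A X (K, inc) \<Longrightarrow> i \<in> A \<Longrightarrow> inc i \<in> hom C (X i) K"
  by (simp add: is_coproduct_def)

lemma coproduct_Obj: "is_coproduct C A X (K, inc) \<Longrightarrow> K \<in> Obj C"
  by (simp add: is_coproduct_def)

lemma coproduct_ex1:
  assumes "is_coproduct C A X (K, inc)" "M \<in> Obj C" "\<And>i. i \<in> A \<Longrightarrow> q i \<in> hom C (X i) M"
  shows "\<exists>!m. m \<in> hom C K M \<and> (\<forall>i\<in>A. m \<cdot> inc i = q i)"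
  using assms by (simp add: is_coproduct_def)

lemma coproduct_eqI:
  assumes "is_coproduct C A X (K, inc)" "m \<in> hom C K M" "m' \<in> hom C K M"
    and "\<And>i. i \<in> A \<Longrightarrow> m \<cdot> inc i = m' \<cdot> inc i"
  shows "m = m'"
proof -
  have "\<exists>!n. n \<in> hom C K M \<and> (\<forall>i\<in>A. n \<cdot> inc i = m' \<cdot> inc i)"
    by (rule coproduct_ex1[OF assms(1) conjunct2[OF hom_Obj[OF assms(3)]]])
      (rule Comp_hom[OF coproduct_inj[OF assms(1)] assms(3)])
  with assms(2-4) show ?thesis by blast
qed

text \<open>Mediating maps are carried over by the inverse of \<open>h\<close>. With
  \<open>h\<close> the identity, this also replaces objects and inclusions by families that agree
  with them on the index set only.\<close>

lemma coproduct_reindex: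
  assumes K: "is_coproduct C A X (K, inc)" and bij: "bij_betw h B A"
    and Y: "\<And>j. j \<in> B \<Longrightarrow> Y j = X (h j)" and inc': "\<And>j. j \<in> B \<Longrightarrow> inc' j = inc (h j)"
  shows "is_coproduct C B Y (K, inc')"
proof (rule is_coproductI)
  have h: "h j \<in> A" if "j \<in> B" for j using bij that by (auto simp: bij_betw_def)
  show "K \<in> Obj C" using K by (rule coproduct_Obj)
  show "inc' j \<in> hom C (Y j) K" if "j \<in> B" for j
    using coproduct_inj[OF K h[OF that]] Y inc' that by simp
  show "\<exists>m\<in>hom C K M. \<forall>j\<in>B. m \<cdot> inc' j = q j"
    if M: "M \<in> Obj C" and q: "\<And>j. j \<in> B \<Longrightarrow> q j \<in> hom C (Y j) M" for M q
  proof -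
    have inv: "inv_into B h i \<in> B \<and> h (inv_into B h i) = i" if "i \<in> A" for i
      using bij that by (metis bij_betw_def f_inv_into_f inv_into_into)
    have "q (inv_into B h i) \<in> hom C (X i) M" if "i \<in> A" for i
      using q Y inv[OF that] by metis
    then obtain m where "m \<in> hom C K M" "\<forall>i\<in>A. m \<cdot> inc i = q (inv_into B h i)"
      using coproduct_ex1[OF K M, of "\<lambda>i. q (inv_into B h i)"] by blast
    moreover have "inv_into B h (h j) = j" if "j \<in> B" for j
      using bij that by (simp add: bij_betw_def)
    ultimately show ?thesis using h inc' by metis
  qed
  show "m = m'" if "m \<in> hom C K M" "m' \<in> hom C K M"
    and "\<And>j. j \<in> B \<Longrightarrow> m \<cdot> inc' j = m' \<cdot> inc' j" for M m m'
    by (rule coproduct_eqI[OF K that(1,2)])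
      (use that(3) inc' bij in \<open>metis bij_betw_def imageE\<close>)
qed

text \<open>Mediate out of each \<open>X i\<close>, then out of \<open>K\<close>. An inner index set
  \<open>B\<close> independent of \<open>i\<close> suffices here, because the factors of a tensor
  product choose their summands independently.\<close>

lemma coproduct_Sigma:
  assumes K: "is_coproduct C A X (K, inc)"
    and X: "\<And>i. i \<in> A \<Longrightarrow> is_coproduct C B (Y i) (X i, inc' i)"
  shows "is_coproduct C (A \<times> B) (\<lambda>(i, j). Y i j) (K, \<lambda>(i, j). inc i \<cdot> inc' i j)"
proof (rule is_coproductI)
  show "K \<in> Obj C" using K by (rule coproduct_Obj)
  show "(\<lambda>(i, j). inc i \<cdot> inc' i j) k \<in> hom C ((\<lambda>(i, j). Y i j) k) K" if "k \<in> A \<times> B" for k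
    using that Comp_hom[OF coproduct_inj[OF X] coproduct_inj[OF K]] by (cases k) simp
  show "\<exists>m\<in>hom C K M. \<forall>k\<in>A \<times> B. m \<cdot> (\<lambda>(i, j). inc i \<cdot> inc' i j) k = q k"
    if M: "M \<in> Obj C" and q: "\<And>k. k \<in> A \<times> B \<Longrightarrow> q k \<in> hom C ((\<lambda>(i, j). Y i j) k) M" for M q
  proof -
    have "\<exists>n. n \<in> hom C (X i) M \<and> (\<forall>j\<in>B. n \<cdot> inc' i j = q (i, j))" if "i \<in> A" for i
    proof -
      have "q (i, j) \<in> hom C (Y i j) M" if "j \<in> B" for j using q[of "(i, j)"] that \<open>i \<in> A\<close> by simp
      then show ?thesis using coproduct_ex1[OF X[OF that] M, of "\<lambda>j. q (i, j)"] by blast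
    qed
    then obtain n where n: "\<And>i. i \<in> A \<Longrightarrow> n i \<in> hom C (X i) M"
        "\<And>i j. i \<in> A \<Longrightarrow> j \<in> B \<Longrightarrow> n i \<cdot> inc' i j = q (i, j)"
      by metis
    obtain m where m: "m \<in> hom C K M" "\<And>i. i \<in> A \<Longrightarrow> m \<cdot> inc i = n i"
      using coproduct_ex1[OF K M n(1)] by metis
    have "m \<cdot> inc i \<cdot> inc' i j = q (i, j)" if "i \<in> A" "j \<in> B" for i j
      using Comp_assoc[OF coproduct_inj[OF X] coproduct_inj[OF K] m(1)] m(2) n(2) that by metis
    then show ?thesis using m(1) by auto
  qed
  show "m = m'" if m: "m \<in> hom C K M" "m' \<in> hom C K M"
    and eq: "\<And>k. k \<in> A \<times> B \<Longrightarrow> m \<cdot> (\<lambda>(i, j). inc i \<cdot> inc' i j) k = m' \<cdot> (\<lambda>(i, j). inc i \<cdot> inc' i j) k"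
    for M m m'
  proof (rule coproduct_eqI[OF K m])
    fix i assume i: "i \<in> A"
    show "m \<cdot> inc i = m' \<cdot> inc i"
    proof (rule coproduct_eqI[OF X[OF i]])
      show "m \<cdot> inc i \<in> hom C (X i) M" "m' \<cdot> inc i \<in> hom C (X i) M"
        using Comp_hom[OF coproduct_inj[OF K i]] m by blast+
      show "(m \<cdot> inc i) \<cdot> inc' i j = (m' \<cdot> inc i) \<cdot> inc' i j" if "j \<in> B" for j
        using Comp_assoc[OF coproduct_inj[OF X] coproduct_inj[OF K]] m eq[of "(i, j)"] i that
        by auto
    qed
  qed
qed

text \<open>A family on the \<open>Y i\<close> becomes one on the \<open>X i\<close> through the
  inverses \<open>x' i\<close>, and its mediating map is then composed with \<open>\<phi>'\<close>.
  The purpose is conjugation by the braiding.\<close>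

lemma coproduct_iso:
  assumes K: "is_coproduct C A X (K, inc)" and \<phi>: "\<phi> \<in> hom C K L" "inverse_arrows C \<phi> \<phi>'"
    and x: "\<And>i. i \<in> A \<Longrightarrow> x i \<in> hom C (Y i) (X i)" "\<And>i. i \<in> A \<Longrightarrow> inverse_arrows C (x i) (x' i)"
  shows "is_coproduct C A Y (L, \<lambda>i. \<phi> \<cdot> inc i \<cdot> x i)"
proof (rule is_coproductI)
  have \<phi>': "\<phi>' \<in> Arr C" "Dom C \<phi>' = L" "Cod C \<phi>' = K" "\<phi>' \<cdot> \<phi> = Ide C K" "\<phi> \<cdot> \<phi>' = Ide C L"
    and \<phi>s: "\<phi> \<in> Arr C" "Dom C \<phi> = K" "Cod C \<phi> = L"
    using \<phi> by (auto simp: inverse_arrows_def hom_def)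
  have x': "x' i \<in> Arr C" "Dom C (x' i) = X i" "Cod C (x' i) = Y i"
      "x' i \<cdot> x i = Ide C (Y i)" "x i \<cdot> x' i = Ide C (X i)"
    and xs: "x i \<in> Arr C" "Dom C (x i) = Y i" "Cod C (x i) = X i" if "i \<in> A" for i
    using x[OF that] by (auto simp: inverse_arrows_def hom_def)
  have inc: "inc i \<in> Arr C" "Dom C (inc i) = X i" "Cod C (inc i) = K" if "i \<in> A" for i
    using coproduct_inj[OF K that] by (auto simp: hom_def)
  show "L \<in> Obj C" using hom_Obj[OF \<phi>(1)] by simp
  show "\<phi> \<cdot> inc i \<cdot> x i \<in> hom C (Y i) L" if "i \<in> A" for i
    using that by (simp add: hom_def \<phi>s xs inc)
  show "\<exists>m\<in>hom C L M. \<forall>i\<in>A. m \<cdot> \<phi> \<cdot> inc i \<cdot> x i = q i"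
    if M: "M \<in> Obj C" and q: "\<And>i. i \<in> A \<Longrightarrow> q i \<in> hom C (Y i) M" for M q
  proof -
    have qs: "q i \<in> Arr C" "Dom C (q i) = Y i" "Cod C (q i) = M" if "i \<in> A" for i
      using q[OF that] by (auto simp: hom_def)
    have "q i \<cdot> x' i \<in> hom C (X i) M" if "i \<in> A" for i
      using that qs x' by (simp add: hom_def)
    then obtain m where m: "m \<in> hom C K M" "\<And>i. i \<in> A \<Longrightarrow> m \<cdot> inc i = q i \<cdot> x' i"
      using coproduct_ex1[OF K M, of "\<lambda>i. q i \<cdot> x' i"] by metis
    have ms: "m \<in> Arr C" "Dom C m = K" "Cod C m = M" using m(1) by (auto simp: hom_def)
    have "(m \<cdot> \<phi>') \<cdot> \<phi> \<cdot> inc i \<cdot> x i = q i" if i: "i \<in> A" for i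
    proof -
      have "(m \<cdot> \<phi>') \<cdot> \<phi> \<cdot> inc i \<cdot> x i = m \<cdot> (\<phi>' \<cdot> \<phi>) \<cdot> inc i \<cdot> x i"
        using i by (simp add: ms \<phi>'(1-3) \<phi>s xs inc)
      also have "\<dots> = (m \<cdot> inc i) \<cdot> x i" using i by (simp add: ms \<phi>'(4) xs inc coproduct_Obj[OF K])
      also have "\<dots> = q i \<cdot> x' i \<cdot> x i" using i by (simp add: m(2) qs xs x'(1-3))
      also have "\<dots> = q i" using i by (simp add: x'(4) qs)
      finally show ?thesis .
    qed
    moreover have "m \<cdot> \<phi>' \<in> hom C L M" by (simp add: hom_def ms \<phi>')
    ultimately show ?thesis by blast
  qed
  show "m = m'" if m: "m \<in> hom C L M" "m' \<in> hom C L M"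
    and eq: "\<And>i. i \<in> A \<Longrightarrow> m \<cdot> \<phi> \<cdot> inc i \<cdot> x i = m' \<cdot> \<phi> \<cdot> inc i \<cdot> x i" for M m m'
  proof -
    have ms: "m \<in> Arr C" "Dom C m = L" "Cod C m = M" "m' \<in> Arr C" "Dom C m' = L" "Cod C m' = M"
      using m by (auto simp: hom_def)
    have "m \<cdot> \<phi> = m' \<cdot> \<phi>"
    proof (rule coproduct_eqI[OF K])
      show "m \<cdot> \<phi> \<in> hom C K M" "m' \<cdot> \<phi> \<in> hom C K M" by (simp_all add: hom_def ms \<phi>s)
      fix i assume i: "i \<in> A"
      have "n \<cdot> \<phi> \<cdot> inc i = (n \<cdot> \<phi> \<cdot> inc i \<cdot> x i) \<cdot> x' i" if "n \<in> hom C L M" for n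
      proof -
        have "n \<in> Arr C" "Dom C n = L" "Cod C n = M" using that by (auto simp: hom_def)
        then have "(n \<cdot> \<phi> \<cdot> inc i \<cdot> x i) \<cdot> x' i = n \<cdot> \<phi> \<cdot> inc i \<cdot> (x i \<cdot> x' i)"
          using i by (simp add: \<phi>s xs inc x'(1-3))
        then show ?thesis using i by (simp add: x'(5) inc)
      qed
      then show "(m \<cdot> \<phi>) \<cdot> inc i = (m' \<cdot> \<phi>) \<cdot> inc i" using m eq[OF i] i by (simp add: ms \<phi>s inc)
    qed
    then have "(m \<cdot> \<phi>) \<cdot> \<phi>' = (m' \<cdot> \<phi>) \<cdot> \<phi>'" by simp
    then show ?thesis by (simp add: ms \<phi>s \<phi>')
  qed
qed

text \<open>Base case for the empty word: the tensor unit is a coproduct over the single choice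
  function on no leaves.\<close>

lemma coproduct_singleton:
  assumes "X a \<in> Obj C"
  shows "is_coproduct C {a} X (X a, \<lambda>_. Ide C (X a))"
  by (rule is_coproductI) (use assms Ide_hom in \<open>auto simp: hom_def\<close>)

text \<open>A coproduct is a colimit over a discrete category. Cocompleteness speaks of shapes whose
  objects and arrows lie in \<open>'u\<close>, so the shape is built on the image of
  \<open>A\<close> under \<open>h\<close> and the result is reindexed along
  \<open>h\<close>.\<close>

lemma small_coproduct_exists:
  fixes h :: "'i \<Rightarrow> 'u"
  assumes coc: "cocomplete_category TYPE('u) C" and h: "inj_on h A"
    and X: "\<And>i. i \<in> A \<Longrightarrow> X i \<in> Obj C"
  shows "\<exists>K. is_coproduct C A X K"
proof -
  define J :: "('u, 'u) cat" where
    "J = \<lparr>Obj = h ` A, Arr = h ` A, Dom = (\<lambda>u. u), Cod = (\<lambda>u. u), Ide = (\<lambda>u. u), Comp = (\<lambda>u v. u)\<rparr>"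
  define Y where "Y u = X (inv_into A h u)" for u
  define D where "D = \<lparr>FO = Y, FA = (\<lambda>u. Ide C (Y u))\<rparr>"
  have Y: "Y u \<in> Obj C" if "u \<in> h ` A" for u
    using X that by (simp add: Y_def inv_into_into)
  have "category J" by unfold_locales (auto simp: J_def hom_def)
  then have "is_functor J C D"
    using Y category_axioms by (auto simp: is_functor_def D_def J_def hom_def)
  then obtain L p where L: "is_colimit J C D L p"
    using coc unfolding cocomplete_category_def by blast
  \<comment> \<open>All arrows of \<open>J\<close> are identities, so the compatibility condition of
    a cocone reduces to a unit law.\<close>
  have cocone: "is_cocone J C D M q \<longleftrightarrow> M \<in> Obj C \<and> (\<forall>u\<in>h ` A. q u \<in> hom C (Y u) M)" for M q
    using Y by (auto simp: is_cocone_def D_def J_def hom_def)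
  have "is_coproduct C (h ` A) Y (L, p)"
    using L by (simp add: is_colimit_def cocone is_coproduct_def) (simp add: J_def)
  then have "is_coproduct C A X (L, p \<circ> h)"
    by (rule coproduct_reindex[where h = h]) (use h in \<open>auto simp: bij_betw_def Y_def\<close>)
  then show ?thesis by blast
qed

end

section \<open>Words in a closed symmetric monoidal category\<close>

lemma tarr_cong: "(\<And>l. l \<in> set (leaves w) \<Longrightarrow> h l = k l) \<Longrightarrow> tarr V h w = tarr V k w"
  by (induction w) auto

context symmetric_monoidal_category
begin

section \<open>Tensor products preserve coproducts\<close>

lemma TensA_simps [simp]:
  assumes "f \<in> Arr V" "g \<in> Arr V"
  shows "f \<odot> g \<in> Arr V" "Dom V (f \<odot> g) = Dom V f \<otimes> Dom V g" "Cod V (f \<odot> g) = Cod V f \<otimes> Cod V g"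
  using TensA_hom[of f "Dom V f" "Cod V f" g "Dom V g" "Cod V g"] assms by (auto simp: hom_def)

lemma TensA_Comp_Arr:
  "f \<in> Arr V \<Longrightarrow> g \<in> Arr V \<Longrightarrow> f' \<in> Arr V \<Longrightarrow> g' \<in> Arr V \<Longrightarrow> Dom V g = Cod V f \<Longrightarrow>
    Dom V g' = Cod V f' \<Longrightarrow> (g \<odot> g') \<cdot> (f \<odot> f') = (g \<cdot> f) \<odot> (g' \<cdot> f')"
  by (rule TensA_Comp[symmetric]) (auto simp: hom_def)

text \<open>Tensoring with \<open>B\<close> has a right adjoint: maps out of
  \<open>K \<otimes> B\<close> and \<open>X i \<otimes> B\<close> are transposes of maps out of
  \<open>K\<close> and \<open>X i\<close>, so the universal property of \<open>K\<close> is
  transported by transposing back and forth.\<close>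

lemma TensO_coproduct_left:
  assumes closed: "is_closed V" and K: "is_coproduct V A X (K, inc)" and B: "B \<in> Obj V"
    and X: "\<And>i. i \<in> A \<Longrightarrow> X i \<in> Obj V"
  shows "is_coproduct V A (\<lambda>i. X i \<otimes> B) (K \<otimes> B, \<lambda>i. inc i \<odot> Ide V B)"
proof (rule is_coproductI)
  have KO: "K \<in> Obj V" using K by (rule coproduct_Obj)
  have inc: "inc i \<in> Arr V" "Dom V (inc i) = X i" "Cod V (inc i) = K" if "i \<in> A" for i
    using coproduct_inj[OF K that] by (auto simp: hom_def)
  show "K \<otimes> B \<in> Obj V" using KO B by (rule TensO_Obj)
  show "inc i \<odot> Ide V B \<in> hom V (X i \<otimes> B) (K \<otimes> B)" if "i \<in> A" for i
    using that B by (simp add: hom_def inc)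
  have curry: "\<exists>H\<in>Obj V. \<exists>ev\<in>hom V (H \<otimes> B) M. \<forall>A\<in>Obj V. \<forall>f\<in>hom V (A \<otimes> B) M.
      \<exists>!g. g \<in> hom V A H \<and> ev \<cdot> (g \<odot> Ide V B) = f" if "M \<in> Obj V" for M
    using closed B that unfolding is_closed_def by blast
  \<comment> \<open>Transposition is natural in the first variable, so precomposing with
    \<open>inc i\<close> commutes with it.\<close>
  have uncurry: "ev \<cdot> ((n \<cdot> inc i) \<odot> Ide V B) = (ev \<cdot> (n \<odot> Ide V B)) \<cdot> (inc i \<odot> Ide V B)"
    if "i \<in> A" "n \<in> hom V K H" "ev \<in> hom V (H \<otimes> B) M" for i n H ev M
    using that B by (auto simp: hom_def inc TensA_Comp_Arr)
  show "\<exists>m\<in>hom V (K \<otimes> B) M. \<forall>i\<in>A. m \<cdot> (inc i \<odot> Ide V B) = q i"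
    if M: "M \<in> Obj V" and q: "\<And>i. i \<in> A \<Longrightarrow> q i \<in> hom V (X i \<otimes> B) M" for M q
  proof -
    obtain H ev where H: "H \<in> Obj V" and ev: "ev \<in> hom V (H \<otimes> B) M"
      and cur: "\<And>A f. A \<in> Obj V \<Longrightarrow> f \<in> hom V (A \<otimes> B) M \<Longrightarrow>
        \<exists>!g. g \<in> hom V A H \<and> ev \<cdot> (g \<odot> Ide V B) = f"
      using curry[OF M] by blast
    obtain g where g: "\<And>i. i \<in> A \<Longrightarrow> g i \<in> hom V (X i) H"
        "\<And>i. i \<in> A \<Longrightarrow> ev \<cdot> (g i \<odot> Ide V B) = q i"
      using cur[OF X q] by metis
    obtain n where n: "n \<in> hom V K H" "\<And>i. i \<in> A \<Longrightarrow> n \<cdot> inc i = g i"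
      using coproduct_ex1[OF K H g(1)] by metis
    have "ev \<cdot> (n \<odot> Ide V B) \<in> hom V (K \<otimes> B) M"
      using ev n(1) B by (auto simp: hom_def)
    then show ?thesis using uncurry[OF _ n(1) ev] n(2) g(2) by metis
  qed
  show "m = m'" if m: "m \<in> hom V (K \<otimes> B) M" "m' \<in> hom V (K \<otimes> B) M"
    and eq: "\<And>i. i \<in> A \<Longrightarrow> m \<cdot> (inc i \<odot> Ide V B) = m' \<cdot> (inc i \<odot> Ide V B)" for M m m'
  proof -
    obtain H ev where H: "H \<in> Obj V" and ev: "ev \<in> hom V (H \<otimes> B) M"
      and cur: "\<And>A f. A \<in> Obj V \<Longrightarrow> f \<in> hom V (A \<otimes> B) M \<Longrightarrow>
        \<exists>!g. g \<in> hom V A H \<and> ev \<cdot> (g \<odot> Ide V B) = f"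
      using curry[OF conjunct2[OF hom_Obj[OF m(1)]]] by blast
    obtain n n' where n: "n \<in> hom V K H" "ev \<cdot> (n \<odot> Ide V B) = m"
        "n' \<in> hom V K H" "ev \<cdot> (n' \<odot> Ide V B) = m'"
      using cur[OF KO m(1)] cur[OF KO m(2)] by blast
    have "n = n'"
    proof (rule coproduct_eqI[OF K n(1,3)])
      fix i assume i: "i \<in> A"
      have "n \<cdot> inc i \<in> hom V (X i) H" "n' \<cdot> inc i \<in> hom V (X i) H"
        using Comp_hom[OF coproduct_inj[OF K i]] n(1,3) by blast+
      moreover have "ev \<cdot> ((n \<cdot> inc i) \<odot> Ide V B) = ev \<cdot> ((n' \<cdot> inc i) \<odot> Ide V B)"
        using uncurry[OF i n(1) ev] uncurry[OF i n(3) ev] eq[OF i] n by simp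
      moreover have "ev \<cdot> ((n \<cdot> inc i) \<odot> Ide V B) \<in> hom V (X i \<otimes> B) M"
        using ev n(1) B i by (auto simp: hom_def inc)
      ultimately show "n \<cdot> inc i = n' \<cdot> inc i" using cur[OF X[OF i]] by metis
    qed
    then show ?thesis using n by simp
  qed
qed

text \<open>Conjugate the previous case by the braiding; naturality and symmetry turn the conjugated
  inclusions into \<open>Ide V B \<odot> inc i\<close>.\<close>

lemma TensO_coproduct_right:
  assumes closed: "is_closed V" and K: "is_coproduct V A X (K, inc)" and B: "B \<in> Obj V"
    and X: "\<And>i. i \<in> A \<Longrightarrow> X i \<in> Obj V"
  shows "is_coproduct V A (\<lambda>i. B \<otimes> X i) (B \<otimes> K, \<lambda>i. Ide V B \<odot> inc i)"
proof -
  have KO: "K \<in> Obj V" using K by (rule coproduct_Obj)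
  have "is_coproduct V A (\<lambda>i. B \<otimes> X i)
      (B \<otimes> K, \<lambda>i. Braid V K B \<cdot> (inc i \<odot> Ide V B) \<cdot> Braid V B (X i))"
    by (rule coproduct_iso[OF TensO_coproduct_left[OF assms] Braid_hom[OF KO B] Braid_iso[OF KO B],
        where x' = "\<lambda>i. Braid V (X i) B"])
      (use Braid_hom Braid_iso B X in auto)
  moreover have "Braid V K B \<cdot> (inc i \<odot> Ide V B) \<cdot> Braid V B (X i) = Ide V B \<odot> inc i"
    if i: "i \<in> A" for i
  proof -
    have inc: "inc i \<in> hom V (X i) K" using coproduct_inj[OF K i] .
    have "(inc i \<odot> Ide V B) \<cdot> Braid V B (X i) = Braid V B K \<cdot> (Ide V B \<odot> inc i)"
      using Braid_natural[OF Ide_hom[OF B] inc] by simp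
    then show ?thesis
      using Comp_assoc[OF TensA_hom[OF Ide_hom[OF B] inc] Braid_hom[OF B KO] Braid_hom[OF KO B]]
        symmetry[OF B KO] Ide_Comp[OF TensA_hom[OF Ide_hom[OF B] inc]] by simp
  qed
  ultimately show ?thesis
    by (elim coproduct_reindex[where h = "\<lambda>i. i"]) (auto simp: bij_betw_def)
qed

text \<open>One variable at a time: \<open>inc i \<odot> inc' j\<close> factors through
  \<open>X i \<otimes> L\<close>, and \<open>coproduct_Sigma\<close> merges the two
  coproducts.\<close>

lemma TensO_coproduct:
  assumes closed: "is_closed V"
    and K: "is_coproduct V A X (K, inc)" and X: "\<And>i. i \<in> A \<Longrightarrow> X i \<in> Obj V"
    and L: "is_coproduct V B Y (L, inc')" and Y: "\<And>j. j \<in> B \<Longrightarrow> Y j \<in> Obj V"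
  shows "is_coproduct V (A \<times> B) (\<lambda>(i, j). X i \<otimes> Y j) (K \<otimes> L, \<lambda>(i, j). inc i \<odot> inc' j)"
proof -
  have "is_coproduct V (A \<times> B) (\<lambda>(i, j). X i \<otimes> Y j)
      (K \<otimes> L, \<lambda>(i, j). (inc i \<odot> Ide V L) \<cdot> (Ide V (X i) \<odot> inc' j))"
    using coproduct_Sigma[OF TensO_coproduct_left[OF closed K coproduct_Obj[OF L] X]
        TensO_coproduct_right[OF closed L X Y]] .
  moreover have "(inc i \<odot> Ide V L) \<cdot> (Ide V (X i) \<odot> inc' j) = inc i \<odot> inc' j"
    if "i \<in> A" "j \<in> B" for i j
    using coproduct_inj[OF K that(1)] coproduct_inj[OF L that(2)] X[OF that(1)] coproduct_Obj[OF L]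
    by (auto simp: TensA_Comp_Arr hom_def)
  ultimately show ?thesis
    by (elim coproduct_reindex[where h = "\<lambda>i. i"]) (auto simp: bij_betw_def)
qed

lemma tobj_Obj_leaves: "(\<And>l. l \<in> set (leaves w) \<Longrightarrow> X l \<in> Obj V) \<Longrightarrow> tobj V X w \<in> Obj V"
  by (induction w) (auto simp: UnitO_Obj TensO_Obj)

text \<open>Distributivity for whole words: a summand is given by a function choosing an index at
  each leaf. Distinct leaves make the choices at different positions independent.\<close>

lemma tobj_coproduct:
  assumes closed: "is_closed V" and "distinct (leaves w)"
    and "\<And>l. l \<in> set (leaves w) \<Longrightarrow> is_coproduct V (I l) (X l) (K l, inc l)"
    and "\<And>l i. l \<in> set (leaves w) \<Longrightarrow> i \<in> I l \<Longrightarrow> X l i \<in> Obj V"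
  shows "is_coproduct V (Pi\<^sub>E (set (leaves w)) I) (\<lambda>c. tobj V (\<lambda>l. X l (c l)) w)
    (tobj V K w, \<lambda>c. tarr V (\<lambda>l. inc l (c l)) w)"
  using assms(2-4)
proof (induction w)
  case One
  then show ?case using coproduct_singleton[of "\<lambda>_. UnitO V"] UnitO_Obj by simp
next
  case (Leaf l)
  then have "is_coproduct V (I l) (X l) (K l, inc l)" by simp
  then show ?case
    unfolding tobj.simps tarr.simps
    by (rule coproduct_reindex[where h = "\<lambda>c. c l"])
      (auto intro!: bij_betwI[where g = "\<lambda>i. \<lambda>l\<in>{l}. i"] simp: PiE_iff extensional_def split: if_splits)
next
  case (Times v w)
  let ?v = "set (leaves v)" and ?w = "set (leaves w)"
  have disj: "?v \<inter> ?w = {}" using Times.prems(1) by auto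
  have "is_coproduct V (Pi\<^sub>E ?v I \<times> Pi\<^sub>E ?w I)
      (\<lambda>(c, d). tobj V (\<lambda>l. X l (c l)) v \<otimes> tobj V (\<lambda>l. X l (d l)) w)
      (tobj V K v \<otimes> tobj V K w, \<lambda>(c, d). tarr V (\<lambda>l. inc l (c l)) v \<odot> tarr V (\<lambda>l. inc l (d l)) w)"
    by (rule TensO_coproduct[OF closed])
      (use Times in \<open>auto intro!: tobj_Obj_leaves simp: PiE_iff\<close>)
  then have "is_coproduct V (Pi\<^sub>E (set (leaves (Times v w))) I) (\<lambda>c. tobj V (\<lambda>l. X l (c l)) (Times v w))
    (tobj V K v \<otimes> tobj V K w, \<lambda>c. tarr V (\<lambda>l. inc l (c l)) (Times v w))"
  proof (rule coproduct_reindex[where h = "\<lambda>c. (restrict c ?v, restrict c ?w)"])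
    \<comment> \<open>Restriction to the two disjoint sets of leaves splits a choice function into a
      pair; gluing is the inverse.\<close>
    show "bij_betw (\<lambda>c. (restrict c ?v, restrict c ?w)) (Pi\<^sub>E (set (leaves (Times v w))) I)
        (Pi\<^sub>E ?v I \<times> Pi\<^sub>E ?w I)"
      by (rule bij_betwI[where g = "\<lambda>(c, d) l. if l \<in> ?v then c l else d l"])
        (use disj in \<open>auto simp: PiE_iff extensional_def fun_eq_iff split: if_splits\<close>)
    show "tobj V (\<lambda>l. X l (c l)) (Times v w) = (case (restrict c ?v, restrict c ?w) of
        (c, d) \<Rightarrow> tobj V (\<lambda>l. X l (c l)) v \<otimes> tobj V (\<lambda>l. X l (d l)) w)" for c
      by (auto intro!: arg_cong2[where f = "TensO V"] tobj_cong)
    show "tarr V (\<lambda>l. inc l (c l)) (Times v w) = (case (restrict c ?v, restrict c ?w) of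
        (c, d) \<Rightarrow> tarr V (\<lambda>l. inc l (c l)) v \<odot> tarr V (\<lambda>l. inc l (d l)) w)" for c
      by (auto intro!: arg_cong2[where f = "TensA V"] tarr_cong)
  qed
  then show ?case by simp
qed

section \<open>Tensor words of maps and naturality of canonical isomorphisms\<close>

lemma tarr_hom:
  "(\<And>l. l \<in> set (leaves w) \<Longrightarrow> h l \<in> hom V (X l) (Y l)) \<Longrightarrow>
    tarr V h w \<in> hom V (tobj V X w) (tobj V Y w)"
  by (induction w) (auto intro: TensA_hom Ide_hom UnitO_Obj)

lemma tarr_Comp:
  assumes "\<And>l. l \<in> set (leaves w) \<Longrightarrow> h l \<in> hom V (X l) (Y l)"
    and "\<And>l. l \<in> set (leaves w) \<Longrightarrow> k l \<in> hom V (Y l) (Z l)"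
  shows "tarr V k w \<cdot> tarr V h w = tarr V (\<lambda>l. k l \<cdot> h l) w"
  using assms
proof (induction w)
  case (Times v w)
  have "tarr V h v \<in> hom V (tobj V X v) (tobj V Y v)" "tarr V h w \<in> hom V (tobj V X w) (tobj V Y w)"
    "tarr V k v \<in> hom V (tobj V Y v) (tobj V Z v)" "tarr V k w \<in> hom V (tobj V Y w) (tobj V Z w)"
    using Times.prems by (auto intro!: tarr_hom)
  from TensA_Comp[OF this(1,3,2,4)] show ?case using Times by simp
qed (auto simp: UnitO_Obj)

lemma tarr_Ide:
  "(\<And>l. l \<in> set (leaves w) \<Longrightarrow> X l \<in> Obj V) \<Longrightarrow> tarr V (\<lambda>l. Ide V (X l)) w = Ide V (tobj V X w)"
  by (induction w) (auto simp: TensA_Ide tobj_Obj_leaves)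

text \<open>
  Naturality of the structure isomorphisms lets one move a canonical map past a tensor product of
  arbitrary maps. The map \<open>\<psi>\<close> is built alongside \<open>\<phi>\<close>, so Mac Lane's coherence theorem is not needed.
\<close>

lemma canonical_natural:
  assumes can: "canonical V X v w \<phi>"
    and h: "\<And>l. l \<in> set (leaves v) \<Longrightarrow> h l \<in> hom V (Y l) (X l)"
  shows "\<exists>\<psi>. canonical V Y v w \<psi> \<and> \<psi> \<in> hom V (tobj V Y v) (tobj V Y w) \<and>
    \<phi> \<in> hom V (tobj V X v) (tobj V X w) \<and> \<phi> \<cdot> tarr V h v = tarr V h w \<cdot> \<psi>"
proof -
  define S where "S = set (leaves v)"
  \<comment> \<open>Canonical maps are known to be well-typed isomorphisms only if every label
    carries an object. Labels outside the words therefore receive the unit object, and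
    \<open>h'\<close> is the identity there; at the leaves themselves nothing changes.\<close>
  define X' where "X' l = (if l \<in> S then X l else UnitO V)" for l
  define Y' where "Y' l = (if l \<in> S then Y l else UnitO V)" for l
  define h' where "h' l = (if l \<in> S then h l else Ide V (UnitO V))" for l
  have h': "h' l \<in> hom V (Y' l) (X' l)" for l
    using h by (simp add: h'_def X'_def Y'_def S_def Ide_hom UnitO_Obj)
  have O: "X' l \<in> Obj V" "Y' l \<in> Obj V" for l using hom_Obj[OF h'] by blast+
  have H: "tarr V h' u \<in> hom V (tobj V Y' u) (tobj V X' u)" for u by (rule tarr_hom) (rule h')
  have canX: "canonical V X' v w \<phi>"
    using can by (rule canonical_cong) (simp add: X'_def S_def)
  from canX have "\<exists>\<psi>. canonical V Y' v w \<psi> \<and> \<phi> \<cdot> tarr V h' v = tarr V h' w \<cdot> \<psi>"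
  proof (induction rule: canonical.induct)
    case (can_Ide w)
    have "Ide V (tobj V X' w) \<cdot> tarr V h' w = tarr V h' w \<cdot> Ide V (tobj V Y' w)"
      using H[of w] by (auto simp: hom_def)
    then show ?case using canonical.can_Ide by blast
  next
    case (can_Comp u v \<phi> w \<psi>)
    then obtain \<phi>' \<psi>' where \<phi>': "canonical V Y' u v \<phi>'" "\<phi> \<cdot> tarr V h' u = tarr V h' v \<cdot> \<phi>'"
      and \<psi>': "canonical V Y' v w \<psi>'" "\<psi> \<cdot> tarr V h' v = tarr V h' w \<cdot> \<psi>'"
      by blast
    note hs = canonical_hom_iso[OF can_Comp.hyps(1) O(1), THEN conjunct1]
      canonical_hom_iso[OF can_Comp.hyps(2) O(1), THEN conjunct1]
      canonical_hom_iso[OF \<phi>'(1) O(2), THEN conjunct1]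
      canonical_hom_iso[OF \<psi>'(1) O(2), THEN conjunct1]
    have "(\<psi> \<cdot> \<phi>) \<cdot> tarr V h' u = \<psi> \<cdot> tarr V h' v \<cdot> \<phi>'"
      using Comp_assoc[OF H hs(1,2)] \<phi>'(2) by simp
    also have "\<dots> = (tarr V h' w \<cdot> \<psi>') \<cdot> \<phi>'"
      using Comp_assoc[OF hs(3) H hs(2)] \<psi>'(2) by simp
    also have "\<dots> = tarr V h' w \<cdot> (\<psi>' \<cdot> \<phi>')" using Comp_assoc[OF hs(3,4) H] .
    finally show ?case using canonical.can_Comp[OF \<phi>'(1) \<psi>'(1)] by blast
  next
    case (can_Tens v w \<phi> v' w' \<psi>)
    then obtain \<phi>' \<psi>' where \<phi>': "canonical V Y' v w \<phi>'" "\<phi> \<cdot> tarr V h' v = tarr V h' w \<cdot> \<phi>'"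
      and \<psi>': "canonical V Y' v' w' \<psi>'" "\<psi> \<cdot> tarr V h' v' = tarr V h' w' \<cdot> \<psi>'"
      by blast
    note hs = canonical_hom_iso[OF can_Tens.hyps(1) O(1), THEN conjunct1]
      canonical_hom_iso[OF can_Tens.hyps(2) O(1), THEN conjunct1]
      canonical_hom_iso[OF \<phi>'(1) O(2), THEN conjunct1]
      canonical_hom_iso[OF \<psi>'(1) O(2), THEN conjunct1]
    have "(\<phi> \<odot> \<psi>) \<cdot> tarr V h' (Times v v') = tarr V h' (Times w w') \<cdot> (\<phi>' \<odot> \<psi>')"
      using TensA_Comp[OF H hs(1) H hs(2)] TensA_Comp[OF hs(3) H hs(4) H] \<phi>'(2) \<psi>'(2) by simp
    then show ?case using canonical.can_Tens[OF \<phi>'(1) \<psi>'(1)] by blast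
  next
    case (can_inv v w \<phi> \<psi>)
    then obtain \<phi>' where \<phi>': "canonical V Y' v w \<phi>'" "\<phi> \<cdot> tarr V h' v = tarr V h' w \<cdot> \<phi>'"
      by blast
    obtain \<psi>' where inv: "inverse_arrows V \<phi>' \<psi>'"
      using canonical_hom_iso[OF \<phi>'(1) O(2)] unfolding is_iso_def by blast
    note hs = canonical_hom_iso[OF can_inv.hyps(1) O(1), THEN conjunct1]
      canonical_hom_iso[OF \<phi>'(1) O(2), THEN conjunct1]
    have i: "\<psi> \<in> hom V (tobj V X' w) (tobj V X' v)" "\<psi> \<cdot> \<phi> = Ide V (tobj V X' v)"
      "\<psi>' \<in> hom V (tobj V Y' w) (tobj V Y' v)" "\<phi>' \<cdot> \<psi>' = Ide V (tobj V Y' w)"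
      using can_inv.hyps(2) inv hs by (auto simp: inverse_arrows_def hom_def)
    \<comment> \<open>Insert \<open>\<phi>' \<cdot> \<psi>'\<close>, which is an identity, on the
      right, replace \<open>tarr V h' w \<cdot> \<phi>'\<close> by the square for
      \<open>\<phi>\<close>, and cancel \<open>\<psi> \<cdot> \<phi>\<close> on the left.\<close>
    have "\<psi> \<cdot> tarr V h' w = \<psi> \<cdot> tarr V h' w \<cdot> (\<phi>' \<cdot> \<psi>')"
      using i(4) Comp_Ide[OF H] by simp
    also have "\<dots> = \<psi> \<cdot> (\<phi> \<cdot> tarr V h' v) \<cdot> \<psi>'"
      using Comp_assoc[OF i(3) hs(2) H] \<phi>'(2) by simp
    also have "\<dots> = \<psi> \<cdot> \<phi> \<cdot> tarr V h' v \<cdot> \<psi>'"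
      using Comp_assoc[OF i(3) H hs(1)] by simp
    also have "\<dots> = (\<psi> \<cdot> \<phi>) \<cdot> tarr V h' v \<cdot> \<psi>'"
      using Comp_assoc[OF Comp_hom[OF i(3) H] hs(1) i(1)] by simp
    also have "\<dots> = tarr V h' v \<cdot> \<psi>'" using i(2) Ide_Comp[OF Comp_hom[OF i(3) H]] by simp
    finally show ?case using canonical.can_inv[OF \<phi>'(1) inv] by blast
  next
    case (can_Assoc u v w)
    show ?case using Assoc_natural[OF H H H] canonical.can_Assoc by fastforce
  next
    case (can_LUnit w)
    show ?case using LUnit_natural[OF H] canonical.can_LUnit by fastforce
  next
    case (can_RUnit w)
    show ?case using RUnit_natural[OF H] canonical.can_RUnit by fastforce
  next
    case (can_Braid v w)
    show ?case using Braid_natural[OF H H] canonical.can_Braid by fastforce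
  qed
  then obtain \<psi> where \<psi>: "canonical V Y' v w \<psi>" "\<phi> \<cdot> tarr V h' v = tarr V h' w \<cdot> \<psi>" by blast
  have S: "set (leaves w) = S" using canonical_leaves[OF can] unfolding S_def by (metis set_mset_mset)
  have eqs: "tobj V X' u = tobj V X u" "tobj V Y' u = tobj V Y u" "tarr V h' u = tarr V h u"
    if "set (leaves u) = S" for u
    using that by (auto intro!: tobj_cong tarr_cong simp: X'_def Y'_def h'_def)
  have "canonical V Y v w \<psi>" using \<psi>(1) by (rule canonical_cong) (simp add: Y'_def S_def)
  then show ?thesis
    using \<psi>(2) canonical_hom_iso[OF \<psi>(1) O(2)] canonical_hom_iso[OF canX O(1)]
    by (auto simp: eqs S eqs[of v, OF S_def[symmetric]])
qed

end

subsection \<open>Iterated tensor products\<close>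

text \<open>A tensor product of words has as its value the iterated product of the values of these
  words; this makes the value of \<open>assoc_tgt\<close> a nested \<open>bigO\<close>.\<close>

lemma tobj_tens_map: "tobj V X (tens (map w xs)) = tobj V (\<lambda>i. tobj V X (w i)) (tens (map Leaf xs))"
  by (induction xs rule: induct_list012) auto

lemma tarr_tens_map: "tarr V h (tens (map w xs)) = tarr V (\<lambda>i. tarr V h (w i)) (tens (map Leaf xs))"
  by (induction xs rule: induct_list012) auto

lemma set_leaves_big: "set (leaves (tens (map Leaf [Suc 0..<Suc n]))) = {1..n}"
  by (auto simp: leaves_tens simp del: upt_Suc)

lemma bigO_cong: "n = m \<Longrightarrow> (\<And>i. i \<in> {1..m} \<Longrightarrow> X i = Y i) \<Longrightarrow> bigO V n X = bigO V m Y"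
  unfolding bigO_def by (auto intro!: tobj_cong simp: set_leaves_big simp del: upt_Suc)

lemma bigA_cong: "n = m \<Longrightarrow> (\<And>i. i \<in> {1..m} \<Longrightarrow> h i = k i) \<Longrightarrow> bigA V n h = bigA V m k"
  unfolding bigA_def by (auto intro!: tarr_cong simp: set_leaves_big simp del: upt_Suc)

lemma bigO_1: "bigO V (Suc 0) X = X 1" and bigA_1: "bigA V (Suc 0) h = h 1"
  by (simp_all add: bigO_def bigA_def)

lemma tobj_assoc_src:
  "tobj V X (assoc_src \<beta>) = bigO V (Dom sFSet \<beta>) (\<lambda>j. X (Up j)) \<otimes>\<^bsub>V\<^esub>
    bigO V (Cod sFSet \<beta>) (\<lambda>i. X (Mid i)) \<otimes>\<^bsub>V\<^esub> X Low"
  by (simp add: assoc_src_def bigO_def tobj_tens_map[of V X] del: upt_Suc)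

lemma tarr_assoc_src:
  "tarr V h (assoc_src \<beta>) = bigA V (Dom sFSet \<beta>) (\<lambda>j. h (Up j)) \<odot>\<^bsub>V\<^esub>
    bigA V (Cod sFSet \<beta>) (\<lambda>i. h (Mid i)) \<odot>\<^bsub>V\<^esub> h Low"
  by (simp add: assoc_src_def bigA_def tarr_tens_map[of V h] del: upt_Suc)

lemma tobj_assoc_tgt:
  "tobj V X (assoc_tgt \<beta>) = bigO V (Cod sFSet \<beta>)
    (\<lambda>i. bigO V (sfib \<beta> i) (\<lambda>p. X (Up (sincl \<beta> i p))) \<otimes>\<^bsub>V\<^esub> X (Mid i)) \<otimes>\<^bsub>V\<^esub> X Low"
  by (simp add: assoc_tgt_def bigO_def tobj_tens_map[of V X] del: upt_Suc)

lemma tarr_assoc_tgt: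
  "tarr V h (assoc_tgt \<beta>) = bigA V (Cod sFSet \<beta>)
    (\<lambda>i. bigA V (sfib \<beta> i) (\<lambda>p. h (Up (sincl \<beta> i p))) \<odot>\<^bsub>V\<^esub> h (Mid i)) \<odot>\<^bsub>V\<^esub> h Low"
  by (simp add: assoc_tgt_def bigA_def tarr_tens_map[of V h] del: upt_Suc)

lemma set_leaves_assoc_src:
  "set (leaves (assoc_src \<beta>)) = Up ` {1..Dom sFSet \<beta>} \<union> Mid ` {1..Cod sFSet \<beta>} \<union> {Low}"
  by (auto simp: assoc_src_def leaves_tens simp del: upt_Suc)

context symmetric_monoidal_category
begin

lemma bigO_Obj: "(\<And>i. i \<in> {1..n} \<Longrightarrow> X i \<in> Obj V) \<Longrightarrow> bigO V n X \<in> Obj V"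
  unfolding bigO_def by (rule tobj_Obj_leaves) (simp add: set_leaves_big del: upt_Suc)

lemma bigA_hom:
  "(\<And>i. i \<in> {1..n} \<Longrightarrow> h i \<in> hom V (X i) (Y i)) \<Longrightarrow> bigA V n h \<in> hom V (bigO V n X) (bigO V n Y)"
  unfolding bigA_def bigO_def by (rule tarr_hom) (simp add: set_leaves_big del: upt_Suc)

lemma bigA_Comp:
  assumes "\<And>i. i \<in> {1..n} \<Longrightarrow> h i \<in> hom V (X i) (Y i)"
    and "\<And>i. i \<in> {1..n} \<Longrightarrow> k i \<in> hom V (Y i) (Z i)"
  shows "bigA V n k \<cdot> bigA V n h = bigA V n (\<lambda>i. k i \<cdot> h i)"
  unfolding bigA_def by (rule tarr_Comp[of _ _ X Y _ Z]) (use assms in \<open>simp_all add: set_leaves_big del: upt_Suc\<close>)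

lemma bigA_Ide:
  "(\<And>i. i \<in> {1..n} \<Longrightarrow> X i \<in> Obj V) \<Longrightarrow> bigA V n (\<lambda>i. Ide V (X i)) = Ide V (bigO V n X)"
  unfolding bigA_def bigO_def by (rule tarr_Ide) (simp add: set_leaves_big del: upt_Suc)

end

section \<open>Connected components\<close>

context category
begin

lemma equiv_connected_rel: "equiv (Obj C) (connected_rel C)"
proof (rule equivI)
  let ?R = "{(X, Y). hom C X Y \<noteq> {} \<or> hom C Y X \<noteq> {}}"
  have "sym (?R\<^sup>*)" by (rule sym_rtrancl) (auto simp: sym_def)
  then show "sym (connected_rel C)" by (auto simp: connected_rel_def sym_def)
  show "trans (connected_rel C)"
    by (rule transI) (auto simp: connected_rel_def intro: rtrancl_trans)
qed (auto simp: connected_rel_def refl_on_def)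

lemma component_pi0: "A \<in> Obj C \<Longrightarrow> component C A \<in> pi0 C"
  by (simp add: component_def pi0_def quotientI)

lemma mem_component: "A \<in> Obj C \<Longrightarrow> A \<in> component C A"
  by (auto simp: component_def connected_rel_def)

lemma pi0_Obj: "c \<in> pi0 C \<Longrightarrow> A \<in> c \<Longrightarrow> A \<in> Obj C"
  by (auto simp: pi0_def quotient_def connected_rel_def)

lemma component_eq: "c \<in> pi0 C \<Longrightarrow> A \<in> c \<Longrightarrow> component C A = c"
  unfolding pi0_def component_def
  by (metis Image_singleton_iff equiv_class_eq equiv_connected_rel quotientE)

lemma component_Dom: "f \<in> Arr C \<Longrightarrow> component C (Dom C f) = component C (Cod C f)"
  unfolding component_def
  by (rule equiv_class_eq[OF equiv_connected_rel])
    (use Dom_Obj Cod_Obj in \<open>auto simp: connected_rel_def hom_def intro!: r_into_rtrancl\<close>)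

end

text \<open>A zigzag of arrows is mapped to a zigzag, step by step and in either direction.\<close>

lemma functor_connected:
  assumes F: "is_functor C D F" and AB: "(A, B) \<in> connected_rel C"
  shows "(FO F A, FO F B) \<in> connected_rel D"
proof -
  let ?R = "{(X, Y). hom C X Y \<noteq> {} \<or> hom C Y X \<noteq> {}}"
  let ?S = "{(X, Y). hom D X Y \<noteq> {} \<or> hom D Y X \<noteq> {}}"
  have "(A, B) \<in> ?R\<^sup>*" using AB by (simp add: connected_rel_def)
  then have "(FO F A, FO F B) \<in> ?S\<^sup>*"
  proof induction
    case (step X Y)
    have "hom D (FO F X) (FO F Y) \<noteq> {}" if "hom C X Y \<noteq> {}" for X Y
      using F that by (fastforce simp: is_functor_def hom_def)
    with step have "(FO F X, FO F Y) \<in> ?S" by blast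
    with step show ?case by (simp add: rtrancl.rtrancl_into_rtrancl)
  qed simp
  then show ?thesis using F AB by (simp add: connected_rel_def is_functor_def)
qed

text \<open>The union in \<open>pi0_map\<close> collapses: connected objects have connected images,
  so every member of \<open>c\<close> contributes the same component.\<close>

lemma pi0_map_eq:
  assumes F: "is_functor C D F" and c: "c \<in> pi0 C" and x: "x \<in> c"
  shows "pi0_map D F c = component D (FO F x)"
proof -
  interpret C: category C using F by (simp add: is_functor_def)
  interpret D: category D using F by (simp add: is_functor_def)
  have *: "component D (FO F y) = component D (FO F x)" if "y \<in> c" for y
  proof -
    have "(y, x) \<in> connected_rel C"
      using C.component_eq[OF c that] x unfolding component_def by blast
    from functor_connected[OF F this] show ?thesis
      unfolding component_def by (rule equiv_class_eq[OF D.equiv_connected_rel])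
  qed
  have "c \<noteq> {}" using x by blast
  then show ?thesis unfolding pi0_map_def by (rule SUP_eq_const) (rule *)
qed

section \<open>The category of operads\<close>

lemma Op_simps [simp]:
  "Obj (Op V \<O>) = {P. is_operad V \<O> P}"
  "(P, \<theta>, Q) \<in> Arr (Op V \<O>) \<longleftrightarrow> is_operad V \<O> P \<and> is_operad V \<O> Q \<and> is_operad_map V \<O> P Q \<theta>"
  "Dom (Op V \<O>) (P, \<theta>, Q) = P" "Cod (Op V \<O>) (P, \<theta>, Q) = Q"
  "Ide (Op V \<O>) P = (P, \<lambda>T\<in>Obj \<O>. Ide V (ob P T), P)"
  "(Q', \<eta>, R) \<cdot>\<^bsub>Op V \<O>\<^esub> (P, \<theta>, Q) = (P, \<lambda>T\<in>Obj \<O>. \<eta> T \<cdot>\<^bsub>V\<^esub> \<theta> T, R)"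
  by (simp_all add: Op_def)

lemma hom_Op_iff:
  "f \<in> hom (Op V \<O>) P Q \<longleftrightarrow>
    (\<exists>\<theta>. f = (P, \<theta>, Q) \<and> is_operad V \<O> P \<and> is_operad V \<O> Q \<and> is_operad_map V \<O> P Q \<theta>)"
  by (cases f) (auto simp: hom_def)

context operadic_category
begin

lemma fib_Obj_Arr: "f \<in> Arr \<O> \<Longrightarrow> i \<in> {1..sz \<O> (Cod \<O> f)} \<Longrightarrow> fib \<O> f i \<in> Obj \<O>"
  using fib_Obj[of f "Dom \<O> f" "Cod \<O> f" i] by (simp add: hom_def)

lemma trm_Obj: "c \<in> pi0 \<O> \<Longrightarrow> trm \<O> c \<in> Obj \<O>"
  using trm_mem pi0_Obj by blast

lemma component_trm: "c \<in> pi0 \<O> \<Longrightarrow> component \<O> (trm \<O> c) = c"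
  using trm_mem component_eq by blast

lemma szm_Arr: "f \<in> Arr \<O> \<Longrightarrow> szm \<O> f \<in> Arr sFSet"
  and Dom_szm: "f \<in> Arr \<O> \<Longrightarrow> Dom sFSet (szm \<O> f) = sz \<O> (Dom \<O> f)"
  and Cod_szm: "f \<in> Arr \<O> \<Longrightarrow> Cod sFSet (szm \<O> f) = sz \<O> (Cod \<O> f)"
  using crd_functor by (auto simp: is_functor_def hom_def)

lemma ind_simps:
  assumes "f \<in> Arr \<O>" "g \<in> Arr \<O>" "Dom \<O> g = Cod \<O> f" "i \<in> {1..sz \<O> (Cod \<O> g)}"
  shows "ind \<O> f g i \<in> Arr \<O>" "Dom \<O> (ind \<O> f g i) = fib \<O> (g \<cdot> f) i"
    "Cod \<O> (ind \<O> f g i) = fib \<O> g i"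
  using ind_hom[of f "Dom \<O> f" "Cod \<O> f" g "Cod \<O> g" i] assms by (auto simp: hom_def)

lemma sz_fib_Arr: "f \<in> Arr \<O> \<Longrightarrow> i \<in> {1..sz \<O> (Cod \<O> f)} \<Longrightarrow> sz \<O> (fib \<O> f i) = sfib (szm \<O> f) i"
  using sz_fib[of f "Dom \<O> f" "Cod \<O> f" i] by (simp add: hom_def)

end

section \<open>Fibers of maps of finite sets and their order isomorphisms with preimages\<close>

lemma sincl_spre:
  assumes p: "p \<in> {1..sfib \<beta> i}"
  shows "sincl \<beta> i p \<in> spre \<beta> i"
proof -
  define xs where "xs = sorted_list_of_set (spre \<beta> i)"
  have "finite (spre \<beta> i)" by (simp add: spre_def)
  then have xs: "set xs = spre \<beta> i" "length xs = sfib \<beta> i" by (simp_all add: sfib_def xs_def)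
  have "xs ! (p - 1) \<in> set xs" by (rule nth_mem) (use p xs(2) in auto)
  then show ?thesis using xs(1) by (simp add: sincl_def xs_def)
qed

text \<open>Exactly \<open>p\<close> elements of the preimage do not exceed its \<open>p\<close>-th
  element in increasing order.\<close>

lemma spos_sincl:
  assumes p: "p \<in> {1..sfib \<beta> i}"
  shows "spos \<beta> i (sincl \<beta> i p) = p"
proof -
  define xs where "xs = sorted_list_of_set (spre \<beta> i)"
  have fin: "finite (spre \<beta> i)" by (simp add: spre_def)
  have xs: "set xs = spre \<beta> i" "length xs = sfib \<beta> i" "sorted_wrt (<) xs"
    using fin by (simp_all add: sfib_def xs_def)
  have lt: "xs ! a \<le> xs ! b \<longleftrightarrow> a \<le> b" if "a < length xs" "b < length xs" for a b
    using sorted_wrt_nth_less[OF xs(3), of a b] sorted_wrt_nth_less[OF xs(3), of b a] that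
    by (cases a b rule: linorder_cases) auto
  have q: "p - 1 < length xs" using p xs(2) by auto
  \<comment> \<open>These are the entries at list positions \<open>0, ..., p - 1\<close>: list
    positions count from 0, points of a fiber from 1.\<close>
  have "{k' \<in> spre \<beta> i. k' \<le> xs ! (p - 1)} = (\<lambda>a. xs ! a) ` {..<p}"
  proof (intro set_eqI iffI)
    fix k assume "k \<in> {k' \<in> spre \<beta> i. k' \<le> xs ! (p - 1)}"
    then obtain a where "k = xs ! a" "a < length xs" "xs ! a \<le> xs ! (p - 1)"
      by (auto simp: in_set_conv_nth simp flip: xs(1))
    moreover from this have "a < p" using lt[OF _ q, of a] p by auto
    ultimately show "k \<in> (\<lambda>a. xs ! a) ` {..<p}" by blast
  next
    fix k assume "k \<in> (\<lambda>a. xs ! a) ` {..<p}"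
    then obtain a where "k = xs ! a" "a < p" by blast
    then show "k \<in> {k' \<in> spre \<beta> i. k' \<le> xs ! (p - 1)}"
      using lt[OF _ q, of a] p xs(2) nth_mem[of a xs] by (simp add: xs(1))
  qed
  moreover have "inj_on (\<lambda>a. xs ! a) {..<p}"
    using p xs(2) xs(3) by (auto simp: strict_sorted_iff inj_on_def nth_eq_iff_index_eq)
  ultimately show ?thesis by (simp add: spos_def sincl_def card_image flip: xs_def)
qed

text \<open>The axiom \<open>fib_ind\<close> at \<open>j = sincl (szm \<O> g) i p\<close>, whose
  position in the fiber over \<open>i\<close> is \<open>p\<close>. It explains the labels
  \<open>Up (sincl \<beta> i p)\<close> in \<open>assoc_tgt\<close>.\<close>

lemma (in operadic_category) fib_ind_sincl:
  assumes "f \<in> Arr \<O>" "g \<in> Arr \<O>" "Dom \<O> g = Cod \<O> f" "p \<in> {1..sfib (szm \<O> g) i}"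
  shows "fib \<O> (ind \<O> f g i) p = fib \<O> f (sincl (szm \<O> g) i p)"
proof -
  have "sincl (szm \<O> g) i p \<in> spre (szm \<O> g) i" using assms(4) by (rule sincl_spre)
  then have j: "sincl (szm \<O> g) i p \<in> {1..sz \<O> (Cod \<O> f)}" "i = sapp (szm \<O> g) (sincl (szm \<O> g) i p)"
    using assms(2,3) by (auto simp: spre_def Dom_szm)
  show ?thesis
    using fib_ind[of f "Dom \<O> f" "Cod \<O> f" g "Cod \<O> g", OF _ _ j] spos_sincl[OF assms(4)] assms(1-3)
    by (simp add: hom_def)
qed

section \<open>Operads and their morphisms over a fixed operadic category\<close>

locale operads = symmetric_monoidal_category V + O: operadic_category \<O>
  for V :: "('vo, 'va) smc" (structure) and \<O> :: "('o, 'a) operadic"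
begin

lemma operad_ob: "is_operad V \<O> P \<Longrightarrow> T \<in> Obj \<O> \<Longrightarrow> ob P T \<in> Obj V"
  by (auto simp: is_operad_def)

lemma operad_unt: "is_operad V \<O> P \<Longrightarrow> c \<in> pi0 \<O> \<Longrightarrow> unt P c \<in> hom V (UnitO V) (ob P (trm \<O> c))"
  by (auto simp: is_operad_def)

lemma operad_mu: "is_operad V \<O> P \<Longrightarrow> f \<in> Arr \<O> \<Longrightarrow>
    mu P f \<in> hom V (ob_fib V \<O> (ob P) f \<otimes> ob P (Cod \<O> f)) (ob P (Dom \<O> f))"
  by (auto simp: is_operad_def)

lemma operad_assoc:
  assumes "is_operad V \<O> P" "f \<in> Arr \<O>" "g \<in> Arr \<O>" "Dom \<O> g = Cod \<O> f"
    and "canonical V (case_slot (\<lambda>j. ob P (fib \<O> f j)) (\<lambda>i. ob P (fib \<O> g i)) (ob P (Cod \<O> g)))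
      (assoc_src (szm \<O> g)) (assoc_tgt (szm \<O> g)) \<phi>"
  shows "mu P f \<cdot> (Ide V (ob_fib V \<O> (ob P) f) \<odot> mu P g) =
    mu P (g \<cdot>\<^bsub>\<O>\<^esub> f) \<cdot>
      (bigA V (sz \<O> (Cod \<O> g)) (\<lambda>i. mu P (ind \<O> f g i)) \<odot> Ide V (ob P (Cod \<O> g))) \<cdot> \<phi>"
  using assms unfolding is_operad_def by blast

lemma operad_unit_left:
  assumes "is_operad V \<O> P" "T \<in> Obj \<O>"
    and "canonical V (\<lambda>_::unit. ob P T)
      (Leaf ()) (Times (tens (map (\<lambda>_. One) [1..<Suc (sz \<O> T)])) (Leaf ())) \<phi>"
  shows "mu P (Ide \<O> T) \<cdot>
    (bigA V (sz \<O> T) (\<lambda>i. unt P (component \<O> (fib \<O> (Ide \<O> T) i))) \<odot> Ide V (ob P T)) \<cdot> \<phi> = Ide V (ob P T)"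
  using assms unfolding is_operad_def by blast

lemma operad_unit_right:
  assumes "is_operad V \<O> P" "c \<in> pi0 \<O>" "T \<in> c" "f \<in> hom \<O> T (trm \<O> c)"
    and "canonical V (\<lambda>_::unit. ob P T) (Leaf ()) (Times (Leaf ()) One) \<phi>"
  shows "mu P f \<cdot> (Ide V (ob P T) \<odot> unt P c) \<cdot> \<phi> = Ide V (ob P T)"
  using assms unfolding is_operad_def by blast

lemma operad_map_unt: "is_operad_map V \<O> P Q \<theta> \<Longrightarrow> c \<in> pi0 \<O> \<Longrightarrow> \<theta> (trm \<O> c) \<cdot> unt P c = unt Q c"
  and operad_map_mu: "is_operad_map V \<O> P Q \<theta> \<Longrightarrow> f \<in> Arr \<O> \<Longrightarrow> \<theta> (Dom \<O> f) \<cdot> mu P f =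
    mu Q f \<cdot> (bigA V (sz \<O> (Cod \<O> f)) (\<lambda>i. \<theta> (fib \<O> f i)) \<odot> \<theta> (Cod \<O> f))"
  by (simp_all add: is_operad_map_def)

lemma operad_map_hom: "is_operad_map V \<O> P Q \<theta> \<Longrightarrow> T \<in> Obj \<O> \<Longrightarrow> \<theta> T \<in> hom V (ob P T) (ob Q T)"
  by (auto simp: is_operad_map_def)

lemma ob_fib_hom:
  "f \<in> Arr \<O> \<Longrightarrow> (\<And>T. T \<in> Obj \<O> \<Longrightarrow> \<theta> T \<in> hom V (X T) (Y T)) \<Longrightarrow>
    bigA V (sz \<O> (Cod \<O> f)) (\<lambda>i. \<theta> (fib \<O> f i)) \<in> hom V (ob_fib V \<O> X f) (ob_fib V \<O> Y f)"
  unfolding ob_fib_def by (rule bigA_hom) (use O.fib_Obj_Arr in blast)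

lemma ob_fib_Obj: "f \<in> Arr \<O> \<Longrightarrow> (\<And>T. T \<in> Obj \<O> \<Longrightarrow> X T \<in> Obj V) \<Longrightarrow> ob_fib V \<O> X f \<in> Obj V"
  unfolding ob_fib_def by (rule bigO_Obj) (use O.fib_Obj_Arr in blast)

lemma operad_map_Ide:
  assumes P: "is_operad V \<O> P"
  shows "is_operad_map V \<O> P P (\<lambda>T\<in>Obj \<O>. Ide V (ob P T))"
  unfolding is_operad_map_def
proof (intro conjI ballI)
  show "(\<lambda>T\<in>Obj \<O>. Ide V (ob P T)) \<in> (\<Pi>\<^sub>E T\<in>Obj \<O>. hom V (ob P T) (ob P T))"
    using operad_ob[OF P] Ide_hom by auto
  show "(\<lambda>T\<in>Obj \<O>. Ide V (ob P T)) (trm \<O> c) \<cdot> unt P c = unt P c" if "c \<in> pi0 \<O>" for c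
    using operad_unt[OF P that] O.trm_Obj[OF that] by (simp add: Ide_Comp)
  fix f assume f: "f \<in> Arr \<O>"
  have "bigA V (sz \<O> (Cod \<O> f)) (\<lambda>i. (\<lambda>T\<in>Obj \<O>. Ide V (ob P T)) (fib \<O> f i)) =
      bigA V (sz \<O> (Cod \<O> f)) (\<lambda>i. Ide V (ob P (fib \<O> f i)))"
    by (rule bigA_cong) (use O.fib_Obj_Arr[OF f] in auto)
  also have "\<dots> = Ide V (ob_fib V \<O> (ob P) f)"
    unfolding ob_fib_def by (rule bigA_Ide) (use O.fib_Obj_Arr[OF f] operad_ob[OF P] in auto)
  finally show "(\<lambda>T\<in>Obj \<O>. Ide V (ob P T)) (Dom \<O> f) \<cdot> mu P f = mu P f \<cdot>
      (bigA V (sz \<O> (Cod \<O> f)) (\<lambda>i. (\<lambda>T\<in>Obj \<O>. Ide V (ob P T)) (fib \<O> f i)) \<odot>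
       (\<lambda>T\<in>Obj \<O>. Ide V (ob P T)) (Cod \<O> f))"
    using operad_mu[OF P f] f O.Dom_Obj O.Cod_Obj operad_ob[OF P] ob_fib_Obj[OF f operad_ob[OF P]]
    by (simp add: TensA_Ide Ide_Comp Comp_Ide)
qed

text \<open>The squares for \<open>\<theta>\<close> and \<open>\<eta>\<close> are pasted, and
  functoriality of the tensor product merges the two maps on the fibers.\<close>

lemma operad_map_Comp:
  assumes P: "is_operad V \<O> P" and Q: "is_operad V \<O> Q" and R: "is_operad V \<O> R"
    and \<theta>: "is_operad_map V \<O> P Q \<theta>" and \<eta>: "is_operad_map V \<O> Q R \<eta>"
  shows "is_operad_map V \<O> P R (\<lambda>T\<in>Obj \<O>. \<eta> T \<cdot> \<theta> T)"
  unfolding is_operad_map_def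
proof (intro conjI ballI)
  note \<theta>h = operad_map_hom[OF \<theta>] and \<eta>h = operad_map_hom[OF \<eta>]
  show "(\<lambda>T\<in>Obj \<O>. \<eta> T \<cdot> \<theta> T) \<in> (\<Pi>\<^sub>E T\<in>Obj \<O>. hom V (ob P T) (ob R T))"
    using Comp_hom[OF \<theta>h \<eta>h] by auto
  show "(\<lambda>T\<in>Obj \<O>. \<eta> T \<cdot> \<theta> T) (trm \<O> c) \<cdot> unt P c = unt R c" if c: "c \<in> pi0 \<O>" for c
    using Comp_assoc[OF operad_unt[OF P c] \<theta>h \<eta>h] O.trm_Obj[OF c] \<theta> \<eta> c
    by (simp add: is_operad_map_def)
  fix f assume f: "f \<in> Arr \<O>"
  note D = O.Dom_Obj[OF f] and E = O.Cod_Obj[OF f]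
  let ?\<theta> = "bigA V (sz \<O> (Cod \<O> f)) (\<lambda>i. \<theta> (fib \<O> f i))"
  let ?\<eta> = "bigA V (sz \<O> (Cod \<O> f)) (\<lambda>i. \<eta> (fib \<O> f i))"
  have 1: "?\<theta> \<in> hom V (ob_fib V \<O> (ob P) f) (ob_fib V \<O> (ob Q) f)"
    "?\<eta> \<in> hom V (ob_fib V \<O> (ob Q) f) (ob_fib V \<O> (ob R) f)"
    by (rule ob_fib_hom[OF f], erule \<theta>h) (rule ob_fib_hom[OF f], erule \<eta>h)
  have "(\<eta> (Dom \<O> f) \<cdot> \<theta> (Dom \<O> f)) \<cdot> mu P f = \<eta> (Dom \<O> f) \<cdot> \<theta> (Dom \<O> f) \<cdot> mu P f"
    using Comp_assoc[OF operad_mu[OF P f] \<theta>h[OF D] \<eta>h[OF D]] .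
  also have "\<dots> = \<eta> (Dom \<O> f) \<cdot> mu Q f \<cdot> (?\<theta> \<odot> \<theta> (Cod \<O> f))"
    using \<theta> f by (simp add: is_operad_map_def)
  also have "\<dots> = (\<eta> (Dom \<O> f) \<cdot> mu Q f) \<cdot> (?\<theta> \<odot> \<theta> (Cod \<O> f))"
    using Comp_assoc[OF TensA_hom[OF 1(1) \<theta>h[OF E]] operad_mu[OF Q f] \<eta>h[OF D]] by simp
  also have "\<dots> = (mu R f \<cdot> (?\<eta> \<odot> \<eta> (Cod \<O> f))) \<cdot> (?\<theta> \<odot> \<theta> (Cod \<O> f))"
    using \<eta> f by (simp add: is_operad_map_def)
  also have "\<dots> = mu R f \<cdot> (?\<eta> \<odot> \<eta> (Cod \<O> f)) \<cdot> (?\<theta> \<odot> \<theta> (Cod \<O> f))"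
    using Comp_assoc[OF TensA_hom[OF 1(1) \<theta>h[OF E]] TensA_hom[OF 1(2) \<eta>h[OF E]] operad_mu[OF R f]] .
  also have "(?\<eta> \<odot> \<eta> (Cod \<O> f)) \<cdot> (?\<theta> \<odot> \<theta> (Cod \<O> f)) = (?\<eta> \<cdot> ?\<theta>) \<odot> (\<eta> (Cod \<O> f) \<cdot> \<theta> (Cod \<O> f))"
    using TensA_Comp[OF 1 \<theta>h[OF E] \<eta>h[OF E]] by simp
  also have "?\<eta> \<cdot> ?\<theta> = bigA V (sz \<O> (Cod \<O> f)) (\<lambda>i. \<eta> (fib \<O> f i) \<cdot> \<theta> (fib \<O> f i))"
    by (rule bigA_Comp) (rule \<theta>h \<eta>h; erule O.fib_Obj_Arr[OF f])+
  also have "\<dots> = bigA V (sz \<O> (Cod \<O> f)) (\<lambda>i. (\<lambda>T\<in>Obj \<O>. \<eta> T \<cdot> \<theta> T) (fib \<O> f i))"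
    by (rule bigA_cong) (use O.fib_Obj_Arr[OF f] in auto)
  finally show "(\<lambda>T\<in>Obj \<O>. \<eta> T \<cdot> \<theta> T) (Dom \<O> f) \<cdot> mu P f = mu R f \<cdot>
      (bigA V (sz \<O> (Cod \<O> f)) (\<lambda>i. (\<lambda>T\<in>Obj \<O>. \<eta> T \<cdot> \<theta> T) (fib \<O> f i)) \<odot>
       (\<lambda>T\<in>Obj \<O>. \<eta> T \<cdot> \<theta> T) (Cod \<O> f))"
    using D E by simp
qed

lemma operad_map_extensional: "is_operad_map V \<O> P Q \<theta> \<Longrightarrow> \<theta> \<in> extensional (Obj \<O>)"
  by (auto simp: is_operad_map_def PiE_def)

text \<open>Operad maps are extensional families, so the restrictions in the composition of
  \<open>Op\<close> lose nothing and the laws hold objectwise.\<close>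

lemma category_Op: "category (Op V \<O>)"
proof
  show "Ide (Op V \<O>) A \<in> hom (Op V \<O>) A A" if "A \<in> Obj (Op V \<O>)" for A
    using that operad_map_Ide by (simp add: hom_Op_iff)
  show "g \<cdot>\<^bsub>Op V \<O>\<^esub> f \<in> hom (Op V \<O>) A D" if "f \<in> hom (Op V \<O>) A B" "g \<in> hom (Op V \<O>) B D"
    for f g A B D
    using that operad_map_Comp by (auto simp: hom_Op_iff)
  show "f \<cdot>\<^bsub>Op V \<O>\<^esub> Ide (Op V \<O>) A = f" if "f \<in> hom (Op V \<O>) A B" for f A B
    using that operad_map_extensional Comp_Ide[OF operad_map_hom]
    by (auto simp: hom_Op_iff intro!: extensionalityI[of _ "Obj \<O>"])
  show "Ide (Op V \<O>) B \<cdot>\<^bsub>Op V \<O>\<^esub> f = f" if "f \<in> hom (Op V \<O>) A B" for f A B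
    using that operad_map_extensional Ide_Comp[OF operad_map_hom]
    by (auto simp: hom_Op_iff intro!: extensionalityI[of _ "Obj \<O>"])
  show "(h \<cdot>\<^bsub>Op V \<O>\<^esub> g) \<cdot>\<^bsub>Op V \<O>\<^esub> f = h \<cdot>\<^bsub>Op V \<O>\<^esub> (g \<cdot>\<^bsub>Op V \<O>\<^esub> f)"
    if fgh: "f \<in> hom (Op V \<O>) A B" "g \<in> hom (Op V \<O>) B D" "h \<in> hom (Op V \<O>) D E"
    for f g h A B D E
  proof -
    obtain \<theta> \<eta> \<zeta> where *: "f = (A, \<theta>, B)" "g = (B, \<eta>, D)" "h = (D, \<zeta>, E)"
      "is_operad_map V \<O> A B \<theta>" "is_operad_map V \<O> B D \<eta>" "is_operad_map V \<O> D E \<zeta>"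
      using fgh by (auto simp: hom_Op_iff)
    have "(\<zeta> T \<cdot> \<eta> T) \<cdot> \<theta> T = \<zeta> T \<cdot> (\<eta> T \<cdot> \<theta> T)" if "T \<in> Obj \<O>" for T
      using Comp_assoc[OF *(4-6)[THEN operad_map_hom[OF _ that]]] .
    then show ?thesis by (auto simp: *(1-3) intro!: restrict_ext)
  qed
qed (auto simp: Op_def)

end

section \<open>Restriction along an operadic functor\<close>

locale operadic_functor = symmetric_monoidal_category V +
  O: operadic_category \<O> + P: operadic_category \<P>
  for V :: "('vo, 'va) smc" (structure)
    and \<O> :: "('o, 'a) operadic" and \<P> :: "('p, 'b) operadic" +
  fixes F :: "('o, 'a, 'p, 'b) fct"
  assumes operadic_functor: "is_operadic_functor \<O> \<P> F"
begin

sublocale OO: operads V \<O> ..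
sublocale OP: operads V \<P> ..

lemma is_functor: "is_functor \<O> \<P> F"
  using operadic_functor by (simp add: is_operadic_functor_def)

lemma F_Obj [simp]: "t \<in> Obj \<O> \<Longrightarrow> FO F t \<in> Obj \<P>"
  using is_functor by (simp add: is_functor_def)

lemma F_Arr [simp]:
  assumes "\<sigma> \<in> Arr \<O>"
  shows "FA F \<sigma> \<in> Arr \<P>" "Dom \<P> (FA F \<sigma>) = FO F (Dom \<O> \<sigma>)" "Cod \<P> (FA F \<sigma>) = FO F (Cod \<O> \<sigma>)"
  using is_functor assms by (auto simp: is_functor_def hom_def)

lemma F_Ide: "t \<in> Obj \<O> \<Longrightarrow> FA F (Ide \<O> t) = Ide \<P> (FO F t)"
  using is_functor by (simp add: is_functor_def)

lemma F_Comp: "\<sigma> \<in> Arr \<O> \<Longrightarrow> \<gamma> \<in> Arr \<O> \<Longrightarrow> Dom \<O> \<gamma> = Cod \<O> \<sigma> \<Longrightarrow>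
    FA F (\<gamma> \<cdot>\<^bsub>\<O>\<^esub> \<sigma>) = FA F \<gamma> \<cdot>\<^bsub>\<P>\<^esub> FA F \<sigma>"
  using is_functor by (simp add: is_functor_def)

lemma F_sz [simp]: "t \<in> Obj \<O> \<Longrightarrow> sz \<P> (FO F t) = sz \<O> t"
  and F_szm [simp]: "\<sigma> \<in> Arr \<O> \<Longrightarrow> szm \<P> (FA F \<sigma>) = szm \<O> \<sigma>"
  and F_fib: "\<sigma> \<in> Arr \<O> \<Longrightarrow> i \<in> {1..sz \<O> (Cod \<O> \<sigma>)} \<Longrightarrow> fib \<P> (FA F \<sigma>) i = FO F (fib \<O> \<sigma> i)"
  and F_ind: "\<sigma> \<in> Arr \<O> \<Longrightarrow> \<gamma> \<in> Arr \<O> \<Longrightarrow> Dom \<O> \<gamma> = Cod \<O> \<sigma> \<Longrightarrow> i \<in> {1..sz \<O> (Cod \<O> \<gamma>)} \<Longrightarrow>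
    ind \<P> (FA F \<sigma>) (FA F \<gamma>) i = FA F (ind \<O> \<sigma> \<gamma> i)"
  and F_trm: "c \<in> pi0 \<O> \<Longrightarrow> trm \<P> (pi0_map \<P> F c) = FO F (trm \<O> c)"
  using operadic_functor by (simp_all add: is_operadic_functor_def)

lemma pi0_map_component: "t \<in> Obj \<O> \<Longrightarrow> pi0_map \<P> F (component \<O> t) = component \<P> (FO F t)"
  using pi0_map_eq[OF is_functor O.component_pi0 O.mem_component] .

lemma pi0_map_pi0: "c \<in> pi0 \<O> \<Longrightarrow> pi0_map \<P> F c \<in> pi0 \<P>"
  using pi0_map_eq[OF is_functor _ O.trm_mem] P.component_pi0 O.trm_Obj by simp

lemma F_mem_pi0_map: "c \<in> pi0 \<O> \<Longrightarrow> t \<in> c \<Longrightarrow> FO F t \<in> pi0_map \<P> F c"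
  using pi0_map_eq[OF is_functor] P.mem_component F_Obj O.pi0_Obj by metis

lemma pullback_simps [simp]:
  "t \<in> Obj \<O> \<Longrightarrow> ob (pullback_operad \<O> \<P> F P) t = ob P (FO F t)"
  "c \<in> pi0 \<O> \<Longrightarrow> unt (pullback_operad \<O> \<P> F P) c = unt P (pi0_map \<P> F c)"
  "\<sigma> \<in> Arr \<O> \<Longrightarrow> mu (pullback_operad \<O> \<P> F P) \<sigma> = mu P (FA F \<sigma>)"
  by (simp_all add: pullback_operad_def)

lemma F_ob_fib: "\<sigma> \<in> Arr \<O> \<Longrightarrow> ob_fib V \<P> X (FA F \<sigma>) = ob_fib V \<O> (\<lambda>t. X (FO F t)) \<sigma>"
  unfolding ob_fib_def by (rule bigO_cong) (simp_all add: F_fib O.Cod_Obj)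

lemma ob_fib_pullback:
  "\<sigma> \<in> Arr \<O> \<Longrightarrow> ob_fib V \<O> (ob (pullback_operad \<O> \<P> F P)) \<sigma> = ob_fib V \<P> (ob P) (FA F \<sigma>)"
  unfolding ob_fib_def by (rule bigO_cong) (use O.fib_Obj_Arr in \<open>auto simp: F_fib O.Cod_Obj\<close>)

text \<open>Each axiom is the axiom of \<open>P\<close> at the images under \<open>F\<close>,
  because \<open>F\<close> preserves sizes, fibers, induced maps and chosen terminal
  objects.\<close>

lemma pullback_is_operad:
  assumes P: "is_operad V \<P> P"
  shows "is_operad V \<O> (pullback_operad \<O> \<P> F P)"
  unfolding is_operad_def
proof (intro conjI ballI allI impI)
  let ?Q = "pullback_operad \<O> \<P> F P"
  show "ob ?Q \<in> Obj \<O> \<rightarrow>\<^sub>E Obj V"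
    using OP.operad_ob[OF P] by (simp add: pullback_operad_def)
  show "unt ?Q \<in> (\<Pi>\<^sub>E c\<in>pi0 \<O>. hom V (UnitO V) (ob ?Q (trm \<O> c)))"
    using OP.operad_unt[OF P pi0_map_pi0] O.trm_Obj by (auto simp: pullback_operad_def F_trm)
  have "mu ?Q \<sigma> \<in> hom V (ob_fib V \<O> (ob ?Q) \<sigma> \<otimes> ob ?Q (Cod \<O> \<sigma>)) (ob ?Q (Dom \<O> \<sigma>))"
    if "\<sigma> \<in> Arr \<O>" for \<sigma>
    using OP.operad_mu[OF P F_Arr(1)[OF that]] that
    by (simp add: ob_fib_pullback O.Dom_Obj O.Cod_Obj)
  then show "mu ?Q \<in> (\<Pi>\<^sub>E \<sigma>\<in>Arr \<O>. hom V (ob_fib V \<O> (ob ?Q) \<sigma> \<otimes> ob ?Q (Cod \<O> \<sigma>)) (ob ?Q (Dom \<O> \<sigma>)))"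
    by (auto simp: pullback_operad_def)
  fix \<sigma> \<gamma> \<phi>
  assume \<sigma>: "\<sigma> \<in> Arr \<O>" and \<gamma>: "\<gamma> \<in> Arr \<O>" and "Dom \<O> \<gamma> = Cod \<O> \<sigma> \<and> canonical V
      (case_slot (\<lambda>j. ob ?Q (fib \<O> \<sigma> j)) (\<lambda>i. ob ?Q (fib \<O> \<gamma> i)) (ob ?Q (Cod \<O> \<gamma>)))
      (assoc_src (szm \<O> \<gamma>)) (assoc_tgt (szm \<O> \<gamma>)) \<phi>"
  then have eq: "Dom \<O> \<gamma> = Cod \<O> \<sigma>" and can: "canonical V
      (case_slot (\<lambda>j. ob ?Q (fib \<O> \<sigma> j)) (\<lambda>i. ob ?Q (fib \<O> \<gamma> i)) (ob ?Q (Cod \<O> \<gamma>)))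
      (assoc_src (szm \<O> \<gamma>)) (assoc_tgt (szm \<O> \<gamma>)) \<phi>" by auto
  \<comment> \<open>The two families of objects are compared at the leaves only; the axioms say
    nothing about \<open>fib\<close> at indices out of range.\<close>
  have "canonical V
      (case_slot (\<lambda>j. ob P (fib \<P> (FA F \<sigma>) j)) (\<lambda>i. ob P (fib \<P> (FA F \<gamma>) i)) (ob P (Cod \<P> (FA F \<gamma>))))
      (assoc_src (szm \<P> (FA F \<gamma>))) (assoc_tgt (szm \<P> (FA F \<gamma>))) \<phi>"
    unfolding F_szm[OF \<gamma>] using can
  proof (rule canonical_cong)
    fix l assume "l \<in> set (leaves (assoc_src (szm \<O> \<gamma>)))"
    then show "case_slot (\<lambda>j. ob ?Q (fib \<O> \<sigma> j)) (\<lambda>i. ob ?Q (fib \<O> \<gamma> i)) (ob ?Q (Cod \<O> \<gamma>)) l =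
      case_slot (\<lambda>j. ob P (fib \<P> (FA F \<sigma>) j)) (\<lambda>i. ob P (fib \<P> (FA F \<gamma>) i)) (ob P (Cod \<P> (FA F \<gamma>))) l"
      using \<sigma> \<gamma> O.fib_Obj_Arr[OF \<sigma>] O.fib_Obj_Arr[OF \<gamma>]
      by (auto simp: set_leaves_assoc_src O.Dom_szm O.Cod_szm eq F_fib O.Cod_Obj)
  qed
  then have "mu P (FA F \<sigma>) \<cdot> (Ide V (ob_fib V \<P> (ob P) (FA F \<sigma>)) \<odot> mu P (FA F \<gamma>)) =
      mu P (FA F \<gamma> \<cdot>\<^bsub>\<P>\<^esub> FA F \<sigma>) \<cdot>
        (bigA V (sz \<P> (Cod \<P> (FA F \<gamma>))) (\<lambda>i. mu P (ind \<P> (FA F \<sigma>) (FA F \<gamma>) i)) \<odot>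
         Ide V (ob P (Cod \<P> (FA F \<gamma>)))) \<cdot> \<phi>"
    using OP.operad_assoc[OF P F_Arr(1)[OF \<sigma>] F_Arr(1)[OF \<gamma>]] \<sigma> \<gamma> eq by simp
  moreover have "bigA V (sz \<P> (Cod \<P> (FA F \<gamma>))) (\<lambda>i. mu P (ind \<P> (FA F \<sigma>) (FA F \<gamma>) i)) =
      bigA V (sz \<O> (Cod \<O> \<gamma>)) (\<lambda>i. mu ?Q (ind \<O> \<sigma> \<gamma> i))"
    by (rule bigA_cong) (use O.ind_simps[OF \<sigma> \<gamma> eq] in \<open>simp_all add: \<sigma> \<gamma> eq O.Cod_Obj F_ind\<close>)
  ultimately show "mu ?Q \<sigma> \<cdot> (Ide V (ob_fib V \<O> (ob ?Q) \<sigma>) \<odot> mu ?Q \<gamma>) =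
      mu ?Q (\<gamma> \<cdot>\<^bsub>\<O>\<^esub> \<sigma>) \<cdot> (bigA V (sz \<O> (Cod \<O> \<gamma>)) (\<lambda>i. mu ?Q (ind \<O> \<sigma> \<gamma> i)) \<odot> Ide V (ob ?Q (Cod \<O> \<gamma>))) \<cdot> \<phi>"
    using \<sigma> \<gamma> eq by (simp add: ob_fib_pullback O.Cod_Obj F_Comp)
next
  let ?Q = "pullback_operad \<O> \<P> F P"
  fix t \<phi>
  assume t: "t \<in> Obj \<O>" and can: "canonical V (\<lambda>_::unit. ob ?Q t)
      (Leaf ()) (Times (tens (map (\<lambda>_. One) [1..<Suc (sz \<O> t)])) (Leaf ())) \<phi>"
  have "bigA V (sz \<P> (FO F t)) (\<lambda>i. unt P (component \<P> (fib \<P> (Ide \<P> (FO F t)) i))) =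
      bigA V (sz \<O> t) (\<lambda>i. unt ?Q (component \<O> (fib \<O> (Ide \<O> t) i)))"
  proof (rule bigA_cong)
    fix i assume i: "i \<in> {1..sz \<O> t}"
    have "fib \<O> (Ide \<O> t) i \<in> Obj \<O>" using O.fib_Obj_Arr[of "Ide \<O> t"] t i by simp
    moreover have "fib \<P> (Ide \<P> (FO F t)) i = FO F (fib \<O> (Ide \<O> t) i)"
      using F_fib[of "Ide \<O> t" i] t i by (simp add: F_Ide)
    ultimately show "unt P (component \<P> (fib \<P> (Ide \<P> (FO F t)) i)) = unt ?Q (component \<O> (fib \<O> (Ide \<O> t) i))"
      by (simp add: O.component_pi0 pi0_map_component)
  qed (simp add: t)
  then show "mu ?Q (Ide \<O> t) \<cdot>
      (bigA V (sz \<O> t) (\<lambda>i. unt ?Q (component \<O> (fib \<O> (Ide \<O> t) i))) \<odot> Ide V (ob ?Q t)) \<cdot> \<phi> = Ide V (ob ?Q t)"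
    using OP.operad_unit_left[OF P F_Obj[OF t], of \<phi>] can t by (simp add: F_Ide del: upt_Suc)
next
  let ?Q = "pullback_operad \<O> \<P> F P"
  fix c t \<sigma> \<phi>
  assume c: "c \<in> pi0 \<O>" and t: "t \<in> c" and \<sigma>: "\<sigma> \<in> hom \<O> t (trm \<O> c)"
    and can: "canonical V (\<lambda>_::unit. ob ?Q t) (Leaf ()) (Times (Leaf ()) One) \<phi>"
  have "FA F \<sigma> \<in> hom \<P> (FO F t) (trm \<P> (pi0_map \<P> F c))" "\<sigma> \<in> Arr \<O>" "t \<in> Obj \<O>"
    using \<sigma> c O.pi0_Obj[OF c t] by (auto simp: hom_def F_trm)
  then show "mu ?Q \<sigma> \<cdot> (Ide V (ob ?Q t) \<odot> unt ?Q c) \<cdot> \<phi> = Ide V (ob ?Q t)"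
    using OP.operad_unit_right[OF P pi0_map_pi0[OF c] F_mem_pi0_map[OF c t], of "FA F \<sigma>" \<phi>] can c by simp
qed

lemma pullback_is_operad_map:
  assumes \<theta>: "is_operad_map V \<P> P Q \<theta>"
  shows "is_operad_map V \<O> (pullback_operad \<O> \<P> F P) (pullback_operad \<O> \<P> F Q) (\<lambda>t\<in>Obj \<O>. \<theta> (FO F t))"
  unfolding is_operad_map_def
proof (intro conjI ballI)
  let ?\<theta> = "\<lambda>t\<in>Obj \<O>. \<theta> (FO F t)"
  show "?\<theta> \<in> (\<Pi>\<^sub>E t\<in>Obj \<O>. hom V (ob (pullback_operad \<O> \<P> F P) t) (ob (pullback_operad \<O> \<P> F Q) t))"
    using OP.operad_map_hom[OF \<theta>] by auto
  show "?\<theta> (trm \<O> c) \<cdot> unt (pullback_operad \<O> \<P> F P) c = unt (pullback_operad \<O> \<P> F Q) c"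
    if c: "c \<in> pi0 \<O>" for c
    using \<theta> pi0_map_pi0[OF c] c O.trm_Obj[OF c] by (simp add: is_operad_map_def flip: F_trm)
  fix \<sigma> assume \<sigma>: "\<sigma> \<in> Arr \<O>"
  have "bigA V (sz \<O> (Cod \<O> \<sigma>)) (\<lambda>i. ?\<theta> (fib \<O> \<sigma> i)) =
      bigA V (sz \<P> (Cod \<P> (FA F \<sigma>))) (\<lambda>i. \<theta> (fib \<P> (FA F \<sigma>) i))"
    by (rule bigA_cong) (use \<sigma> O.fib_Obj_Arr[OF \<sigma>] in \<open>auto simp: F_fib O.Cod_Obj\<close>)
  then show "?\<theta> (Dom \<O> \<sigma>) \<cdot> mu (pullback_operad \<O> \<P> F P) \<sigma> = mu (pullback_operad \<O> \<P> F Q) \<sigma> \<cdot>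
      (bigA V (sz \<O> (Cod \<O> \<sigma>)) (\<lambda>i. ?\<theta> (fib \<O> \<sigma> i)) \<odot> ?\<theta> (Cod \<O> \<sigma>))"
    using \<sigma> O.Dom_Obj[OF \<sigma>] O.Cod_Obj[OF \<sigma>] OP.operad_map_mu[OF \<theta> F_Arr(1)[OF \<sigma>]] by simp
qed

lemma pullback_functor_simps [simp]:
  "FO (pullback \<O> \<P> F) P = pullback_operad \<O> \<P> F P"
  "FA (pullback \<O> \<P> F) (P, \<theta>, Q) =
    (pullback_operad \<O> \<P> F P, \<lambda>t\<in>Obj \<O>. \<theta> (FO F t), pullback_operad \<O> \<P> F Q)"
  by (simp_all add: pullback_def)

lemma pullback_functor: "is_functor (Op V \<P>) (Op V \<O>) (pullback \<O> \<P> F)"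
  unfolding is_functor_def
proof (intro conjI ballI impI)
  show "FO (pullback \<O> \<P> F) P \<in> Obj (Op V \<O>)" if "P \<in> Obj (Op V \<P>)" for P
    using that by (simp add: pullback_is_operad)
  show "FA (pullback \<O> \<P> F) f \<in> hom (Op V \<O>) (FO (pullback \<O> \<P> F) (Dom (Op V \<P>) f))
      (FO (pullback \<O> \<P> F) (Cod (Op V \<P>) f))" if "f \<in> Arr (Op V \<P>)" for f
    using that by (cases f) (simp add: hom_Op_iff pullback_is_operad pullback_is_operad_map)
  show "FA (pullback \<O> \<P> F) (Ide (Op V \<P>) P) = Ide (Op V \<O>) (FO (pullback \<O> \<P> F) P)" for P
    by (simp cong: restrict_cong)
  show "FA (pullback \<O> \<P> F) (g \<cdot>\<^bsub>Op V \<P>\<^esub> f) =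
      FA (pullback \<O> \<P> F) g \<cdot>\<^bsub>Op V \<O>\<^esub> FA (pullback \<O> \<P> F) f" for f g
    by (cases f; cases g) (simp cong: restrict_cong)
qed (rule OP.category_Op OO.category_Op)+

end

section \<open>The operad \<open>F\<^sub>!\<close>\<close>

text \<open>Cocompleteness enters through coproducts over the fibers of \<open>F\<close> on objects;
  stating these directly keeps the size type \<open>'u\<close> out of the locale.\<close>

locale discrete_fibration = operadic_functor V \<O> \<P> F
  for V :: "('vo, 'va) smc" (structure)
    and \<O> :: "('o, 'a) operadic" and \<P> :: "('p, 'b) operadic" and F :: "('o, 'a, 'p, 'b) fct" +
  assumes fibration: "is_discrete_operadic_fibration \<O> \<P> F"
    and closed: "is_closed V"
    and fibre_coproducts:
      "(\<And>t. t \<in> obj_fibre \<O> F T \<Longrightarrow> X t \<in> Obj V) \<Longrightarrow> \<exists>K. is_coproduct V (obj_fibre \<O> F T) X K"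
begin

abbreviation K :: "('o, 'a, 'vo, 'va) operad \<Rightarrow> 'p \<Rightarrow> 'vo" where
  "K \<equiv> shriek_ob V \<O> F"

abbreviation inc :: "('o, 'a, 'vo, 'va) operad \<Rightarrow> 'o \<Rightarrow> 'va" where
  "inc \<equiv> shriek_inj V \<O> F"

section \<open>Lifts along the fibration\<close>

lemma lift_ex1:
  assumes "f \<in> Arr \<P>" "s \<in> obj_fibre \<O> F (Cod \<P> f)"
    and "\<And>i. i \<in> {1..sz \<P> (Cod \<P> f)} \<Longrightarrow> t i \<in> obj_fibre \<O> F (fib \<P> f i)"
  shows "\<exists>!\<sigma>. is_lift \<O> F f s t \<sigma>"
proof -
  have "\<forall>i\<in>{1..sz \<P> (Cod \<P> f)}. t i \<in> obj_fibre \<O> F (fib \<P> f i)" using assms(3) by blast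
  with fibration[unfolded is_discrete_operadic_fibration_def, THEN conjunct2, THEN conjunct2]
  show ?thesis using assms(1,2) by simp
qed

lemma fib_fibre:
  "\<sigma> \<in> Arr \<O> \<Longrightarrow> i \<in> {1..sz \<O> (Cod \<O> \<sigma>)} \<Longrightarrow> fib \<O> \<sigma> i \<in> obj_fibre \<O> F (fib \<P> (FA F \<sigma>) i)"
  using O.fib_Obj_Arr by (simp add: obj_fibre_def F_fib)

text \<open>An arrow \<open>\<sigma>\<close> is itself a lift of its image with its own codomain and
  fibers, and lifts are unique. A statement about all choices \<open>(s, t)\<close> over
  \<open>f\<close> thereby becomes one about all arrows over \<open>f\<close>.\<close>

lemma The_lift:
  assumes \<sigma>: "\<sigma> \<in> Arr \<O>"
  shows "(THE \<tau>. is_lift \<O> F (FA F \<sigma>) (Cod \<O> \<sigma>) (fib \<O> \<sigma>) \<tau>) = \<sigma>"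
proof (rule the1_equality)
  show "\<exists>!\<tau>. is_lift \<O> F (FA F \<sigma>) (Cod \<O> \<sigma>) (fib \<O> \<sigma>) \<tau>"
    by (rule lift_ex1) (use \<sigma> fib_fibre[OF \<sigma>] in \<open>simp_all add: obj_fibre_def O.Cod_Obj\<close>)
qed (simp add: is_lift_def \<sigma>)

text \<open>Lifting the identity of \<open>U\<^sub>c\<close> connects any two chosen terminal objects over \<open>U\<^sub>c\<close>.\<close>

lemma trm_fibre_unique:
  assumes a: "a \<in> pi0 \<O>" and b: "b \<in> pi0 \<O>" and eq: "FO F (trm \<O> a) = FO F (trm \<O> b)"
  shows "a = b"
proof -
  define c where "c = pi0_map \<P> F b"
  have c: "c \<in> pi0 \<P>" "trm \<P> c = FO F (trm \<O> b)" using pi0_map_pi0[OF b] F_trm[OF b] by (simp_all add: c_def)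
  have U: "trm \<P> c \<in> Obj \<P>" using P.trm_Obj[OF c(1)] .
  \<comment> \<open>The fiber of an arrow into a chosen terminal object is its domain. Hence
    \<open>trm \<O> a\<close> may be prescribed as the fiber, and \<open>trm \<O> b\<close> as the
    codomain, of a lift of this identity.\<close>
  have "fib \<P> (Ide \<P> (trm \<P> c)) 1 = trm \<P> c" using P.fib_trm[OF c(1) P.Ide_hom[OF U]] .
  then have "\<exists>!\<sigma>. is_lift \<O> F (Ide \<P> (trm \<P> c)) (trm \<O> b) (\<lambda>_. trm \<O> a) \<sigma>"
    by (intro lift_ex1)
      (use U c eq O.trm_Obj a b P.sz_trm[OF c(1)] in \<open>auto simp: obj_fibre_def\<close>)
  then obtain \<sigma> where \<sigma>: "\<sigma> \<in> hom \<O> (Dom \<O> \<sigma>) (trm \<O> b)" "fib \<O> \<sigma> 1 = trm \<O> a"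
    using O.sz_trm[OF b] by (auto simp: is_lift_def hom_def)
  \<comment> \<open>The same rule, now in \<open>\<O>\<close>, identifies the domain of the lift
    with its prescribed fiber.\<close>
  then have "Dom \<O> \<sigma> = trm \<O> a" using O.fib_trm[OF b \<sigma>(1)] by simp
  then have "component \<O> (trm \<O> a) = component \<O> (trm \<O> b)"
    using O.component_Dom[of \<sigma>] \<sigma>(1) by (simp add: hom_def)
  then show ?thesis using O.component_trm a b by simp
qed

section \<open>Structure maps of \<open>F\<^sub>!A\<close> and their restrictions to
  summands\<close>

context
  fixes A assumes A: "is_operad V \<O> A"
begin

text \<open>The inclusion of \<open>t\<close> is taken from the coproduct over
  \<open>FO F t\<close>, so that one family \<open>inc A\<close> serves all \<open>T\<close>; on the
  fiber over \<open>T\<close> it agrees with the inclusions chosen there.\<close>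

lemma K_coproduct: "is_coproduct V (obj_fibre \<O> F T) (ob A) (K A T, inc A)"
proof -
  have "\<exists>K. is_coproduct V (obj_fibre \<O> F T) (ob A) K"
    by (rule fibre_coproducts) (use OO.operad_ob[OF A] in \<open>simp add: obj_fibre_def\<close>)
  then have "is_coproduct V (obj_fibre \<O> F T) (ob A) (coprod V (obj_fibre \<O> F T) (ob A))"
    unfolding coprod_def by (rule someI_ex)
  then have "is_coproduct V (obj_fibre \<O> F T) (ob A) (K A T, snd (coprod V (obj_fibre \<O> F T) (ob A)))"
    by (simp add: shriek_ob_def)
  then show ?thesis
    by (rule coproduct_reindex[where h = "\<lambda>t. t"])
      (auto simp: bij_betw_def shriek_inj_def obj_fibre_def)
qed

lemma K_Obj: "K A T \<in> Obj V"
  using coproduct_Obj[OF K_coproduct] .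

lemma inc_hom: "t \<in> Obj \<O> \<Longrightarrow> inc A t \<in> hom V (ob A t) (K A (FO F t))"
  using coproduct_inj[OF K_coproduct, of t "FO F t"] by (simp add: obj_fibre_def)

lemma K_eqI:
  assumes "m \<in> hom V (K A T) M" "m' \<in> hom V (K A T) M"
    and "\<And>t. t \<in> Obj \<O> \<Longrightarrow> FO F t = T \<Longrightarrow> m \<cdot> inc A t = m' \<cdot> inc A t"
  shows "m = m'"
  by (rule coproduct_eqI[OF K_coproduct assms(1,2)]) (simp add: obj_fibre_def assms(3))

lemma K_ex1:
  assumes "M \<in> Obj V" "\<And>t. t \<in> Obj \<O> \<Longrightarrow> FO F t = T \<Longrightarrow> q t \<in> hom V (ob A t) M"
  shows "\<exists>!m. m \<in> hom V (K A T) M \<and> (\<forall>t\<in>obj_fibre \<O> F T. m \<cdot> inc A t = q t)"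
  by (rule coproduct_ex1[OF K_coproduct assms(1)]) (simp add: obj_fibre_def assms(2))

text \<open>For \<open>\<sigma> : t \<rightarrow> s\<close> over
  \<open>f : T \<rightarrow> S\<close>, this is the inclusion of the summand
  \<open>A(\<sigma>) \<otimes> A(s)\<close> into
  \<open>F\<^sub>!A(f) \<otimes> F\<^sub>!A(S)\<close>.\<close>

definition mu_inc :: "'a \<Rightarrow> 'va" where
  "mu_inc \<sigma> = bigA V (sz \<O> (Cod \<O> \<sigma>)) (\<lambda>i. inc A (fib \<O> \<sigma> i)) \<odot> inc A (Cod \<O> \<sigma>)"

text \<open>In the index family of the next lemma, position \<open>0\<close> stands for the codomain of \<open>f\<close>.\<close>

lemma mu_coproduct:
  assumes f: "f \<in> Arr \<P>"
  defines "n \<equiv> sz \<P> (Cod \<P> f)"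
  shows "is_coproduct V (\<Pi>\<^sub>E i\<in>{0..n}. obj_fibre \<O> F (if i = 0 then Cod \<P> f else fib \<P> f i))
    (\<lambda>c. bigO V n (\<lambda>i. ob A (c i)) \<otimes> ob A (c 0))
    (ob_fib V \<P> (K A) f \<otimes> K A (Cod \<P> f), \<lambda>c. bigA V n (\<lambda>i. inc A (c i)) \<odot> inc A (c 0))"
proof -
  define w where "w = Times (tens (map Leaf [Suc 0..<Suc n])) (Leaf 0)"
  define T where "T i = (if i = 0 then Cod \<P> f else fib \<P> f i)" for i
  have w: "set (leaves w) = {0..n}" by (auto simp: w_def set_leaves_big simp del: upt_Suc)
  have dist: "distinct (leaves w)" by (auto simp: w_def leaves_tens comp_def simp del: upt_Suc)
  have tobj: "tobj V X w = bigO V n X \<otimes> X 0" and tarr: "tarr V h w = bigA V n h \<odot> h 0" for X h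
    by (simp_all add: w_def bigO_def bigA_def del: upt_Suc)
  have "is_coproduct V (\<Pi>\<^sub>E i\<in>set (leaves w). obj_fibre \<O> F (T i)) (\<lambda>c. tobj V (\<lambda>l. ob A (c l)) w)
      (tobj V (\<lambda>i. K A (T i)) w, \<lambda>c. tarr V (\<lambda>l. inc A (c l)) w)"
    by (rule tobj_coproduct[OF closed dist K_coproduct])
      (use OO.operad_ob[OF A] in \<open>simp add: obj_fibre_def\<close>)
  moreover have "bigO V n (\<lambda>i. K A (T i)) = ob_fib V \<P> (K A) f"
    unfolding ob_fib_def n_def by (rule bigO_cong) (auto simp: T_def)
  ultimately show ?thesis unfolding tobj tarr w by (simp add: T_def)
qed

text \<open>The condition ranges over arbitrary functions \<open>t\<close>, the coproduct over
  extensional choice functions. They impose the same constraints, since \<open>is_lift\<close> and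
  \<open>bigA\<close> read \<open>t\<close> on \<open>{1..n}\<close> only, and the universal
  property gives the unique map.\<close>

lemma shriek_mu_spec:
  assumes f: "f \<in> Arr \<P>"
  shows "\<exists>!m. m \<in> hom V (ob_fib V \<P> (K A) f \<otimes> K A (Cod \<P> f)) (K A (Dom \<P> f)) \<and>
    (\<forall>s\<in>obj_fibre \<O> F (Cod \<P> f). \<forall>t.
      (\<forall>i\<in>{1..sz \<P> (Cod \<P> f)}. t i \<in> obj_fibre \<O> F (fib \<P> f i)) \<longrightarrow>
      (let \<sigma> = (THE \<sigma>. is_lift \<O> F f s t \<sigma>) in
        m \<cdot> (bigA V (sz \<P> (Cod \<P> f)) (\<lambda>i. inc A (t i)) \<odot> inc A s) = inc A (Dom \<O> \<sigma>) \<cdot> mu A \<sigma>))"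
    (is "\<exists>!m. m \<in> ?H \<and> ?P m")
proof -
  define n where "n = sz \<P> (Cod \<P> f)"
  let ?I = "\<Pi>\<^sub>E i\<in>{0..n}. obj_fibre \<O> F (if i = 0 then Cod \<P> f else fib \<P> f i)"
  define \<sigma> where "\<sigma> s t = (THE \<sigma>. is_lift \<O> F f s t \<sigma>)" for s t
  define q where "q c = inc A (Dom \<O> (\<sigma> (c 0) c)) \<cdot> mu A (\<sigma> (c 0) c)" for c
  have I0: "c 0 \<in> obj_fibre \<O> F (Cod \<P> f)" if "c \<in> ?I" for c
    using PiE_mem[OF that, of 0] by simp
  have I1: "c i \<in> obj_fibre \<O> F (fib \<P> f i)" if "c \<in> ?I" "i \<in> {1..n}" for c i
    using PiE_mem[OF that(1), of i] that(2) by simp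
  have lift: "is_lift \<O> F f (c 0) c (\<sigma> (c 0) c)" if c: "c \<in> ?I" for c
    unfolding \<sigma>_def by (rule theI', rule lift_ex1[OF f I0[OF c] I1[OF c]]) (simp add: n_def)
  have q: "q c \<in> hom V (bigO V n (\<lambda>i. ob A (c i)) \<otimes> ob A (c 0)) (K A (Dom \<P> f))" if c: "c \<in> ?I" for c
  proof -
    let ?\<sigma> = "\<sigma> (c 0) c"
    have \<sigma>: "?\<sigma> \<in> Arr \<O>" "Cod \<O> ?\<sigma> = c 0" "FA F ?\<sigma> = f" "\<forall>i\<in>{1..sz \<O> (c 0)}. fib \<O> ?\<sigma> i = c i"
      using lift[OF c] by (auto simp: is_lift_def)
    have n: "sz \<O> (c 0) = n" using I0[OF c] by (auto simp: n_def obj_fibre_def simp flip: F_sz)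
    have "ob_fib V \<O> (ob A) ?\<sigma> = bigO V n (\<lambda>i. ob A (c i))"
      unfolding ob_fib_def by (rule bigO_cong) (use \<sigma> n in auto)
    \<comment> \<open>The domain of the lift lies over the domain of \<open>f\<close>, so its
      summand has an inclusion into \<open>K A (Dom \<P> f)\<close>.\<close>
    moreover have "FO F (Dom \<O> ?\<sigma>) = Dom \<P> f" using F_Arr(2)[OF \<sigma>(1)] \<sigma>(3) by simp
    ultimately show ?thesis
      unfolding q_def using Comp_hom[OF OO.operad_mu[OF A \<sigma>(1)] inc_hom[OF O.Dom_Obj[OF \<sigma>(1)]]] \<sigma>(2) by simp
  qed
  have "?P m \<longleftrightarrow> (\<forall>c\<in>?I. m \<cdot> (bigA V n (\<lambda>i. inc A (c i)) \<odot> inc A (c 0)) = q c)" for m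
  proof (intro iffI ballI allI impI)
    fix c assume "?P m" and c: "c \<in> ?I"
    then have "m \<cdot> (bigA V n (\<lambda>i. inc A (c i)) \<odot> inc A (c 0)) =
        inc A (Dom \<O> (\<sigma> (c 0) c)) \<cdot> mu A (\<sigma> (c 0) c)"
      using I0[OF c] I1[OF c] unfolding n_def Let_def \<sigma>_def by blast
    then show "m \<cdot> (bigA V n (\<lambda>i. inc A (c i)) \<odot> inc A (c 0)) = q c" by (simp add: q_def)
  next
    fix s t assume *: "\<forall>c\<in>?I. m \<cdot> (bigA V n (\<lambda>i. inc A (c i)) \<odot> inc A (c 0)) = q c"
      and s: "s \<in> obj_fibre \<O> F (Cod \<P> f)"
      and t: "\<forall>i\<in>{1..sz \<P> (Cod \<P> f)}. t i \<in> obj_fibre \<O> F (fib \<P> f i)"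
    define c where "c = (\<lambda>i\<in>{0..n}. if i = 0 then s else t i)"
    have c: "c \<in> ?I" using s t by (auto simp: c_def n_def)
    have c0: "c 0 = s" and ci: "\<And>i. i \<in> {1..n} \<Longrightarrow> c i = t i" by (auto simp: c_def)
    have n: "sz \<O> s = n" using s by (auto simp: n_def obj_fibre_def simp flip: F_sz)
    have "is_lift \<O> F f (c 0) c = is_lift \<O> F f s t"
      using ci by (auto simp: fun_eq_iff is_lift_def c0 n)
    then have "q c = inc A (Dom \<O> (\<sigma> s t)) \<cdot> mu A (\<sigma> s t)" by (simp add: q_def \<sigma>_def)
    moreover have "bigA V n (\<lambda>i. inc A (c i)) = bigA V n (\<lambda>i. inc A (t i))"
      by (rule bigA_cong) (simp_all add: ci)
    ultimately show "let \<sigma> = (THE \<sigma>. is_lift \<O> F f s t \<sigma>) in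
        m \<cdot> (bigA V (sz \<P> (Cod \<P> f)) (\<lambda>i. inc A (t i)) \<odot> inc A s) = inc A (Dom \<O> \<sigma>) \<cdot> mu A \<sigma>"
      using *[rule_format, OF c] c0 unfolding Let_def \<sigma>_def n_def by simp
  qed
  moreover have "\<exists>!m. m \<in> ?H \<and> (\<forall>c\<in>?I. m \<cdot> (bigA V n (\<lambda>i. inc A (c i)) \<odot> inc A (c 0)) = q c)"
    by (rule coproduct_ex1[OF mu_coproduct[OF f, folded n_def] K_Obj q])
  ultimately show ?thesis by simp
qed

lemma shriek_mu_hom:
  assumes f: "f \<in> Arr \<P>"
  shows "shriek_mu V \<O> \<P> F A f \<in> hom V (ob_fib V \<P> (K A) f \<otimes> K A (Cod \<P> f)) (K A (Dom \<P> f))"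
  using theI'[OF shriek_mu_spec[OF f]] unfolding shriek_mu_def by blast

text \<open>The defining property with the description of the lift eliminated by
  \<open>The_lift\<close>; it is the rule by which the structure map is evaluated in all
  verifications below.\<close>

lemma shriek_mu_lift:
  assumes \<sigma>: "\<sigma> \<in> Arr \<O>"
  shows "shriek_mu V \<O> \<P> F A (FA F \<sigma>) \<cdot> mu_inc \<sigma> = inc A (Dom \<O> \<sigma>) \<cdot> mu A \<sigma>"
proof -
  have "Cod \<O> \<sigma> \<in> obj_fibre \<O> F (Cod \<P> (FA F \<sigma>))"
    using \<sigma> O.Cod_Obj by (simp add: obj_fibre_def)
  moreover have "\<forall>i\<in>{1..sz \<P> (Cod \<P> (FA F \<sigma>))}. fib \<O> \<sigma> i \<in> obj_fibre \<O> F (fib \<P> (FA F \<sigma>) i)"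
    using \<sigma> fib_fibre[OF \<sigma>] O.Cod_Obj by simp
  ultimately show ?thesis
    using theI'[OF shriek_mu_spec[OF F_Arr(1)[OF \<sigma>]], folded shriek_mu_def, THEN conjunct2, rule_format, of "Cod \<O> \<sigma>" "fib \<O> \<sigma>"]
    unfolding The_lift[OF \<sigma>] Let_def mu_inc_def
    using \<sigma> O.Cod_Obj by simp
qed

lemma mu_inc_hom:
  assumes \<sigma>: "\<sigma> \<in> Arr \<O>"
  shows "mu_inc \<sigma> \<in> hom V (ob_fib V \<O> (ob A) \<sigma> \<otimes> ob A (Cod \<O> \<sigma>))
    (ob_fib V \<P> (K A) (FA F \<sigma>) \<otimes> K A (FO F (Cod \<O> \<sigma>)))"
  unfolding mu_inc_def F_ob_fib[OF \<sigma>]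
  by (intro TensA_hom OO.ob_fib_hom[OF \<sigma>] inc_hom O.Cod_Obj \<sigma>)

text \<open>The maps \<open>mu_inc \<sigma>\<close> with \<open>\<sigma>\<close> over
  \<open>f\<close> are jointly epic: by existence of lifts, each choice of summands consists of the
  codomain and the fibers of such a \<open>\<sigma>\<close>.\<close>

lemma mu_inc_eqI:
  assumes f: "f \<in> Arr \<P>"
    and m: "m \<in> hom V (ob_fib V \<P> (K A) f \<otimes> K A (Cod \<P> f)) M"
      "m' \<in> hom V (ob_fib V \<P> (K A) f \<otimes> K A (Cod \<P> f)) M"
    and eq: "\<And>\<sigma>. \<sigma> \<in> Arr \<O> \<Longrightarrow> FA F \<sigma> = f \<Longrightarrow> m \<cdot> mu_inc \<sigma> = m' \<cdot> mu_inc \<sigma>"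
  shows "m = m'"
proof (rule coproduct_eqI[OF mu_coproduct[OF f] m])
  let ?n = "sz \<P> (Cod \<P> f)"
  fix c assume "c \<in> (\<Pi>\<^sub>E i\<in>{0..?n}. obj_fibre \<O> F (if i = 0 then Cod \<P> f else fib \<P> f i))"
  then have c: "c i \<in> obj_fibre \<O> F (if i = 0 then Cod \<P> f else fib \<P> f i)" if "i \<in> {0..?n}" for i
    using that by blast
  have c0: "c 0 \<in> obj_fibre \<O> F (Cod \<P> f)" using c[of 0] by simp
  have "c i \<in> obj_fibre \<O> F (fib \<P> f i)" if "i \<in> {1..?n}" for i using c[of i] that by simp
  then obtain \<sigma> where "is_lift \<O> F f (c 0) c \<sigma>" using lift_ex1[OF f c0] by blast
  then have \<sigma>: "\<sigma> \<in> Arr \<O>" "Cod \<O> \<sigma> = c 0" "FA F \<sigma> = f" "\<forall>i\<in>{1..sz \<O> (c 0)}. fib \<O> \<sigma> i = c i"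
    by (auto simp: is_lift_def)
  have n: "sz \<O> (c 0) = ?n" using c0 by (auto simp: obj_fibre_def simp flip: F_sz)
  have "mu_inc \<sigma> = bigA V ?n (\<lambda>i. inc A (c i)) \<odot> inc A (c 0)"
    unfolding mu_inc_def \<sigma>(2) n
    by (intro arg_cong2[where f = "TensA V"] bigA_cong) (use \<sigma>(4) n in simp_all)
  then show "m \<cdot> (bigA V ?n (\<lambda>i. inc A (c i)) \<odot> inc A (c 0)) = m' \<cdot> (bigA V ?n (\<lambda>i. inc A (c i)) \<odot> inc A (c 0))"
    using eq[OF \<sigma>(1,3)] by simp
qed

text \<open>
  A choice of summands for \<open>f\<close> and \<open>g\<close> over \<open>T \<rightarrow> S \<rightarrow> R\<close> is the same as a composable pair of lifts:
  first lift \<open>g\<close>, then lift \<open>f\<close> to an arrow into the domain of the lift of \<open>g\<close>.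
\<close>

lemma assoc_eqI:
  assumes f: "f \<in> Arr \<P>" and g: "g \<in> Arr \<P>" and fg: "Dom \<P> g = Cod \<P> f"
  defines "X \<equiv> case_slot (\<lambda>j. K A (fib \<P> f j)) (\<lambda>i. K A (fib \<P> g i)) (K A (Cod \<P> g))"
  assumes m: "m \<in> hom V (tobj V X (assoc_src (szm \<P> g))) M" "m' \<in> hom V (tobj V X (assoc_src (szm \<P> g))) M"
    and eq: "\<And>\<sigma> \<gamma>. \<sigma> \<in> Arr \<O> \<Longrightarrow> \<gamma> \<in> Arr \<O> \<Longrightarrow> Dom \<O> \<gamma> = Cod \<O> \<sigma> \<Longrightarrow> FA F \<sigma> = f \<Longrightarrow> FA F \<gamma> = g \<Longrightarrow>
      m \<cdot> tarr V (case_slot (\<lambda>j. inc A (fib \<O> \<sigma> j)) (\<lambda>i. inc A (fib \<O> \<gamma> i)) (inc A (Cod \<O> \<gamma>))) (assoc_src (szm \<O> \<gamma>)) =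
      m' \<cdot> tarr V (case_slot (\<lambda>j. inc A (fib \<O> \<sigma> j)) (\<lambda>i. inc A (fib \<O> \<gamma> i)) (inc A (Cod \<O> \<gamma>))) (assoc_src (szm \<O> \<gamma>))"
  shows "m = m'"
proof -
  define T where "T = case_slot (fib \<P> f) (fib \<P> g) (Cod \<P> g)"
  let ?w = "assoc_src (szm \<P> g)"
  have X: "X l = K A (T l)" for l by (cases l) (simp_all add: X_def T_def)
  have w: "set (leaves ?w) = Up ` {1..sz \<P> (Cod \<P> f)} \<union> Mid ` {1..sz \<P> (Cod \<P> g)} \<union> {Low}"
    by (simp add: set_leaves_assoc_src P.Dom_szm P.Cod_szm f g fg)
  \<comment> \<open>The slots of \<open>assoc_src\<close> are pairwise distinct, so summands can be
    chosen independently at all of them.\<close>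
  have cop: "is_coproduct V (\<Pi>\<^sub>E l\<in>set (leaves ?w). obj_fibre \<O> F (T l)) (\<lambda>c. tobj V (\<lambda>l. ob A (c l)) ?w)
      (tobj V X ?w, \<lambda>c. tarr V (\<lambda>l. inc A (c l)) ?w)"
    unfolding X
    by (rule tobj_coproduct[OF closed assoc_leaves(1)[OF P.szm_Arr[OF g]] K_coproduct])
      (use OO.operad_ob[OF A] in \<open>simp add: obj_fibre_def\<close>)
  show ?thesis
  proof (rule coproduct_eqI[OF cop m])
    fix c assume "c \<in> (\<Pi>\<^sub>E l\<in>set (leaves ?w). obj_fibre \<O> F (T l))"
    then have c: "c l \<in> obj_fibre \<O> F (T l)" if "l \<in> set (leaves ?w)" for l using that by blast
    have Low: "c Low \<in> obj_fibre \<O> F (Cod \<P> g)" using c[of Low] by (simp add: w T_def)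
    have Mid: "c (Mid i) \<in> obj_fibre \<O> F (fib \<P> g i)" if "i \<in> {1..sz \<P> (Cod \<P> g)}" for i
      using c[of "Mid i"] that by (simp add: w T_def)
    have Up: "c (Up j) \<in> obj_fibre \<O> F (fib \<P> f j)" if "j \<in> {1..sz \<P> (Cod \<P> f)}" for j
      using c[of "Up j"] that by (simp add: w T_def)
    obtain \<gamma> where "is_lift \<O> F g (c Low) (\<lambda>i. c (Mid i)) \<gamma>" using lift_ex1[OF g Low Mid] by blast
    then have \<gamma>: "\<gamma> \<in> Arr \<O>" "Cod \<O> \<gamma> = c Low" "FA F \<gamma> = g" "\<forall>i\<in>{1..sz \<O> (c Low)}. fib \<O> \<gamma> i = c (Mid i)"
      by (auto simp: is_lift_def)
    have D: "Dom \<O> \<gamma> \<in> obj_fibre \<O> F (Cod \<P> f)"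
      using F_Arr(2)[OF \<gamma>(1)] \<gamma>(3) fg O.Dom_Obj[OF \<gamma>(1)] by (simp add: obj_fibre_def)
    obtain \<sigma> where "is_lift \<O> F f (Dom \<O> \<gamma>) (\<lambda>j. c (Up j)) \<sigma>" using lift_ex1[OF f D Up] by blast
    then have \<sigma>: "\<sigma> \<in> Arr \<O>" "Cod \<O> \<sigma> = Dom \<O> \<gamma>" "FA F \<sigma> = f" "\<forall>j\<in>{1..sz \<O> (Dom \<O> \<gamma>)}. fib \<O> \<sigma> j = c (Up j)"
      by (auto simp: is_lift_def)
    have n: "sz \<O> (c Low) = sz \<P> (Cod \<P> g)" "sz \<O> (Dom \<O> \<gamma>) = sz \<P> (Cod \<P> f)"
      using Low D by (auto simp: obj_fibre_def simp flip: F_sz)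
    have "tarr V (\<lambda>l. inc A (c l)) ?w =
        tarr V (case_slot (\<lambda>j. inc A (fib \<O> \<sigma> j)) (\<lambda>i. inc A (fib \<O> \<gamma> i)) (inc A (Cod \<O> \<gamma>))) (assoc_src (szm \<O> \<gamma>))"
      unfolding F_szm[OF \<gamma>(1), symmetric] \<gamma>(3)
      by (rule tarr_cong) (use \<gamma> \<sigma> n in \<open>auto simp: w\<close>)
    then show "m \<cdot> tarr V (\<lambda>l. inc A (c l)) ?w = m' \<cdot> tarr V (\<lambda>l. inc A (c l)) ?w"
      using eq[OF \<sigma>(1) \<gamma>(1) \<sigma>(2)[symmetric] \<sigma>(3) \<gamma>(3)] by simp
  qed
qed

end

end

text \<open>The fibers of \<open>f_i\<close> are the fibers of \<open>f\<close> over the preimage of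
  \<open>i\<close>, in order; so \<open>P(f_i)\<close> is the product of the \<open>Up\<close> slots
  in the block over \<open>i\<close> of \<open>assoc_tgt\<close>.\<close>

lemma (in operads) ob_fib_ind:
  assumes "f \<in> Arr \<O>" "g \<in> Arr \<O>" "Dom \<O> g = Cod \<O> f" "i \<in> {1..sz \<O> (Cod \<O> g)}"
  shows "ob_fib V \<O> X (ind \<O> f g i) = bigO V (sfib (szm \<O> g) i) (\<lambda>p. X (fib \<O> f (sincl (szm \<O> g) i p)))"
  unfolding ob_fib_def O.ind_simps(3)[OF assms] O.sz_fib_Arr[OF assms(2,4)]
  by (rule bigO_cong) (simp_all only: O.fib_ind_sincl[OF assms(1-3)])

context discrete_fibration
begin

lemma pi0_map_surj:
  assumes "c \<in> pi0 \<P>"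
  obtains a where "a \<in> pi0 \<O>" "pi0_map \<P> F a = c"
  using fibration assms unfolding is_discrete_operadic_fibration_def by (metis imageE)

text \<open>By \<open>trm_fibre_unique\<close> the definite description denotes \<open>a\<close>.
  Every component of \<open>\<P>\<close> has the form \<open>pi0_map \<P> F a\<close> by
  surjectivity, so this determines all units.\<close>

lemma shriek_unt:
  assumes a: "a \<in> pi0 \<O>"
  shows "shriek_unt V \<O> \<P> F A (pi0_map \<P> F a) = inc A (trm \<O> a) \<cdot> unt A a"
proof -
  have "(THE b. b \<in> pi0 \<O> \<and> FO F (trm \<O> b) = trm \<P> (pi0_map \<P> F a)) = a"
    by (rule the_equality) (use a trm_fibre_unique[OF _ a] in \<open>auto simp: F_trm\<close>)
  then show ?thesis by (simp add: shriek_unt_def)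
qed

lemma shriek_operad_simps [simp]:
  "T \<in> Obj \<P> \<Longrightarrow> ob (shriek_operad V \<O> \<P> F A) T = K A T"
  "a \<in> pi0 \<O> \<Longrightarrow> unt (shriek_operad V \<O> \<P> F A) (pi0_map \<P> F a) = inc A (trm \<O> a) \<cdot> unt A a"
  "f \<in> Arr \<P> \<Longrightarrow> mu (shriek_operad V \<O> \<P> F A) f = shriek_mu V \<O> \<P> F A f"
  by (simp_all add: shriek_operad_def shriek_unt pi0_map_pi0)

lemma ob_fib_shriek:
  "f \<in> Arr \<P> \<Longrightarrow> ob_fib V \<P> (ob (shriek_operad V \<O> \<P> F A)) f = ob_fib V \<P> (K A) f"
  unfolding ob_fib_def by (rule bigO_cong) (use P.fib_Obj_Arr in auto)

section \<open>The operad axioms for \<open>F\<^sub>!A\<close>\<close>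

context
  fixes A assumes A: "is_operad V \<O> A"
begin

lemma unt_inc_hom: "a \<in> pi0 \<O> \<Longrightarrow> inc A (trm \<O> a) \<cdot> unt A a \<in> hom V (UnitO V) (K A (FO F (trm \<O> a)))"
  using Comp_hom[OF OO.operad_unt[OF A] inc_hom[OF A O.trm_Obj]] .

text \<open>On the summand of a composable pair of lifts, both sides become the inclusion of
  \<open>A(t)\<close>, with \<open>t\<close> the domain of \<open>\<sigma>\<close>, after one of the
  two sides of associativity in \<open>A\<close>, with a canonical \<open>\<psi>\<close> in the
  place of \<open>\<phi>\<close>.\<close>

lemma shriek_assoc:
  assumes f: "f \<in> Arr \<P>" and g: "g \<in> Arr \<P>" and fg: "Dom \<P> g = Cod \<P> f"
    and can: "canonical V (case_slot (\<lambda>j. K A (fib \<P> f j)) (\<lambda>i. K A (fib \<P> g i)) (K A (Cod \<P> g)))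
      (assoc_src (szm \<P> g)) (assoc_tgt (szm \<P> g)) \<phi>"
  shows "shriek_mu V \<O> \<P> F A f \<cdot> (Ide V (ob_fib V \<P> (K A) f) \<odot> shriek_mu V \<O> \<P> F A g) =
    shriek_mu V \<O> \<P> F A (g \<cdot>\<^bsub>\<P>\<^esub> f) \<cdot>
      (bigA V (sz \<P> (Cod \<P> g)) (\<lambda>i. shriek_mu V \<O> \<P> F A (ind \<P> f g i)) \<odot> Ide V (K A (Cod \<P> g))) \<cdot> \<phi>"
    (is "?L = ?R")
proof (rule assoc_eqI[OF A f g fg])
  let ?X = "case_slot (\<lambda>j. K A (fib \<P> f j)) (\<lambda>i. K A (fib \<P> g i)) (K A (Cod \<P> g))"
  let ?m = "shriek_mu V \<O> \<P> F A"
  let ?B = "bigA V (sz \<P> (Cod \<P> g)) (\<lambda>i. ?m (ind \<P> f g i))"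
  note KO = K_Obj[OF A] and mh = shriek_mu_hom[OF A]
  have obf: "ob_fib V \<P> (K A) f \<in> Obj V" by (rule OP.ob_fib_Obj[OF f KO])
  have src: "tobj V ?X (assoc_src (szm \<P> g)) =
      ob_fib V \<P> (K A) f \<otimes> ob_fib V \<P> (K A) g \<otimes> K A (Cod \<P> g)"
    by (simp add: tobj_assoc_src ob_fib_def P.Dom_szm P.Cod_szm g fg)
  have tgt: "tobj V ?X (assoc_tgt (szm \<P> g)) =
      bigO V (sz \<P> (Cod \<P> g)) (\<lambda>i. ob_fib V \<P> (K A) (ind \<P> f g i) \<otimes> K A (fib \<P> g i)) \<otimes> K A (Cod \<P> g)"
    unfolding tobj_assoc_tgt P.Cod_szm[OF g]
    by (auto intro!: arg_cong2[where f = "TensO V"] bigO_cong simp: OP.ob_fib_ind[OF f g fg])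
  have B: "?B \<in> hom V (bigO V (sz \<P> (Cod \<P> g)) (\<lambda>i. ob_fib V \<P> (K A) (ind \<P> f g i) \<otimes> K A (fib \<P> g i)))
      (ob_fib V \<P> (K A) (g \<cdot>\<^bsub>\<P>\<^esub> f))"
  proof -
    have "?m (ind \<P> f g i) \<in> hom V (ob_fib V \<P> (K A) (ind \<P> f g i) \<otimes> K A (fib \<P> g i)) (K A (fib \<P> (g \<cdot>\<^bsub>\<P>\<^esub> f) i))"
      if "i \<in> {1..sz \<P> (Cod \<P> g)}" for i
      using mh[OF P.ind_simps(1)[OF f g fg that]] P.ind_simps[OF f g fg that] by simp
    from bigA_hom[OF this] show ?thesis using f g fg by (simp add: ob_fib_def)
  qed
  have \<phi>: "\<phi> \<in> hom V (tobj V ?X (assoc_src (szm \<P> g))) (tobj V ?X (assoc_tgt (szm \<P> g)))"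
    using canonical_hom_iso[OF can] KO by (simp split: slot.split)
  have gf: "?m (g \<cdot>\<^bsub>\<P>\<^esub> f) \<in> hom V (ob_fib V \<P> (K A) (g \<cdot>\<^bsub>\<P>\<^esub> f) \<otimes> K A (Cod \<P> g)) (K A (Dom \<P> f))"
    using mh[of "g \<cdot>\<^bsub>\<P>\<^esub> f"] f g fg by simp
  have mf: "?m f \<in> hom V (ob_fib V \<P> (K A) f \<otimes> K A (Dom \<P> g)) (K A (Dom \<P> f))"
    using mh[OF f] fg by simp
  have IdeB: "?B \<odot> Ide V (K A (Cod \<P> g)) \<in> hom V (tobj V ?X (assoc_tgt (szm \<P> g)))
      (ob_fib V \<P> (K A) (g \<cdot>\<^bsub>\<P>\<^esub> f) \<otimes> K A (Cod \<P> g))"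
    unfolding tgt by (rule TensA_hom[OF B Ide_hom[OF KO]])
  show "?L \<in> hom V (tobj V ?X (assoc_src (szm \<P> g))) (K A (Dom \<P> f))"
    unfolding src by (rule Comp_hom[OF TensA_hom[OF Ide_hom[OF obf] mh[OF g]] mf])
  show "?R \<in> hom V (tobj V ?X (assoc_src (szm \<P> g))) (K A (Dom \<P> f))"
    by (rule Comp_hom[OF Comp_hom[OF \<phi> IdeB] gf])
  fix \<sigma> \<gamma>
  assume \<sigma>: "\<sigma> \<in> Arr \<O>" and \<gamma>: "\<gamma> \<in> Arr \<O>" and sg: "Dom \<O> \<gamma> = Cod \<O> \<sigma>" and F: "FA F \<sigma> = f" "FA F \<gamma> = g"
  let ?h = "case_slot (\<lambda>j. inc A (fib \<O> \<sigma> j)) (\<lambda>i. inc A (fib \<O> \<gamma> i)) (inc A (Cod \<O> \<gamma>))"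
  let ?Y = "case_slot (\<lambda>j. ob A (fib \<O> \<sigma> j)) (\<lambda>i. ob A (fib \<O> \<gamma> i)) (ob A (Cod \<O> \<gamma>))"
  let ?s = "assoc_src (szm \<O> \<gamma>)" and ?t = "assoc_tgt (szm \<O> \<gamma>)" and ?r = "sz \<O> (Cod \<O> \<gamma>)"
  have szm: "szm \<P> g = szm \<O> \<gamma>" using \<gamma> F(2) by auto
  have CodF: "Cod \<P> g = FO F (Cod \<O> \<gamma>)" "sz \<P> (Cod \<P> g) = ?r" using F_Arr(3)[OF \<gamma>] O.Cod_Obj[OF \<gamma>] F(2) by auto
  note ih = inc_hom[OF A]
  have h: "?h l \<in> hom V (?Y l) (?X l)" if "l \<in> set (leaves ?s)" for l
    using that ih[OF O.fib_Obj_Arr[OF \<sigma>]] ih[OF O.fib_Obj_Arr[OF \<gamma>]] ih[OF O.Cod_Obj[OF \<gamma>]]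
      F_fib[OF \<sigma>] F_fib[OF \<gamma>]
    by (auto simp: set_leaves_assoc_src O.Dom_szm O.Cod_szm \<gamma> sg F CodF)
  \<comment> \<open>Nothing beyond canonicity has to be known about \<open>\<psi>\<close>, since
    associativity in \<open>A\<close> holds for every canonical map.\<close>
  obtain \<psi> where \<psi>: "canonical V ?Y ?s ?t \<psi>" "\<psi> \<in> hom V (tobj V ?Y ?s) (tobj V ?Y ?t)"
      "\<phi> \<cdot> tarr V ?h ?s = tarr V ?h ?t \<cdot> \<psi>"
    using canonical_natural[OF can[unfolded szm] h] by blast
  let ?J = "bigA V (sz \<O> (Cod \<O> \<sigma>)) (\<lambda>j. inc A (fib \<O> \<sigma> j))"
  let ?I = "mu_inc A"
  note ind = O.ind_simps[OF \<sigma> \<gamma> sg]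
  have J: "?J \<in> hom V (ob_fib V \<O> (ob A) \<sigma>) (ob_fib V \<P> (K A) f)"
    using OO.ob_fib_hom[OF \<sigma> ih] F_ob_fib[OF \<sigma>, of "K A"] F(1) by simp
  note I\<sigma> = mu_inc_hom[OF A \<sigma>] and I\<gamma> = mu_inc_hom[OF A \<gamma>]
  have obA: "ob_fib V \<O> (ob A) \<sigma> \<in> Obj V" using J hom_Obj by blast
  have s1: "tarr V ?h ?s = ?J \<odot> ?I \<gamma>"
    by (simp add: tarr_assoc_src mu_inc_def[OF A] O.Dom_szm O.Cod_szm \<gamma> sg)
  have comp\<sigma>: "\<gamma> \<cdot>\<^bsub>\<O>\<^esub> \<sigma> \<in> Arr \<O>" "Cod \<O> (\<gamma> \<cdot>\<^bsub>\<O>\<^esub> \<sigma>) = Cod \<O> \<gamma>" "Dom \<O> (\<gamma> \<cdot>\<^bsub>\<O>\<^esub> \<sigma>) = Dom \<O> \<sigma>"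
    "FA F (\<gamma> \<cdot>\<^bsub>\<O>\<^esub> \<sigma>) = g \<cdot>\<^bsub>\<P>\<^esub> f"
    using \<sigma> \<gamma> sg F F_Comp by auto
  \<comment> \<open>After rebracketing, the block over \<open>i\<close> is the inclusion of the
    summand of the induced arrow \<open>ind \<O> \<sigma> \<gamma> i\<close>, which lies over
    \<open>f_i\<close>.\<close>
  have s2: "tarr V ?h ?t = bigA V ?r (\<lambda>i. ?I (ind \<O> \<sigma> \<gamma> i)) \<odot> inc A (Cod \<O> \<gamma>)"
    unfolding tarr_assoc_tgt O.Cod_szm[OF \<gamma>] mu_inc_def[OF A]
    by (auto intro!: arg_cong2[where f = "TensA V"] bigA_cong
        simp: ind O.sz_fib_Arr[OF \<gamma>] O.fib_ind_sincl[OF \<sigma> \<gamma> sg])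
  have muA: "mu A (ind \<O> \<sigma> \<gamma> i) \<in> hom V (ob_fib V \<O> (ob A) (ind \<O> \<sigma> \<gamma> i) \<otimes> ob A (fib \<O> \<gamma> i)) (ob A (fib \<O> (\<gamma> \<cdot>\<^bsub>\<O>\<^esub> \<sigma>) i))"
    if "i \<in> {1..?r}" for i
    using OO.operad_mu[OF A ind(1)[OF that]] ind[OF that] by simp
  let ?MA = "bigA V ?r (\<lambda>i. mu A (ind \<O> \<sigma> \<gamma> i))"
  have tY: "tobj V ?Y ?t = bigO V ?r (\<lambda>i. ob_fib V \<O> (ob A) (ind \<O> \<sigma> \<gamma> i) \<otimes> ob A (fib \<O> \<gamma> i)) \<otimes> ob A (Cod \<O> \<gamma>)"
    unfolding tobj_assoc_tgt O.Cod_szm[OF \<gamma>]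
    by (auto intro!: arg_cong2[where f = "TensO V"] bigO_cong simp: OO.ob_fib_ind[OF \<sigma> \<gamma> sg])
  have MA: "?MA \<in> hom V (bigO V ?r (\<lambda>i. ob_fib V \<O> (ob A) (ind \<O> \<sigma> \<gamma> i) \<otimes> ob A (fib \<O> \<gamma> i)))
      (ob_fib V \<O> (ob A) (\<gamma> \<cdot>\<^bsub>\<O>\<^esub> \<sigma>))"
    unfolding ob_fib_def[of V \<O> "ob A" "\<gamma> \<cdot>\<^bsub>\<O>\<^esub> \<sigma>"] comp\<sigma>(2) by (rule bigA_hom) (rule muA)
  have obC: "ob A (Cod \<O> \<gamma>) \<in> Obj V" using OO.operad_ob[OF A O.Cod_Obj[OF \<gamma>]] .

  have "?L \<cdot> tarr V ?h ?s = ?m f \<cdot> (Ide V (ob_fib V \<P> (K A) f) \<odot> ?m g) \<cdot> (?J \<odot> ?I \<gamma>)"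
    unfolding s1 using J I\<gamma> mf mh[OF g] obf F CodF by (auto simp: hom_def)
  \<comment> \<open>The inner structure map is evaluated on the summand of \<open>\<gamma>\<close>.
    The result lies in the summand of the domain of \<open>\<gamma>\<close>, which is the codomain
    of \<open>\<sigma>\<close>, so \<open>mu_inc A \<sigma>\<close> can be split off next.\<close>
  also have "(Ide V (ob_fib V \<P> (K A) f) \<odot> ?m g) \<cdot> (?J \<odot> ?I \<gamma>) = ?J \<odot> (inc A (Dom \<O> \<gamma>) \<cdot> mu A \<gamma>)"
    using J I\<gamma> mh[OF g] obf F CodF shriek_mu_lift[OF A \<gamma>] by (auto simp: hom_def TensA_Comp_Arr)
  also have "\<dots> = ?I \<sigma> \<cdot> (Ide V (ob_fib V \<O> (ob A) \<sigma>) \<odot> mu A \<gamma>)"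
    unfolding mu_inc_def[OF A] sg
    using J ih[OF O.Cod_Obj[OF \<sigma>]] OO.operad_mu[OF A \<gamma>] sg obA by (auto simp: hom_def TensA_Comp_Arr)
  also have "?m f \<cdot> \<dots> = (?m f \<cdot> ?I \<sigma>) \<cdot> (Ide V (ob_fib V \<O> (ob A) \<sigma>) \<odot> mu A \<gamma>)"
    using mh[OF f] I\<sigma> OO.operad_mu[OF A \<gamma>] sg obA F F_Arr[OF \<sigma>] by (auto simp: hom_def)
  also have "\<dots> = inc A (Dom \<O> \<sigma>) \<cdot> mu A \<sigma> \<cdot> (Ide V (ob_fib V \<O> (ob A) \<sigma>) \<odot> mu A \<gamma>)"
    using shriek_mu_lift[OF A \<sigma>] F ih[OF O.Dom_Obj[OF \<sigma>]] OO.operad_mu[OF A \<sigma>] OO.operad_mu[OF A \<gamma>] sg obA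
    by (auto simp: hom_def)
  also have "mu A \<sigma> \<cdot> (Ide V (ob_fib V \<O> (ob A) \<sigma>) \<odot> mu A \<gamma>) =
      mu A (\<gamma> \<cdot>\<^bsub>\<O>\<^esub> \<sigma>) \<cdot> (?MA \<odot> Ide V (ob A (Cod \<O> \<gamma>))) \<cdot> \<psi>"
    by (rule OO.operad_assoc[OF A \<sigma> \<gamma> sg \<psi>(1)])
  finally have L: "?L \<cdot> tarr V ?h ?s =
      inc A (Dom \<O> \<sigma>) \<cdot> mu A (\<gamma> \<cdot>\<^bsub>\<O>\<^esub> \<sigma>) \<cdot> (?MA \<odot> Ide V (ob A (Cod \<O> \<gamma>))) \<cdot> \<psi>" .

  have h_s: "tarr V ?h ?s \<in> hom V (tobj V ?Y ?s) (tobj V ?X (assoc_src (szm \<P> g)))"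
    unfolding szm by (rule tarr_hom) (rule h)
  have h_t: "tarr V ?h ?t \<in> hom V (tobj V ?Y ?t) (tobj V ?X (assoc_tgt (szm \<P> g)))"
    unfolding szm by (rule tarr_hom)
      (use h assoc_leaves(2)[OF O.szm_Arr[OF \<gamma>]] in \<open>metis set_mset_mset\<close>)
  have Iind: "?I (ind \<O> \<sigma> \<gamma> i) \<in> hom V (ob_fib V \<O> (ob A) (ind \<O> \<sigma> \<gamma> i) \<otimes> ob A (fib \<O> \<gamma> i))
      (ob_fib V \<P> (K A) (ind \<P> f g i) \<otimes> K A (fib \<P> g i))" if "i \<in> {1..?r}" for i
    using mu_inc_hom[OF A ind(1)[OF that]] ind[OF that] F_ind[OF \<sigma> \<gamma> sg that] F_fib[OF \<gamma> that] F by simp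
  have mind: "?m (ind \<P> f g i) \<in> hom V (ob_fib V \<P> (K A) (ind \<P> f g i) \<otimes> K A (fib \<P> g i)) (K A (fib \<P> (g \<cdot>\<^bsub>\<P>\<^esub> f) i))"
    if "i \<in> {1..?r}" for i
    using mh[OF P.ind_simps(1)[OF f g fg]] P.ind_simps[OF f g fg] that CodF(2) by simp
  have incf: "inc A (fib \<O> (\<gamma> \<cdot>\<^bsub>\<O>\<^esub> \<sigma>) i) \<in> hom V (ob A (fib \<O> (\<gamma> \<cdot>\<^bsub>\<O>\<^esub> \<sigma>) i)) (K A (fib \<P> (g \<cdot>\<^bsub>\<P>\<^esub> f) i))"
    if "i \<in> {1..?r}" for i
    using ih[OF O.fib_Obj_Arr[OF comp\<sigma>(1)]] F_fib[OF comp\<sigma>(1)] comp\<sigma> that by simp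
  \<comment> \<open>Blockwise evaluation: \<open>shriek_mu_lift\<close> at each induced arrow leaves
    the inclusions of the fibers of the composite lift, which are the fiber part of its
    \<open>mu_inc\<close>.\<close>
  have "?B \<cdot> bigA V ?r (\<lambda>i. ?I (ind \<O> \<sigma> \<gamma> i)) = bigA V ?r (\<lambda>i. ?m (ind \<P> f g i) \<cdot> ?I (ind \<O> \<sigma> \<gamma> i))"
    unfolding CodF(2) by (rule bigA_Comp[OF Iind mind])
  also have "\<dots> = bigA V ?r (\<lambda>i. inc A (fib \<O> (\<gamma> \<cdot>\<^bsub>\<O>\<^esub> \<sigma>) i) \<cdot> mu A (ind \<O> \<sigma> \<gamma> i))"
  proof (rule bigA_cong[OF refl])
    fix i assume i: "i \<in> {1..?r}"
    show "?m (ind \<P> f g i) \<cdot> ?I (ind \<O> \<sigma> \<gamma> i) = inc A (fib \<O> (\<gamma> \<cdot>\<^bsub>\<O>\<^esub> \<sigma>) i) \<cdot> mu A (ind \<O> \<sigma> \<gamma> i)"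
      using shriek_mu_lift[OF A ind(1)[OF i]] ind[OF i] F_ind[OF \<sigma> \<gamma> sg i] F by simp
  qed
  also have "\<dots> = bigA V ?r (\<lambda>i. inc A (fib \<O> (\<gamma> \<cdot>\<^bsub>\<O>\<^esub> \<sigma>) i)) \<cdot> ?MA"
    by (rule bigA_Comp[OF muA incf, symmetric])
  finally have BI: "?B \<cdot> bigA V ?r (\<lambda>i. ?I (ind \<O> \<sigma> \<gamma> i)) = \<dots>" .
  have incs: "bigA V ?r (\<lambda>i. inc A (fib \<O> (\<gamma> \<cdot>\<^bsub>\<O>\<^esub> \<sigma>) i)) \<in> hom V (ob_fib V \<O> (ob A) (\<gamma> \<cdot>\<^bsub>\<O>\<^esub> \<sigma>))
      (ob_fib V \<P> (K A) (g \<cdot>\<^bsub>\<P>\<^esub> f))"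
    using OO.ob_fib_hom[OF comp\<sigma>(1) ih] F_ob_fib[OF comp\<sigma>(1), of "K A"] comp\<sigma> by simp
  have bI: "bigA V ?r (\<lambda>i. ?I (ind \<O> \<sigma> \<gamma> i)) \<in> hom V
      (bigO V ?r (\<lambda>i. ob_fib V \<O> (ob A) (ind \<O> \<sigma> \<gamma> i) \<otimes> ob A (fib \<O> \<gamma> i)))
      (bigO V ?r (\<lambda>i. ob_fib V \<P> (K A) (ind \<P> f g i) \<otimes> K A (fib \<P> g i)))"
    by (rule bigA_hom) (rule Iind)
  have step: "(?B \<odot> Ide V (K A (Cod \<P> g))) \<cdot> tarr V ?h ?t = ?I (\<gamma> \<cdot>\<^bsub>\<O>\<^esub> \<sigma>) \<cdot> (?MA \<odot> Ide V (ob A (Cod \<O> \<gamma>)))"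
  proof -
    have "(?B \<odot> Ide V (K A (Cod \<P> g))) \<cdot> tarr V ?h ?t =
        (?B \<cdot> bigA V ?r (\<lambda>i. ?I (ind \<O> \<sigma> \<gamma> i))) \<odot> inc A (Cod \<O> \<gamma>)"
      unfolding s2 using B[unfolded CodF(2)] bI ih[OF O.Cod_Obj[OF \<gamma>]] KO CodF
      by (auto simp: hom_def TensA_Comp_Arr)
    also have "\<dots> = ?I (\<gamma> \<cdot>\<^bsub>\<O>\<^esub> \<sigma>) \<cdot> (?MA \<odot> Ide V (ob A (Cod \<O> \<gamma>)))"
      unfolding BI unfolding mu_inc_def[OF A] comp\<sigma>(2)
      using incs MA ih[OF O.Cod_Obj[OF \<gamma>]] obC by (auto simp: hom_def TensA_Comp_Arr)
    finally show ?thesis .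
  qed
  have I\<gamma>\<sigma>: "?I (\<gamma> \<cdot>\<^bsub>\<O>\<^esub> \<sigma>) \<in> hom V (ob_fib V \<O> (ob A) (\<gamma> \<cdot>\<^bsub>\<O>\<^esub> \<sigma>) \<otimes> ob A (Cod \<O> \<gamma>))
      (ob_fib V \<P> (K A) (g \<cdot>\<^bsub>\<P>\<^esub> f) \<otimes> K A (Cod \<P> g))"
    using mu_inc_hom[OF A comp\<sigma>(1)] comp\<sigma> CodF by simp
  have MI: "?MA \<odot> Ide V (ob A (Cod \<O> \<gamma>)) \<in> hom V (tobj V ?Y ?t) (ob_fib V \<O> (ob A) (\<gamma> \<cdot>\<^bsub>\<O>\<^esub> \<sigma>) \<otimes> ob A (Cod \<O> \<gamma>))"
    unfolding tY by (rule TensA_hom[OF MA Ide_hom[OF obC]])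
  have "?R \<cdot> tarr V ?h ?s = ?m (g \<cdot>\<^bsub>\<P>\<^esub> f) \<cdot> (?B \<odot> Ide V (K A (Cod \<P> g))) \<cdot> \<phi> \<cdot> tarr V ?h ?s"
    using Comp_assoc[OF h_s Comp_hom[OF \<phi> IdeB] gf] Comp_assoc[OF h_s \<phi> IdeB] by simp
  also have "\<dots> = ?m (g \<cdot>\<^bsub>\<P>\<^esub> f) \<cdot> ((?B \<odot> Ide V (K A (Cod \<P> g))) \<cdot> tarr V ?h ?t) \<cdot> \<psi>"
    unfolding \<psi>(3) using Comp_assoc[OF \<psi>(2) h_t IdeB] by simp
  also have "\<dots> = (?m (g \<cdot>\<^bsub>\<P>\<^esub> f) \<cdot> ?I (\<gamma> \<cdot>\<^bsub>\<O>\<^esub> \<sigma>)) \<cdot> (?MA \<odot> Ide V (ob A (Cod \<O> \<gamma>))) \<cdot> \<psi>"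
    unfolding step
    using Comp_assoc[OF \<psi>(2) MI I\<gamma>\<sigma>] Comp_assoc[OF Comp_hom[OF \<psi>(2) MI] I\<gamma>\<sigma> gf] by simp
  also have "\<dots> = inc A (Dom \<O> \<sigma>) \<cdot> mu A (\<gamma> \<cdot>\<^bsub>\<O>\<^esub> \<sigma>) \<cdot> (?MA \<odot> Ide V (ob A (Cod \<O> \<gamma>))) \<cdot> \<psi>"
    using shriek_mu_lift[OF A comp\<sigma>(1)] comp\<sigma>
      Comp_assoc[OF Comp_hom[OF \<psi>(2) MI] OO.operad_mu[OF A comp\<sigma>(1), unfolded comp\<sigma>(2,3)] ih[OF O.Dom_Obj[OF \<sigma>]]]
    by simp
  finally show "?L \<cdot> tarr V ?h ?s = ?R \<cdot> tarr V ?h ?s" using L by simp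
qed

text \<open>On the summand of \<open>t\<close> this is the unit law of \<open>A\<close> at
  \<open>t\<close>: \<open>Ide \<O> t\<close> lies over \<open>Ide \<P> T\<close>, and its fibers
  are chosen terminal objects over the fibers of \<open>Ide \<P> T\<close>.\<close>

lemma shriek_unit_left:
  assumes T: "T \<in> Obj \<P>"
    and can: "canonical V (\<lambda>_::unit. K A T)
      (Leaf ()) (Times (tens (map (\<lambda>_. One) [1..<Suc (sz \<P> T)])) (Leaf ())) \<phi>"
  shows "shriek_mu V \<O> \<P> F A (Ide \<P> T) \<cdot>
    (bigA V (sz \<P> T) (\<lambda>i. unt (shriek_operad V \<O> \<P> F A) (component \<P> (fib \<P> (Ide \<P> T) i))) \<odot> Ide V (K A T)) \<cdot> \<phi> =
    Ide V (K A T)"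
    (is "?m \<cdot> (?U \<odot> _) \<cdot> \<phi> = _")
proof (rule K_eqI[OF A])
  let ?S = "shriek_operad V \<O> \<P> F A" and ?n = "sz \<P> T"
  let ?w = "tens (map (\<lambda>_. One) [Suc 0..<Suc ?n]) :: unit tword"
  note KO = K_Obj[OF A] and ih = inc_hom[OF A]
  have fibT: "fib \<P> (Ide \<P> T) i \<in> Obj \<P>" if "i \<in> {1..?n}" for i
    using P.fib_Obj_Arr[of "Ide \<P> T"] T that by simp
  \<comment> \<open>The word has no leaves, so its value does not depend on \<open>X\<close>, and a
    tensor word of maps on it is an identity.\<close>
  have w: "tobj V X ?w = bigO V ?n (\<lambda>_. UnitO V)" "tarr V h ?w = Ide V (bigO V ?n (\<lambda>_. UnitO V))" for X h
  proof -
    show "tobj V X ?w = bigO V ?n (\<lambda>_. UnitO V)"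
      unfolding bigO_def by (subst tobj_tens_map) (simp del: upt_Suc)
    have "tarr V h ?w = bigA V ?n (\<lambda>_. Ide V (UnitO V))"
      unfolding bigA_def by (subst tarr_tens_map) (simp del: upt_Suc)
    then show "tarr V h ?w = Ide V (bigO V ?n (\<lambda>_. UnitO V))" by (simp add: bigA_Ide UnitO_Obj)
  qed
  have uT: "unt ?S (component \<P> (fib \<P> (Ide \<P> T) i)) \<in> hom V (UnitO V) (K A (fib \<P> (Ide \<P> T) i))"
    if i: "i \<in> {1..?n}" for i
  proof -
    obtain c where c: "c \<in> pi0 \<P>" "fib \<P> (Ide \<P> T) i = trm \<P> c" using P.fib_Ide[OF T i] by blast
    obtain a where a: "a \<in> pi0 \<O>" "pi0_map \<P> F a = c" using pi0_map_surj[OF c(1)] by blast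
    have "component \<P> (fib \<P> (Ide \<P> T) i) = pi0_map \<P> F a" using P.component_trm[OF c(1)] c(2) a by simp
    moreover have "fib \<P> (Ide \<P> T) i = FO F (trm \<O> a)" using F_trm[OF a(1)] a c by simp
    ultimately show ?thesis using unt_inc_hom[OF a(1)] a(1) by simp
  qed
  have U: "?U \<in> hom V (bigO V ?n (\<lambda>_. UnitO V)) (ob_fib V \<P> (K A) (Ide \<P> T))"
    using bigA_hom[OF uT] T by (simp add: ob_fib_def)
  have m: "?m \<in> hom V (ob_fib V \<P> (K A) (Ide \<P> T) \<otimes> K A T) (K A T)"
    using shriek_mu_hom[OF A, of "Ide \<P> T"] T by simp
  have \<phi>: "\<phi> \<in> hom V (K A T) (bigO V ?n (\<lambda>_. UnitO V) \<otimes> K A T)"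
    using canonical_hom_iso[OF can KO] by (simp add: w del: upt_Suc)
  show "?m \<cdot> (?U \<odot> Ide V (K A T)) \<cdot> \<phi> \<in> hom V (K A T) (K A T)"
    using Comp_hom[OF Comp_hom[OF \<phi> TensA_hom[OF U Ide_hom[OF KO]]] m] .
  show "Ide V (K A T) \<in> hom V (K A T) (K A T)" using Ide_hom[OF KO] .
  fix t assume t: "t \<in> Obj \<O>" and Ft: "FO F t = T"
  have sz: "?n = sz \<O> t" using t Ft by auto
  have it: "inc A t \<in> hom V (ob A t) (K A T)" using ih[OF t] Ft by simp
  have obt: "ob A t \<in> Obj V" using OO.operad_ob[OF A t] .
  obtain \<psi> where \<psi>: "canonical V (\<lambda>_::unit. ob A t) (Leaf ()) (Times ?w (Leaf ())) \<psi>"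
      "\<psi> \<in> hom V (ob A t) (bigO V ?n (\<lambda>_. UnitO V) \<otimes> ob A t)"
      "\<phi> \<cdot> inc A t = (Ide V (bigO V ?n (\<lambda>_. UnitO V)) \<odot> inc A t) \<cdot> \<psi>"
    using canonical_natural[OF can, of "\<lambda>_. inc A t" "\<lambda>_. ob A t"] it by (auto simp: w simp del: upt_Suc)
  let ?a = "\<lambda>i. component \<O> (fib \<O> (Ide \<O> t) i)"
  let ?J = "bigA V ?n (\<lambda>i. inc A (fib \<O> (Ide \<O> t) i))" and ?UA = "bigA V ?n (\<lambda>i. unt A (?a i))"
  have fibt: "?a i \<in> pi0 \<O>" "trm \<O> (?a i) = fib \<O> (Ide \<O> t) i" "fib \<P> (Ide \<P> T) i = FO F (fib \<O> (Ide \<O> t) i)"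
      "fib \<O> (Ide \<O> t) i \<in> Obj \<O>"
    if i: "i \<in> {1..?n}" for i
  proof -
    obtain a where "a \<in> pi0 \<O>" "fib \<O> (Ide \<O> t) i = trm \<O> a" using O.fib_Ide[OF t] i sz by auto
    then show "?a i \<in> pi0 \<O>" "trm \<O> (?a i) = fib \<O> (Ide \<O> t) i" "fib \<O> (Ide \<O> t) i \<in> Obj \<O>"
      using O.component_trm O.trm_Obj by auto
    show "fib \<P> (Ide \<P> T) i = FO F (fib \<O> (Ide \<O> t) i)"
      using F_fib[of "Ide \<O> t" i] F_Ide[OF t] t Ft i sz by simp
  qed
  have ua: "unt A (?a i) \<in> hom V (UnitO V) (ob A (fib \<O> (Ide \<O> t) i))" if "i \<in> {1..?n}" for i
    using OO.operad_unt[OF A fibt(1)[OF that]] fibt(2)[OF that] by simp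
  \<comment> \<open>Whichever \<open>t\<close> over \<open>T\<close> is taken, the units at the
    fibers of \<open>Ide \<P> T\<close> factor through the summands of the fibers of
    \<open>Ide \<O> t\<close>.\<close>
  have "?U = bigA V ?n (\<lambda>i. inc A (fib \<O> (Ide \<O> t) i) \<cdot> unt A (?a i))"
    by (rule bigA_cong[OF refl]) (simp add: fibt flip: pi0_map_component)
  also have "\<dots> = ?J \<cdot> ?UA"
    by (rule bigA_Comp[symmetric, OF ua ih]) (use fibt in auto)
  finally have UJ: "?U = ?J \<cdot> ?UA" .
  have UA: "?UA \<in> hom V (bigO V ?n (\<lambda>_. UnitO V)) (ob_fib V \<O> (ob A) (Ide \<O> t))"
    using bigA_hom[OF ua] t sz by (simp add: ob_fib_def)
  have I: "?J \<odot> inc A t = mu_inc A (Ide \<O> t)" using t sz by (simp add: mu_inc_def[OF A])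
  have J: "?J \<in> hom V (ob_fib V \<O> (ob A) (Ide \<O> t)) (ob_fib V \<P> (K A) (Ide \<P> T))"
    using OO.ob_fib_hom[of "Ide \<O> t" "inc A" "ob A" "\<lambda>t. K A (FO F t)", OF _ ih]
      F_ob_fib[of "Ide \<O> t" "K A"] t sz F_Ide[OF t] Ft by simp
  have mA: "mu A (Ide \<O> t) \<in> hom V (ob_fib V \<O> (ob A) (Ide \<O> t) \<otimes> ob A t) (ob A t)"
    using OO.operad_mu[OF A, of "Ide \<O> t"] t by simp
  have UO: "bigO V ?n (\<lambda>_. UnitO V) \<in> Obj V" using hom_Obj[OF UA] by blast
  have "(?m \<cdot> (?U \<odot> Ide V (K A T)) \<cdot> \<phi>) \<cdot> inc A t = ?m \<cdot> (?U \<odot> Ide V (K A T)) \<cdot> \<phi> \<cdot> inc A t"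
    using m U \<phi> it KO by (auto simp: hom_def)
  also have "\<dots> = ?m \<cdot> ((?U \<odot> Ide V (K A T)) \<cdot> (Ide V (bigO V ?n (\<lambda>_. UnitO V)) \<odot> inc A t)) \<cdot> \<psi>"
    unfolding \<psi>(3) using m U \<psi>(2) it KO UO by (auto simp: hom_def)
  also have "(?U \<odot> Ide V (K A T)) \<cdot> (Ide V (bigO V ?n (\<lambda>_. UnitO V)) \<odot> inc A t) =
      (?J \<odot> inc A t) \<cdot> (?UA \<odot> Ide V (ob A t))"
    unfolding UJ using J UA it KO UO obt by (auto simp: hom_def TensA_Comp_Arr)
  also have "?m \<cdot> ((?J \<odot> inc A t) \<cdot> (?UA \<odot> Ide V (ob A t))) \<cdot> \<psi> =
      (?m \<cdot> (?J \<odot> inc A t)) \<cdot> (?UA \<odot> Ide V (ob A t)) \<cdot> \<psi>"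
    using m J UA it obt \<psi>(2) by (auto simp: hom_def)
  also have "?m \<cdot> (?J \<odot> inc A t) = inc A t \<cdot> mu A (Ide \<O> t)"
    unfolding I using shriek_mu_lift[OF A, of "Ide \<O> t"] F_Ide[OF t] t Ft by simp
  also have "(inc A t \<cdot> mu A (Ide \<O> t)) \<cdot> (?UA \<odot> Ide V (ob A t)) \<cdot> \<psi> =
      inc A t \<cdot> mu A (Ide \<O> t) \<cdot> (?UA \<odot> Ide V (ob A t)) \<cdot> \<psi>"
    using mA it UA obt \<psi>(2) by (auto simp: hom_def)
  also have "mu A (Ide \<O> t) \<cdot> (?UA \<odot> Ide V (ob A t)) \<cdot> \<psi> = Ide V (ob A t)"
    using OO.operad_unit_left[OF A t, of \<psi>] \<psi>(1) unfolding sz by (simp del: upt_Suc)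
  also have "inc A t \<cdot> Ide V (ob A t) = Ide V (K A T) \<cdot> inc A t"
    using it by (auto simp: hom_def)
  finally show "(?m \<cdot> (?U \<odot> Ide V (K A T)) \<cdot> \<phi>) \<cdot> inc A t = Ide V (K A T) \<cdot> inc A t" .
qed

text \<open>On the summand of \<open>t\<close> this is the unit law of \<open>A\<close> for the
  arrow from \<open>t\<close> to its chosen terminal object, once the component of \<open>t\<close>
  is known to be the one that supplies the unit over \<open>c\<close>.\<close>

lemma shriek_unit_right:
  assumes c: "c \<in> pi0 \<P>" and T: "T \<in> c" and f: "f \<in> hom \<P> T (trm \<P> c)"
    and can: "canonical V (\<lambda>_::unit. K A T) (Leaf ()) (Times (Leaf ()) One) \<phi>"
  shows "shriek_mu V \<O> \<P> F A f \<cdot> (Ide V (K A T) \<odot> unt (shriek_operad V \<O> \<P> F A) c) \<cdot> \<phi> = Ide V (K A T)"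
    (is "?m \<cdot> (_ \<odot> ?u) \<cdot> \<phi> = _")
proof (rule K_eqI[OF A])
  note KO = K_Obj[OF A] and ih = inc_hom[OF A]
  obtain a where a: "a \<in> pi0 \<O>" "pi0_map \<P> F a = c" using pi0_map_surj[OF c] by blast
  have u: "?u = inc A (trm \<O> a) \<cdot> unt A a" using a by auto
  have trm: "trm \<P> c = FO F (trm \<O> a)" using F_trm[OF a(1)] a(2) by simp
  have f': "f \<in> Arr \<P>" "Dom \<P> f = T" "Cod \<P> f = trm \<P> c" using f by (auto simp: hom_def)
  have "ob_fib V \<P> (K A) f = K A T"
    using P.sz_trm[OF c] P.fib_trm[OF c f] f' by (simp add: ob_fib_def bigO_1)
  then have m: "?m \<in> hom V (K A T \<otimes> K A (trm \<P> c)) (K A T)"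
    using shriek_mu_hom[OF A f'(1)] f' by simp
  have uh: "?u \<in> hom V (UnitO V) (K A (trm \<P> c))" using unt_inc_hom[OF a(1)] u trm by simp
  have \<phi>: "\<phi> \<in> hom V (K A T) (K A T \<otimes> UnitO V)" using canonical_hom_iso[OF can KO] by simp
  show "?m \<cdot> (Ide V (K A T) \<odot> ?u) \<cdot> \<phi> \<in> hom V (K A T) (K A T)"
    using Comp_hom[OF Comp_hom[OF \<phi> TensA_hom[OF Ide_hom[OF KO] uh]] m] .
  show "Ide V (K A T) \<in> hom V (K A T) (K A T)" using Ide_hom[OF KO] .
  fix t assume t: "t \<in> Obj \<O>" and Ft: "FO F t = T"
  have it: "inc A t \<in> hom V (ob A t) (K A T)" using ih[OF t] Ft by simp
  have obt: "ob A t \<in> Obj V" using OO.operad_ob[OF A t] .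
  let ?b = "component \<O> t"
  have b: "?b \<in> pi0 \<O>" "t \<in> ?b" using t O.component_pi0 O.mem_component by auto
  \<comment> \<open>The component of \<open>t\<close> and \<open>a\<close> have the same image, so
    their chosen terminal objects lie over the same object, and \<open>trm_fibre_unique\<close>
    identifies the two components.\<close>
  have "pi0_map \<P> F ?b = c" using pi0_map_component[OF t] Ft P.component_eq[OF c T] by simp
  then have "FO F (trm \<O> ?b) = FO F (trm \<O> a)" using F_trm[OF b(1)] trm by simp
  then have ba: "?b = a" using trm_fibre_unique[OF b(1) a(1)] by simp
  then have ta: "t \<in> a" using b by simp
  obtain \<sigma> where \<sigma>: "\<sigma> \<in> hom \<O> t (trm \<O> a)" using O.trm_terminal[OF a(1) ta] by blast
  then have \<sigma>': "\<sigma> \<in> Arr \<O>" "Dom \<O> \<sigma> = t" "Cod \<O> \<sigma> = trm \<O> a" by (auto simp: hom_def)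
  \<comment> \<open>By terminality, \<open>f\<close> is the only arrow from \<open>T\<close> to
    \<open>trm \<P> c\<close>.\<close>
  have F\<sigma>: "FA F \<sigma> = f"
    using P.trm_terminal[OF c T] f \<sigma>' Ft trm by (auto simp: hom_def)
  have I: "mu_inc A \<sigma> = inc A t \<odot> inc A (trm \<O> a)"
    using O.sz_trm[OF a(1)] O.fib_trm[OF a(1) \<sigma>] \<sigma>' by (simp add: mu_inc_def[OF A] bigA_1)
  have "ob_fib V \<O> (ob A) \<sigma> = ob A t"
    using O.sz_trm[OF a(1)] O.fib_trm[OF a(1) \<sigma>] \<sigma>' by (simp add: ob_fib_def bigO_1)
  then have mA: "mu A \<sigma> \<in> hom V (ob A t \<otimes> ob A (trm \<O> a)) (ob A t)"
    using OO.operad_mu[OF A \<sigma>'(1)] \<sigma>' by simp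
  have ia: "inc A (trm \<O> a) \<in> hom V (ob A (trm \<O> a)) (K A (trm \<P> c))"
    using ih[OF O.trm_Obj[OF a(1)]] trm by simp
  note ua = OO.operad_unt[OF A a(1)]
  obtain \<psi> where \<psi>: "canonical V (\<lambda>_::unit. ob A t) (Leaf ()) (Times (Leaf ()) One) \<psi>"
      "\<psi> \<in> hom V (ob A t) (ob A t \<otimes> UnitO V)"
      "\<phi> \<cdot> inc A t = (inc A t \<odot> Ide V (UnitO V)) \<cdot> \<psi>"
    using canonical_natural[OF can, of "\<lambda>_. inc A t" "\<lambda>_. ob A t"] it by auto
  have "(?m \<cdot> (Ide V (K A T) \<odot> ?u) \<cdot> \<phi>) \<cdot> inc A t = ?m \<cdot> (Ide V (K A T) \<odot> ?u) \<cdot> \<phi> \<cdot> inc A t"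
    using m uh \<phi> it KO by (auto simp: hom_def)
  also have "\<dots> = ?m \<cdot> ((Ide V (K A T) \<odot> ?u) \<cdot> (inc A t \<odot> Ide V (UnitO V))) \<cdot> \<psi>"
    unfolding \<psi>(3) using m uh \<psi>(2) it KO UnitO_Obj by (auto simp: hom_def)
  also have "(Ide V (K A T) \<odot> ?u) \<cdot> (inc A t \<odot> Ide V (UnitO V)) =
      (inc A t \<odot> inc A (trm \<O> a)) \<cdot> (Ide V (ob A t) \<odot> unt A a)"
    unfolding u using ia ua it KO UnitO_Obj obt by (auto simp: hom_def TensA_Comp_Arr)
  also have "?m \<cdot> ((inc A t \<odot> inc A (trm \<O> a)) \<cdot> (Ide V (ob A t) \<odot> unt A a)) \<cdot> \<psi> =
      (?m \<cdot> (inc A t \<odot> inc A (trm \<O> a))) \<cdot> (Ide V (ob A t) \<odot> unt A a) \<cdot> \<psi>"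
    using m ia ua it obt \<psi>(2) by (auto simp: hom_def)
  also have "?m \<cdot> (inc A t \<odot> inc A (trm \<O> a)) = inc A t \<cdot> mu A \<sigma>"
    using shriek_mu_lift[OF A \<sigma>'(1)] F\<sigma> \<sigma>' I by simp
  also have "(inc A t \<cdot> mu A \<sigma>) \<cdot> (Ide V (ob A t) \<odot> unt A a) \<cdot> \<psi> =
      inc A t \<cdot> mu A \<sigma> \<cdot> (Ide V (ob A t) \<odot> unt A a) \<cdot> \<psi>"
    using mA it ua obt \<psi>(2) by (auto simp: hom_def)
  also have "mu A \<sigma> \<cdot> (Ide V (ob A t) \<odot> unt A a) \<cdot> \<psi> = Ide V (ob A t)"
    by (rule OO.operad_unit_right[OF A a(1) ta \<sigma> \<psi>(1)])
  also have "inc A t \<cdot> Ide V (ob A t) = Ide V (K A T) \<cdot> inc A t"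
    using it by (auto simp: hom_def)
  finally show "(?m \<cdot> (Ide V (K A T) \<odot> ?u) \<cdot> \<phi>) \<cdot> inc A t = Ide V (K A T) \<cdot> inc A t" .
qed

lemma shriek_is_operad: "is_operad V \<P> (shriek_operad V \<O> \<P> F A)"
  unfolding is_operad_def
proof (intro conjI ballI allI impI)
  let ?S = "shriek_operad V \<O> \<P> F A"
  show "ob ?S \<in> Obj \<P> \<rightarrow>\<^sub>E Obj V" using K_Obj[OF A] by (simp add: shriek_operad_def)
  have "unt ?S c \<in> hom V (UnitO V) (ob ?S (trm \<P> c))" if c: "c \<in> pi0 \<P>" for c
  proof -
    obtain a where a: "a \<in> pi0 \<O>" "pi0_map \<P> F a = c" using pi0_map_surj[OF c] by blast
    then show ?thesis
      using unt_inc_hom[OF a(1)] F_trm[OF a(1)] P.trm_Obj[OF c] by auto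
  qed
  then show "unt ?S \<in> (\<Pi>\<^sub>E c\<in>pi0 \<P>. hom V (UnitO V) (ob ?S (trm \<P> c)))"
    by (auto simp: shriek_operad_def)
  have "mu ?S f \<in> hom V (ob_fib V \<P> (ob ?S) f \<otimes> ob ?S (Cod \<P> f)) (ob ?S (Dom \<P> f))" if "f \<in> Arr \<P>" for f
    using shriek_mu_hom[OF A that] that P.Dom_Obj P.Cod_Obj by (simp add: ob_fib_shriek)
  then show "mu ?S \<in> (\<Pi>\<^sub>E f\<in>Arr \<P>. hom V (ob_fib V \<P> (ob ?S) f \<otimes> ob ?S (Cod \<P> f)) (ob ?S (Dom \<P> f)))"
    by (auto simp: shriek_operad_def)
next
  let ?S = "shriek_operad V \<O> \<P> F A"
  fix f g \<phi>
  assume f: "f \<in> Arr \<P>" and g: "g \<in> Arr \<P>" and "Dom \<P> g = Cod \<P> f \<and> canonical V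
      (case_slot (\<lambda>j. ob ?S (fib \<P> f j)) (\<lambda>i. ob ?S (fib \<P> g i)) (ob ?S (Cod \<P> g)))
      (assoc_src (szm \<P> g)) (assoc_tgt (szm \<P> g)) \<phi>"
  then have fg: "Dom \<P> g = Cod \<P> f" and can: "canonical V
      (case_slot (\<lambda>j. ob ?S (fib \<P> f j)) (\<lambda>i. ob ?S (fib \<P> g i)) (ob ?S (Cod \<P> g)))
      (assoc_src (szm \<P> g)) (assoc_tgt (szm \<P> g)) \<phi>" by auto
  have "canonical V (case_slot (\<lambda>j. K A (fib \<P> f j)) (\<lambda>i. K A (fib \<P> g i)) (K A (Cod \<P> g)))
      (assoc_src (szm \<P> g)) (assoc_tgt (szm \<P> g)) \<phi>"
    using can
  proof (rule canonical_cong)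
    fix l assume "l \<in> set (leaves (assoc_src (szm \<P> g)))"
    then show "case_slot (\<lambda>j. ob ?S (fib \<P> f j)) (\<lambda>i. ob ?S (fib \<P> g i)) (ob ?S (Cod \<P> g)) l =
        case_slot (\<lambda>j. K A (fib \<P> f j)) (\<lambda>i. K A (fib \<P> g i)) (K A (Cod \<P> g)) l"
      using P.fib_Obj_Arr[OF f] P.fib_Obj_Arr[OF g] P.Cod_Obj[OF g]
      by (auto simp: set_leaves_assoc_src P.Dom_szm P.Cod_szm g fg)
  qed
  note assoc = shriek_assoc[OF f g fg this]
  have "bigA V (sz \<P> (Cod \<P> g)) (\<lambda>i. mu ?S (ind \<P> f g i)) =
      bigA V (sz \<P> (Cod \<P> g)) (\<lambda>i. shriek_mu V \<O> \<P> F A (ind \<P> f g i))"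
    by (rule bigA_cong[OF refl]) (simp add: P.ind_simps[OF f g fg])
  then show "mu ?S f \<cdot> (Ide V (ob_fib V \<P> (ob ?S) f) \<odot> mu ?S g) =
      mu ?S (g \<cdot>\<^bsub>\<P>\<^esub> f) \<cdot> (bigA V (sz \<P> (Cod \<P> g)) (\<lambda>i. mu ?S (ind \<P> f g i)) \<odot> Ide V (ob ?S (Cod \<P> g))) \<cdot> \<phi>"
    using assoc f g fg P.Cod_Obj[OF g] by (simp add: ob_fib_shriek)
next
  let ?S = "shriek_operad V \<O> \<P> F A"
  fix T \<phi>
  assume T: "T \<in> Obj \<P>" and can: "canonical V (\<lambda>_::unit. ob ?S T)
      (Leaf ()) (Times (tens (map (\<lambda>_. One) [1..<Suc (sz \<P> T)])) (Leaf ())) \<phi>"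
  show "mu ?S (Ide \<P> T) \<cdot>
      (bigA V (sz \<P> T) (\<lambda>i. unt ?S (component \<P> (fib \<P> (Ide \<P> T) i))) \<odot> Ide V (ob ?S T)) \<cdot> \<phi> = Ide V (ob ?S T)"
    using shriek_unit_left[OF T can[unfolded shriek_operad_simps(1)[OF T]]] T by simp
next
  let ?S = "shriek_operad V \<O> \<P> F A"
  fix c T f \<phi>
  assume c: "c \<in> pi0 \<P>" and T: "T \<in> c" and f: "f \<in> hom \<P> T (trm \<P> c)"
    and can: "canonical V (\<lambda>_::unit. ob ?S T) (Leaf ()) (Times (Leaf ()) One) \<phi>"
  have "T \<in> Obj \<P>" "f \<in> Arr \<P>" using P.pi0_Obj[OF c T] f by (auto simp: hom_def)
  then show "mu ?S f \<cdot> (Ide V (ob ?S T) \<odot> unt ?S c) \<cdot> \<phi> = Ide V (ob ?S T)"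
    using shriek_unit_right[OF c T f, of \<phi>] can by simp
qed

end

end

section \<open>The adjunction\<close>

context discrete_fibration
begin

text \<open>The adjoint transpose on underlying families. No compatibility with the operad
  structures is built in, so that the conditions on both sides of the adjunction can be
  compared.\<close>

definition mate ::
  "('o, 'a, 'vo, 'va) operad \<Rightarrow> ('p \<Rightarrow> 'va) \<Rightarrow> 'o \<Rightarrow> 'va" where
  "mate A \<theta> = (\<lambda>t\<in>Obj \<O>. \<theta> (FO F t) \<cdot> inc A t)"

text \<open>Precomposing with \<open>mu_inc A \<sigma>\<close> turns the condition on
  \<open>\<theta>\<close> at \<open>FA F \<sigma>\<close> into that on its mate at
  \<open>\<sigma>\<close>, and the unit conditions at \<open>pi0_map \<P> F a\<close> and
  \<open>a\<close> correspond likewise. The converse uses that the \<open>mu_inc A \<sigma>\<close>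
  are jointly epic and that every component of \<open>\<P>\<close> is an image.\<close>

lemma is_operad_map_mate:
  assumes A: "is_operad V \<O> A" and P: "is_operad V \<P> P"
    and \<theta>: "\<theta> \<in> (\<Pi>\<^sub>E T\<in>Obj \<P>. hom V (K A T) (ob P T))"
  shows "is_operad_map V \<P> (shriek_operad V \<O> \<P> F A) P \<theta> \<longleftrightarrow>
    is_operad_map V \<O> A (pullback_operad \<O> \<P> F P) (mate A \<theta>)"
proof -
  let ?S = "shriek_operad V \<O> \<P> F A" and ?Q = "pullback_operad \<O> \<P> F P"
  let ?\<theta> = "mate A \<theta>"
  note ih = inc_hom[OF A]
  have \<theta>h: "\<theta> T \<in> hom V (K A T) (ob P T)" if "T \<in> Obj \<P>" for T using \<theta> that by blast
  have \<theta>th: "?\<theta> t \<in> hom V (ob A t) (ob P (FO F t))" if "t \<in> Obj \<O>" for t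
    using Comp_hom[OF ih[OF that] \<theta>h] that by (simp add: mate_def)
  have \<theta>t: "?\<theta> \<in> (\<Pi>\<^sub>E t\<in>Obj \<O>. hom V (ob A t) (ob ?Q t))"
    using \<theta>th by (auto simp: mate_def)
  have unt: "\<theta> (trm \<P> (pi0_map \<P> F a)) \<cdot> unt ?S (pi0_map \<P> F a) = ?\<theta> (trm \<O> a) \<cdot> unt A a"
    if a: "a \<in> pi0 \<O>" for a
    using Comp_assoc[OF OO.operad_unt[OF A a] ih \<theta>h] O.trm_Obj[OF a] a by (simp add: F_trm mate_def)
  let ?B = "\<lambda>f. bigA V (sz \<P> (Cod \<P> f)) (\<lambda>i. \<theta> (fib \<P> f i)) \<odot> \<theta> (Cod \<P> f)"
  let ?C = "\<lambda>\<sigma>. bigA V (sz \<O> (Cod \<O> \<sigma>)) (\<lambda>i. ?\<theta> (fib \<O> \<sigma> i)) \<odot> ?\<theta> (Cod \<O> \<sigma>)"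
  have B: "?B f \<in> hom V (ob_fib V \<P> (K A) f \<otimes> K A (Cod \<P> f)) (ob_fib V \<P> (ob P) f \<otimes> ob P (Cod \<P> f))"
    if f: "f \<in> Arr \<P>" for f
    by (rule TensA_hom[OF OP.ob_fib_hom[OF f] \<theta>h]) (use \<theta>h P.Cod_Obj[OF f] in auto)
  \<comment> \<open>By functoriality of the tensor product, the product of the maps
    \<open>\<theta>\<close> restricts on the summand of \<open>\<sigma>\<close> to the product of
    their restrictions.\<close>
  have BC: "?B (FA F \<sigma>) \<cdot> mu_inc A \<sigma> = ?C \<sigma>" if \<sigma>: "\<sigma> \<in> Arr \<O>" for \<sigma>
  proof -
    have "bigA V (sz \<P> (Cod \<P> (FA F \<sigma>))) (\<lambda>i. \<theta> (fib \<P> (FA F \<sigma>) i)) =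
        bigA V (sz \<O> (Cod \<O> \<sigma>)) (\<lambda>i. \<theta> (FO F (fib \<O> \<sigma> i)))"
      by (rule bigA_cong) (use \<sigma> O.Cod_Obj in \<open>simp_all add: F_fib\<close>)
    moreover have "bigA V (sz \<O> (Cod \<O> \<sigma>)) (\<lambda>i. \<theta> (FO F (fib \<O> \<sigma> i))) \<cdot>
        bigA V (sz \<O> (Cod \<O> \<sigma>)) (\<lambda>i. inc A (fib \<O> \<sigma> i)) =
        bigA V (sz \<O> (Cod \<O> \<sigma>)) (\<lambda>i. \<theta> (FO F (fib \<O> \<sigma> i)) \<cdot> inc A (fib \<O> \<sigma> i))"
      by (rule bigA_Comp[OF ih \<theta>h]) (use O.fib_Obj_Arr[OF \<sigma>] in auto)
    moreover have "\<dots> = bigA V (sz \<O> (Cod \<O> \<sigma>)) (\<lambda>i. ?\<theta> (fib \<O> \<sigma> i))"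
      by (rule bigA_cong) (use O.fib_Obj_Arr[OF \<sigma>] in \<open>simp_all add: mate_def\<close>)
    moreover have "bigA V (sz \<O> (Cod \<O> \<sigma>)) (\<lambda>i. inc A (fib \<O> \<sigma> i)) \<in>
        hom V (ob_fib V \<O> (ob A) \<sigma>) (ob_fib V \<O> (\<lambda>t. K A (FO F t)) \<sigma>)"
      by (rule OO.ob_fib_hom[OF \<sigma> ih])
    moreover have "bigA V (sz \<O> (Cod \<O> \<sigma>)) (\<lambda>i. \<theta> (FO F (fib \<O> \<sigma> i))) \<in>
        hom V (ob_fib V \<O> (\<lambda>t. K A (FO F t)) \<sigma>) (ob_fib V \<O> (\<lambda>t. ob P (FO F t)) \<sigma>)"
      by (rule OO.ob_fib_hom[OF \<sigma>, of "\<lambda>t. \<theta> (FO F t)"]) (rule \<theta>h, simp)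
    ultimately show ?thesis
      using ih[OF O.Cod_Obj[OF \<sigma>]] \<theta>h[OF F_Obj[OF O.Cod_Obj[OF \<sigma>]]] O.Cod_Obj[OF \<sigma>] \<sigma>
      by (auto simp: mu_inc_def[OF A] TensA_Comp_Arr hom_def mate_def)
  qed
  have L: "(\<theta> (Dom \<P> (FA F \<sigma>)) \<cdot> mu ?S (FA F \<sigma>)) \<cdot> mu_inc A \<sigma> = ?\<theta> (Dom \<O> \<sigma>) \<cdot> mu A \<sigma>"
    if \<sigma>: "\<sigma> \<in> Arr \<O>" for \<sigma>
    using Comp_assoc[OF mu_inc_hom[OF A \<sigma>] shriek_mu_hom[OF A F_Arr(1)[OF \<sigma>], unfolded F_Arr[OF \<sigma>]] \<theta>h]
      Comp_assoc[OF OO.operad_mu[OF A \<sigma>] ih \<theta>h] O.Dom_Obj[OF \<sigma>] \<sigma> shriek_mu_lift[OF A \<sigma>]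
    by (simp add: mate_def)
  have R: "(mu P (FA F \<sigma>) \<cdot> ?B (FA F \<sigma>)) \<cdot> mu_inc A \<sigma> = mu P (FA F \<sigma>) \<cdot> ?C \<sigma>"
    if \<sigma>: "\<sigma> \<in> Arr \<O>" for \<sigma>
    using Comp_assoc[OF mu_inc_hom[OF A \<sigma>] B[OF F_Arr(1)[OF \<sigma>], unfolded F_Arr(3)[OF \<sigma>]]
        OP.operad_mu[OF P F_Arr(1)[OF \<sigma>], unfolded F_Arr(3)[OF \<sigma>]]] BC[OF \<sigma>] \<sigma> by simp
  show ?thesis
  proof
    assume \<theta>m: "is_operad_map V \<P> ?S P \<theta>"
    show "is_operad_map V \<O> A ?Q ?\<theta>"
      unfolding is_operad_map_def
    proof (intro conjI ballI \<theta>t)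
      show "?\<theta> (trm \<O> a) \<cdot> unt A a = unt ?Q a" if a: "a \<in> pi0 \<O>" for a
        using OP.operad_map_unt[OF \<theta>m pi0_map_pi0[OF a]] unt[OF a] a by simp
      show "?\<theta> (Dom \<O> \<sigma>) \<cdot> mu A \<sigma> = mu ?Q \<sigma> \<cdot> ?C \<sigma>" if \<sigma>: "\<sigma> \<in> Arr \<O>" for \<sigma>
        using OP.operad_map_mu[OF \<theta>m F_Arr(1)[OF \<sigma>]] L[OF \<sigma>] R[OF \<sigma>] \<sigma> by simp
    qed
  next
    assume \<theta>m: "is_operad_map V \<O> A ?Q ?\<theta>"
    show "is_operad_map V \<P> ?S P \<theta>"
      unfolding is_operad_map_def
    proof (intro conjI ballI)
      show "\<theta> \<in> (\<Pi>\<^sub>E T\<in>Obj \<P>. hom V (ob ?S T) (ob P T))"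
        using \<theta> by (auto simp: PiE_iff)
      show "\<theta> (trm \<P> c) \<cdot> unt ?S c = unt P c" if c: "c \<in> pi0 \<P>" for c
      proof -
        obtain a where a: "a \<in> pi0 \<O>" "pi0_map \<P> F a = c" using pi0_map_surj[OF c] by blast
        then show ?thesis using OO.operad_map_unt[OF \<theta>m a(1)] unt[OF a(1)] by simp
      qed
      fix f assume f: "f \<in> Arr \<P>"
      show "\<theta> (Dom \<P> f) \<cdot> mu ?S f = mu P f \<cdot> ?B f"
      proof (rule mu_inc_eqI[OF A f])
        show "\<theta> (Dom \<P> f) \<cdot> mu ?S f \<in> hom V (ob_fib V \<P> (K A) f \<otimes> K A (Cod \<P> f)) (ob P (Dom \<P> f))"
          using Comp_hom[OF shriek_mu_hom[OF A f] \<theta>h[OF P.Dom_Obj[OF f]]] f by simp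
        show "mu P f \<cdot> ?B f \<in> hom V (ob_fib V \<P> (K A) f \<otimes> K A (Cod \<P> f)) (ob P (Dom \<P> f))"
          using Comp_hom[OF B[OF f] OP.operad_mu[OF P f]] .
        fix \<sigma> assume \<sigma>: "\<sigma> \<in> Arr \<O>" and F\<sigma>: "FA F \<sigma> = f"
        show "(\<theta> (Dom \<P> f) \<cdot> mu ?S f) \<cdot> mu_inc A \<sigma> = (mu P f \<cdot> ?B f) \<cdot> mu_inc A \<sigma>"
          using OO.operad_map_mu[OF \<theta>m \<sigma>] L[OF \<sigma>] R[OF \<sigma>] \<sigma> unfolding F\<sigma> by (simp add: F\<sigma>)
      qed
    qed
  qed
qed

text \<open>The unit of the adjunction, obtained as the mate of the identity of
  \<open>F\<^sub>!A\<close>.\<close>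

lemma inc_operad_map:
  assumes A: "is_operad V \<O> A"
  shows "is_operad_map V \<O> A (pullback_operad \<O> \<P> F (shriek_operad V \<O> \<P> F A)) (\<lambda>t\<in>Obj \<O>. inc A t)"
proof -
  let ?S = "shriek_operad V \<O> \<P> F A"
  have S: "is_operad V \<P> ?S" using shriek_is_operad[OF A] .
  have "is_operad_map V \<O> A (pullback_operad \<O> \<P> F ?S) (mate A (\<lambda>T\<in>Obj \<P>. Ide V (ob ?S T)))"
    using OP.operad_map_Ide[OF S] by (subst is_operad_map_mate[OF A S, symmetric]) (auto simp: Ide_hom K_Obj[OF A])
  moreover have "mate A (\<lambda>T\<in>Obj \<P>. Ide V (ob ?S T)) = (\<lambda>t\<in>Obj \<O>. inc A t)"
    using Ide_Comp[OF inc_hom[OF A]] by (auto simp: mate_def intro!: restrict_ext)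
  ultimately show ?thesis by simp
qed

section \<open>Functoriality of \<open>F\<^sub>!\<close>\<close>

lemma shriek_map_spec:
  assumes A: "is_operad V \<O> A" and B: "is_operad V \<O> B"
    and \<theta>: "\<And>t. t \<in> Obj \<O> \<Longrightarrow> \<theta> t \<in> hom V (ob A t) (ob B t)"
  shows "shriek_map V \<O> F A B \<theta> T \<in> hom V (K A T) (K B T) \<and>
    (\<forall>t\<in>obj_fibre \<O> F T. shriek_map V \<O> F A B \<theta> T \<cdot> inc A t = inc B t \<cdot> \<theta> t)"
  unfolding shriek_map_def
  by (rule theI', rule K_ex1[OF A K_Obj[OF B]]) (use Comp_hom[OF \<theta> inc_hom[OF B]] in blast)

lemma shriek_map_hom:
  assumes "is_operad V \<O> A" "is_operad V \<O> B" "is_operad_map V \<O> A B \<theta>"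
  shows "shriek_map V \<O> F A B \<theta> T \<in> hom V (K A T) (K B T)"
  using shriek_map_spec[OF assms(1,2) OO.operad_map_hom[OF assms(3)]] by blast

lemma shriek_map_inc:
  assumes "is_operad V \<O> A" "is_operad V \<O> B" "is_operad_map V \<O> A B \<theta>" "t \<in> Obj \<O>"
  shows "shriek_map V \<O> F A B \<theta> (FO F t) \<cdot> inc A t = inc B t \<cdot> \<theta> t"
  using shriek_map_spec[OF assms(1,2) OO.operad_map_hom[OF assms(3)], of "FO F t"] assms(4)
  by (simp add: obj_fibre_def)

text \<open>Its mate is \<open>\<theta>\<close> followed by the unit at \<open>B\<close>, a
  composite of operad maps, and \<open>is_operad_map_mate\<close> transfers this back.\<close>

lemma shriek_map_is_operad_map:
  assumes A: "is_operad V \<O> A" and B: "is_operad V \<O> B" and \<theta>: "is_operad_map V \<O> A B \<theta>"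
  shows "is_operad_map V \<P> (shriek_operad V \<O> \<P> F A) (shriek_operad V \<O> \<P> F B)
    (\<lambda>T\<in>Obj \<P>. shriek_map V \<O> F A B \<theta> T)"
proof (subst is_operad_map_mate[OF A shriek_is_operad[OF B]])
  show "(\<lambda>T\<in>Obj \<P>. shriek_map V \<O> F A B \<theta> T) \<in> (\<Pi>\<^sub>E T\<in>Obj \<P>. hom V (K A T) (ob (shriek_operad V \<O> \<P> F B) T))"
    using shriek_map_hom[OF A B \<theta>] by auto
  have "mate A (\<lambda>T\<in>Obj \<P>. shriek_map V \<O> F A B \<theta> T) = (\<lambda>t\<in>Obj \<O>. (\<lambda>t\<in>Obj \<O>. inc B t) t \<cdot> \<theta> t)"
    unfolding mate_def by (rule restrict_ext) (simp add: shriek_map_inc[OF A B \<theta>])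
  then show "is_operad_map V \<O> A (pullback_operad \<O> \<P> F (shriek_operad V \<O> \<P> F B))
      (mate A (\<lambda>T\<in>Obj \<P>. shriek_map V \<O> F A B \<theta> T))"
    using OO.operad_map_Comp[OF A B pullback_is_operad[OF shriek_is_operad[OF B]] \<theta> inc_operad_map[OF B]] by simp
qed

lemma shriek_functor_simps [simp]:
  "FO (shriek V \<O> \<P> F) A = shriek_operad V \<O> \<P> F A"
  "FA (shriek V \<O> \<P> F) (A, \<theta>, B) =
    (shriek_operad V \<O> \<P> F A, \<lambda>T\<in>Obj \<P>. shriek_map V \<O> F A B \<theta> T, shriek_operad V \<O> \<P> F B)"
  by (simp_all add: shriek_def)

text \<open>Identities and composites are preserved because maps out of \<open>K A T\<close> are
  determined by their composites with the inclusions.\<close>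

lemma shriek_functor: "is_functor (Op V \<O>) (Op V \<P>) (shriek V \<O> \<P> F)"
  unfolding is_functor_def
proof (intro conjI ballI impI)
  show "FO (shriek V \<O> \<P> F) A \<in> Obj (Op V \<P>)" if "A \<in> Obj (Op V \<O>)" for A
    using that by (simp add: shriek_is_operad)
  show "FA (shriek V \<O> \<P> F) f \<in> hom (Op V \<P>) (FO (shriek V \<O> \<P> F) (Dom (Op V \<O>) f))
      (FO (shriek V \<O> \<P> F) (Cod (Op V \<O>) f))" if "f \<in> Arr (Op V \<O>)" for f
    using that by (cases f) (simp add: hom_Op_iff shriek_is_operad shriek_map_is_operad_map)
  show "FA (shriek V \<O> \<P> F) (Ide (Op V \<O>) A) = Ide (Op V \<P>) (FO (shriek V \<O> \<P> F) A)"
    if "A \<in> Obj (Op V \<O>)" for A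
  proof -
    have A: "is_operad V \<O> A" using that by simp
    note I = OO.operad_map_Ide[OF A]
    have "shriek_map V \<O> F A A (\<lambda>t\<in>Obj \<O>. Ide V (ob A t)) T = Ide V (K A T)" for T
    proof (rule K_eqI[OF A shriek_map_hom[OF A A I] Ide_hom[OF K_Obj[OF A]]])
      show "shriek_map V \<O> F A A (\<lambda>t\<in>Obj \<O>. Ide V (ob A t)) T \<cdot> inc A t = Ide V (K A T) \<cdot> inc A t"
        if "t \<in> Obj \<O>" "FO F t = T" for t
        using shriek_map_inc[OF A A I that(1)] inc_hom[OF A that(1)] that by (auto simp: hom_def)
    qed
    then show ?thesis by (auto intro!: restrict_ext)
  qed
  show "FA (shriek V \<O> \<P> F) (g \<cdot>\<^bsub>Op V \<O>\<^esub> f) = FA (shriek V \<O> \<P> F) g \<cdot>\<^bsub>Op V \<P>\<^esub> FA (shriek V \<O> \<P> F) f"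
    if f: "f \<in> Arr (Op V \<O>)" and g: "g \<in> Arr (Op V \<O>)" and fg: "Dom (Op V \<O>) g = Cod (Op V \<O>) f" for f g
  proof -
    obtain A \<theta> B where f': "f = (A, \<theta>, B)" by (cases f)
    obtain \<eta> D where g': "g = (B, \<eta>, D)" using fg f' by (cases g) auto
    have A: "is_operad V \<O> A" and B: "is_operad V \<O> B" and D: "is_operad V \<O> D"
      and \<theta>: "is_operad_map V \<O> A B \<theta>" and \<eta>: "is_operad_map V \<O> B D \<eta>"
      using f g f' g' by auto
    note \<eta>\<theta> = OO.operad_map_Comp[OF A B D \<theta> \<eta>]
    let ?\<theta> = "shriek_map V \<O> F A B \<theta>" and ?\<eta> = "shriek_map V \<O> F B D \<eta>"
    have "shriek_map V \<O> F A D (\<lambda>t\<in>Obj \<O>. \<eta> t \<cdot> \<theta> t) T = ?\<eta> T \<cdot> ?\<theta> T" for T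
    proof (rule K_eqI[OF A shriek_map_hom[OF A D \<eta>\<theta>]
          Comp_hom[OF shriek_map_hom[OF A B \<theta>] shriek_map_hom[OF B D \<eta>]]])
      fix t assume t: "t \<in> Obj \<O>" and T: "FO F t = T"
      have "(?\<eta> T \<cdot> ?\<theta> T) \<cdot> inc A t = ?\<eta> T \<cdot> inc B t \<cdot> \<theta> t"
        using Comp_assoc[OF inc_hom[OF A t] shriek_map_hom[OF A B \<theta>] shriek_map_hom[OF B D \<eta>]]
          shriek_map_inc[OF A B \<theta> t] T by simp
      also have "\<dots> = inc D t \<cdot> \<eta> t \<cdot> \<theta> t"
        using Comp_assoc[OF OO.operad_map_hom[OF \<theta> t] inc_hom[OF B t] shriek_map_hom[OF B D \<eta>]]
          Comp_assoc[OF OO.operad_map_hom[OF \<theta> t] OO.operad_map_hom[OF \<eta> t] inc_hom[OF D t]]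
          shriek_map_inc[OF B D \<eta> t] T by simp
      finally show "shriek_map V \<O> F A D (\<lambda>t\<in>Obj \<O>. \<eta> t \<cdot> \<theta> t) T \<cdot> inc A t = (?\<eta> T \<cdot> ?\<theta> T) \<cdot> inc A t"
        using shriek_map_inc[OF A D \<eta>\<theta> t] t T by simp
    qed
    then show ?thesis by (auto simp: f' g' intro!: restrict_ext)
  qed
qed (rule OO.category_Op OP.category_Op)+

section \<open>The natural bijection of hom-sets\<close>

definition mate_arrow ::
  "('o, 'a, 'vo, 'va) operad \<Rightarrow> ('p, 'b, 'vo, 'va) operad \<Rightarrow>
    ('p, 'b, 'vo, 'va) operad_arr \<Rightarrow> ('o, 'a, 'vo, 'va) operad_arr" where
  "mate_arrow A P f = (A, mate A (fst (snd f)), pullback_operad \<O> \<P> F P)"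

text \<open>On families of maps the bijection is the universal property of the coproducts
  \<open>K A T\<close>; \<open>is_operad_map_mate\<close> restricts it to operad maps on both
  sides.\<close>

lemma mate_arrow_bij:
  assumes A: "is_operad V \<O> A" and P: "is_operad V \<P> P"
  shows "bij_betw (mate_arrow A P) (hom (Op V \<P>) (shriek_operad V \<O> \<P> F A) P)
    (hom (Op V \<O>) A (pullback_operad \<O> \<P> F P))"
  unfolding bij_betw_def
proof
  let ?S = "shriek_operad V \<O> \<P> F A" and ?Q = "pullback_operad \<O> \<P> F P"
  have S: "is_operad V \<P> ?S" and Q: "is_operad V \<O> ?Q"
    using shriek_is_operad[OF A] pullback_is_operad[OF P] by auto
  have fam: "\<theta> \<in> (\<Pi>\<^sub>E T\<in>Obj \<P>. hom V (K A T) (ob P T))" if "is_operad_map V \<P> ?S P \<theta>" for \<theta>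
    using that by (auto simp: is_operad_map_def PiE_iff)
  show "inj_on (mate_arrow A P) (hom (Op V \<P>) ?S P)"
  proof (rule inj_onI)
    fix f g assume "f \<in> hom (Op V \<P>) ?S P" "g \<in> hom (Op V \<P>) ?S P" and eq: "mate_arrow A P f = mate_arrow A P g"
    then obtain \<theta> \<eta> where f: "f = (?S, \<theta>, P)" "is_operad_map V \<P> ?S P \<theta>" and g: "g = (?S, \<eta>, P)" "is_operad_map V \<P> ?S P \<eta>"
      by (auto simp: hom_Op_iff)
    have teq: "mate A \<theta> = mate A \<eta>" using eq by (simp add: mate_arrow_def f g)
    have "\<theta> = \<eta>"
    proof (rule PiE_ext[OF fam[OF f(2)] fam[OF g(2)]])
      fix T assume T: "T \<in> Obj \<P>"
      show "\<theta> T = \<eta> T"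
      proof (rule K_eqI[OF A PiE_mem[OF fam[OF f(2)] T] PiE_mem[OF fam[OF g(2)] T]])
        fix t assume "t \<in> Obj \<O>" "FO F t = T"
        then show "\<theta> T \<cdot> inc A t = \<eta> T \<cdot> inc A t"
          using fun_cong[OF teq, of t] by (simp add: mate_def)
      qed
    qed
    then show "f = g" using f g by simp
  qed
  show "mate_arrow A P ` hom (Op V \<P>) ?S P = hom (Op V \<O>) A ?Q"
  proof (intro equalityI subsetI)
    fix h assume "h \<in> mate_arrow A P ` hom (Op V \<P>) ?S P"
    then obtain \<theta> where \<theta>: "is_operad_map V \<P> ?S P \<theta>" "h = (A, mate A \<theta>, ?Q)"
      by (auto simp: hom_Op_iff mate_arrow_def)
    then show "h \<in> hom (Op V \<O>) A ?Q"
      using is_operad_map_mate[OF A P fam[OF \<theta>(1)]] A Q by (simp add: hom_Op_iff)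
  next
    fix h assume "h \<in> hom (Op V \<O>) A ?Q"
    then obtain \<eta> where h: "h = (A, \<eta>, ?Q)" and \<eta>: "is_operad_map V \<O> A ?Q \<eta>" by (auto simp: hom_Op_iff)
    have \<eta>h: "\<eta> t \<in> hom V (ob A t) (ob P (FO F t))" if "t \<in> Obj \<O>" for t
      using OO.operad_map_hom[OF \<eta> that] that by simp
    have "\<exists>m. m \<in> hom V (K A T) (ob P T) \<and> (\<forall>t\<in>obj_fibre \<O> F T. m \<cdot> inc A t = \<eta> t)" if "T \<in> Obj \<P>" for T
      using K_ex1[OF A OP.operad_ob[OF P that], of T \<eta>] \<eta>h by blast
    then obtain m where m: "\<And>T. T \<in> Obj \<P> \<Longrightarrow> m T \<in> hom V (K A T) (ob P T)"
        "\<And>T t. T \<in> Obj \<P> \<Longrightarrow> t \<in> obj_fibre \<O> F T \<Longrightarrow> m T \<cdot> inc A t = \<eta> t"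
      by metis
    define \<theta> where "\<theta> = (\<lambda>T\<in>Obj \<P>. m T)"
    have \<theta>: "\<theta> \<in> (\<Pi>\<^sub>E T\<in>Obj \<P>. hom V (K A T) (ob P T))" using m(1) by (auto simp: \<theta>_def)
    have t\<theta>: "mate A \<theta> = \<eta>"
      by (rule extensionalityI[of _ "Obj \<O>"])
        (use m(2) OO.operad_map_extensional[OF \<eta>] in \<open>auto simp: mate_def \<theta>_def obj_fibre_def\<close>)
    then have "is_operad_map V \<P> ?S P \<theta>" using is_operad_map_mate[OF A P \<theta>] \<eta> by simp
    then have "(?S, \<theta>, P) \<in> hom (Op V \<P>) ?S P" using S P by (simp add: hom_Op_iff)
    moreover have "mate_arrow A P (?S, \<theta>, P) = h" using h t\<theta> by (simp add: mate_arrow_def)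
    ultimately show "h \<in> mate_arrow A P ` hom (Op V \<P>) ?S P" by blast
  qed
qed

text \<open>At \<open>t\<close> over \<open>T\<close> both sides are \<open>\<eta> T\<close> after
  \<open>\<zeta> T\<close> after the inclusion of \<open>B(t)\<close> after
  \<open>\<theta> t\<close>; on the left this uses the defining equation of
  \<open>shriek_map\<close>.\<close>

lemma mate_arrow_natural:
  assumes u: "u \<in> Arr (Op V \<O>)" and v: "v \<in> Arr (Op V \<P>)"
    and f: "f \<in> hom (Op V \<P>) (shriek_operad V \<O> \<P> F (Cod (Op V \<O>) u)) (Dom (Op V \<P>) v)"
  shows "mate_arrow (Dom (Op V \<O>) u) (Cod (Op V \<P>) v)
      (v \<cdot>\<^bsub>Op V \<P>\<^esub> f \<cdot>\<^bsub>Op V \<P>\<^esub> FA (shriek V \<O> \<P> F) u) =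
    FA (pullback \<O> \<P> F) v \<cdot>\<^bsub>Op V \<O>\<^esub> mate_arrow (Cod (Op V \<O>) u) (Dom (Op V \<P>) v) f \<cdot>\<^bsub>Op V \<O>\<^esub> u"
proof -
  obtain A \<theta> B where u': "u = (A, \<theta>, B)" by (cases u)
  obtain P \<eta> Q where v': "v = (P, \<eta>, Q)" by (cases v)
  obtain \<zeta> where f': "f = (shriek_operad V \<O> \<P> F B, \<zeta>, P)"
    and \<zeta>: "is_operad_map V \<P> (shriek_operad V \<O> \<P> F B) P \<zeta>"
    using f by (auto simp: hom_Op_iff u' v')
  have A: "is_operad V \<O> A" and B: "is_operad V \<O> B" and \<theta>: "is_operad_map V \<O> A B \<theta>"
    and \<eta>: "is_operad_map V \<P> P Q \<eta>"
    using u v by (auto simp: u' v')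
  have "(\<eta> (FO F t) \<cdot> \<zeta> (FO F t) \<cdot> shriek_map V \<O> F A B \<theta> (FO F t)) \<cdot> inc A t =
      \<eta> (FO F t) \<cdot> (\<zeta> (FO F t) \<cdot> inc B t) \<cdot> \<theta> t" if t: "t \<in> Obj \<O>" for t
  proof -
    have h: "\<zeta> (FO F t) \<in> hom V (K B (FO F t)) (ob P (FO F t))"
      using OP.operad_map_hom[OF \<zeta> F_Obj[OF t]] t by simp
    note i = inc_hom[OF A t] and s = shriek_map_hom[OF A B \<theta>] and e = OP.operad_map_hom[OF \<eta> F_Obj[OF t]]
    show ?thesis
      using Comp_assoc[OF i Comp_hom[OF s h] e] Comp_assoc[OF i s h] shriek_map_inc[OF A B \<theta> t]
        Comp_assoc[OF OO.operad_map_hom[OF \<theta> t] inc_hom[OF B t] h] by simp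
  qed
  then show ?thesis
    by (auto simp: u' v' f' mate_arrow_def mate_def intro!: restrict_ext)
qed

lemma shriek_left_adjoint:
  "is_left_adjoint (Op V \<O>) (Op V \<P>) (shriek V \<O> \<P> F) (pullback \<O> \<P> F)"
  unfolding is_left_adjoint_def
  using shriek_functor pullback_functor mate_arrow_bij mate_arrow_natural
  by (intro conjI exI[of _ mate_arrow] ballI) simp_all

end

theorem theorem2p4:
  fixes V :: "('vo, 'va) smc"
    and \<O> :: "('o, 'a) operadic"
    and \<P> :: "('p, 'b) operadic"
    and F :: "('o, 'a, 'p, 'b) fct"
  assumes "symmetric_monoidal_category V"
    and "is_closed V"
    and "complete_category TYPE('u) V"
    and "cocomplete_category TYPE('u) V"
    and "operadic_category \<O>"
    and "operadic_category \<P>"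
    and "small_category TYPE('u) \<O>"
    and "is_discrete_operadic_fibration \<O> \<P> F"
  shows "is_left_adjoint (Op V \<O>) (Op V \<P>) (shriek V \<O> \<P> F) (pullback \<O> \<P> F)"
proof -
  interpret symmetric_monoidal_category V by fact
  interpret O: operadic_category \<O> by fact
  interpret P: operadic_category \<P> by fact
  obtain h :: "'o \<Rightarrow> 'u" where h: "inj_on h (Obj \<O>)"
    using assms(7) by (auto simp: small_category_def)
  \<comment> \<open>Each fiber is a subset of \<open>Obj \<O>\<close>, so \<open>h\<close> embeds it
    into \<open>'u\<close> and its coproducts exist by cocompleteness.\<close>
  have "\<exists>K. is_coproduct V (obj_fibre \<O> F T) X K"
    if X: "\<And>t. t \<in> obj_fibre \<O> F T \<Longrightarrow> X t \<in> Obj V" for T X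
    by (rule small_coproduct_exists[OF assms(4) inj_on_subset[OF h] X])
      (auto simp: obj_fibre_def)
  then interpret discrete_fibration V \<O> \<P> F
    by unfold_locales (use assms in \<open>auto simp: is_discrete_operadic_fibration_def\<close>)
  show ?thesis by (rule shriek_left_adjoint)
qed

end
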